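(* Let $L$ be the linear operator $L v=(1-\phi^2)v'+\phi\phi' v$ on $L^2(\mathbb{R})$, where $\phi(\xi)=e^{-|\xi|}$, with domain $\mathrm{Dom}(L)=\{v\in L^2(\mathbb{R}) : (1-\phi^2)v'\in L^2(\mathbb{R})\}$. The spectrum of $L$ is $$\sigma(L)=\{\lambda\in\mathbb{C} : 0\le |\operatorname{Re}\lambda|\le 2\}.$$ Moreover, the point spectrum is $\sigma_{\rm p}(L)=\{\lambda\in\mathbb{C}: 0<|\operatorname{Re}\lambda|<2\}$, the continuous spectrum $\sigma_{\rm c}(L)$ is the union of the three lines $\operatorname{Re}\lambda=0$ and $\operatorname{Re}\lambda=\pm2$, and the residual spectrum $\sigma_{\rm r}(L)$ is empty.
   Context: All function spaces consist of complex-valued functions on $\mathbb{R}$ (variable $\xi$); $v'$ denotes the distributional derivative, and $\phi'(\xi)=-\operatorname{sgn}(\xi)e^{-|\xi|}$ for $\xi\ne0$. For a closed linear operator $A$ on a Banach space $X$ with domain $\mathrm{Dom}(A)\subset X$: the spectrum $\sigma(A)$ is the set of $\lambda\in\mathbb{C}$ such that $A-\lambda I:\mathrm{Dom}(A)\to X$ is not a bijection; the resolvent set is $\rho(A)=\mathbb{C}\setminus\sigma(A)$; the point spectrum is $\sigma_{\rm p}(A)=\{\lambda:\ker(A-\lambda I)\ne\{0\}\}$; the residual spectrum is $\sigma_{\rm r}(A)=\{\lambda:\ker(A-\lambda I)=\{0\},\ \overline{\mathrm{Ran}(A-\lambda I)}\neq X\}$; the continuous spectrum is $\sigma_{\rm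 c}(A)=\{\lambda:\ker(A-\lambda I)=\{0\},\ \overline{\mathrm{Ran}(A-\lambda I)}=X,\ \mathrm{Ran}(A-\lambda I)\ne X\}$. *)

theory Defs
  imports "HOL-Analysis.Analysis"
begin

section \<open>Complex normed spaces and the spectrum of an unbounded operator\<close>

class complex_normed_vector = real_normed_vector +
  fixes scaleC :: "complex \<Rightarrow> 'a \<Rightarrow> 'a"  (infixr "*\<^sub>C" 75)
  assumes scaleC_add_right: "a *\<^sub>C (x + y) = a *\<^sub>C x + a *\<^sub>C y"
    and scaleC_add_left: "(a + b) *\<^sub>C x = a *\<^sub>C x + b *\<^sub>C x"
    and scaleC_scaleC: "a *\<^sub>C b *\<^sub>C x = (a * b) *\<^sub>C x"
    and scaleC_of_real: "complex_of_real r *\<^sub>C x = r *\<^sub>R x"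
    and norm_scaleC: "norm (a *\<^sub>C x) = cmod a * norm x"

text \<open>An operator is given by its domain \<open>D\<close> and a function \<open>A\<close>, whose values outside \<open>D\<close> are
  irrelevant.\<close>

definition op_ker :: "'a::complex_normed_vector set \<Rightarrow> ('a \<Rightarrow> 'a) \<Rightarrow> complex \<Rightarrow> 'a set" where
  "op_ker D A \<mu> = {v \<in> D. A v - \<mu> *\<^sub>C v = 0}"

definition op_ran :: "'a::complex_normed_vector set \<Rightarrow> ('a \<Rightarrow> 'a) \<Rightarrow> complex \<Rightarrow> 'a set" where
  "op_ran D A \<mu> = (\<lambda>v. A v - \<mu> *\<^sub>C v) ` D"

definition spectrum :: "'a::complex_normed_vector set \<Rightarrow> ('a \<Rightarrow> 'a) \<Rightarrow> complex set" where
  "spectrum D A = {\<mu>. \<not> bij_betw (\<lambda>v. A v - \<mu> *\<^sub>C v) D UNIV}"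

definition point_spectrum :: "'a::complex_normed_vector set \<Rightarrow> ('a \<Rightarrow> 'a) \<Rightarrow> complex set" where
  "point_spectrum D A = {\<mu>. op_ker D A \<mu> \<noteq> {0}}"

definition residual_spectrum :: "'a::complex_normed_vector set \<Rightarrow> ('a \<Rightarrow> 'a) \<Rightarrow> complex set" where
  "residual_spectrum D A = {\<mu>. op_ker D A \<mu> = {0} \<and> closure (op_ran D A \<mu>) \<noteq> UNIV}"

definition continuous_spectrum :: "'a::complex_normed_vector set \<Rightarrow> ('a \<Rightarrow> 'a) \<Rightarrow> complex set" where
  "continuous_spectrum D A =
    {\<mu>. op_ker D A \<mu> = {0} \<and> closure (op_ran D A \<mu>) = UNIV \<and> op_ran D A \<mu> \<noteq> UNIV}"


section \<open>The space $L^2(\mathbb{R})$ of complex-valued functions\<close>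

definition square_integrable :: "(real \<Rightarrow> complex) \<Rightarrow> bool" where
  "square_integrable f \<longleftrightarrow>
    f \<in> borel_measurable lborel \<and> integrable lborel (\<lambda>x. (cmod (f x))\<^sup>2)"

lemma square_integrableD:
  assumes "square_integrable f"
  shows "f \<in> borel_measurable lborel" "f \<in> borel_measurable borel"
    "integrable lborel (\<lambda>x. (cmod (f x))\<^sup>2)"
  using assms by (auto simp: square_integrable_def)

lemma square_integrable_0: "square_integrable (\<lambda>x. 0)"
  by (simp add: square_integrable_def)

lemma square_integrable_bounded_mult:
  assumes f: "square_integrable f" and g: "g \<in> borel_measurable borel"
    and b: "\<And>x. cmod (g x) \<le> B"
  shows "square_integrable (\<lambda>x. g x * f x)"
  unfolding square_integrable_def
proof
  note [measurable] = square_integrableD(2)[OF f] g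
  show "(\<lambda>x. g x * f x) \<in> borel_measurable lborel" by measurable
  show "integrable lborel (\<lambda>x. (cmod (g x * f x))\<^sup>2)"
  proof (rule Bochner_Integration.integrable_bound)
    show "integrable lborel (\<lambda>x. B\<^sup>2 * (cmod (f x))\<^sup>2)"
      using square_integrableD(3)[OF f] by simp
    show "AE x in lborel. norm ((cmod (g x * f x))\<^sup>2) \<le> norm (B\<^sup>2 * (cmod (f x))\<^sup>2)"
      using b by (auto simp: norm_mult power_mult_distrib intro!: mult_right_mono power_mono)
  qed measurable
qed

lemma square_integrable_cmult: "square_integrable f \<Longrightarrow> square_integrable (\<lambda>x. c * f x)"
  by (rule square_integrable_bounded_mult[where B = "cmod c"]) auto

lemma cmod_add_power2_le:
  fixes s :: real
  assumes "s > 0"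
  shows "(cmod (x + y))\<^sup>2 \<le> (1 + s) * (cmod x)\<^sup>2 + (1 + 1 / s) * (cmod y)\<^sup>2"
proof -
  have "0 \<le> (s * cmod x - cmod y)\<^sup>2 / s" using assms by simp
  also have "\<dots> = s * (cmod x)\<^sup>2 + (1 / s) * (cmod y)\<^sup>2 - 2 * cmod x * cmod y"
    using assms by (simp add: power2_eq_square field_simps)
  finally have "2 * cmod x * cmod y \<le> s * (cmod x)\<^sup>2 + (1 / s) * (cmod y)\<^sup>2" by simp
  moreover have "(cmod (x + y))\<^sup>2 \<le> (cmod x + cmod y)\<^sup>2"
    by (simp add: norm_triangle_ineq power_mono)
  ultimately show ?thesis by (simp add: power2_sum algebra_simps)
qed

lemma square_integrable_add:
  assumes f: "square_integrable f" and g: "square_integrable g"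
  shows "square_integrable (\<lambda>x. f x + g x)"
  unfolding square_integrable_def
proof
  note [measurable] = square_integrableD(2)[OF f] square_integrableD(2)[OF g]
  show "(\<lambda>x. f x + g x) \<in> borel_measurable lborel" by measurable
  show "integrable lborel (\<lambda>x. (cmod (f x + g x))\<^sup>2)"
  proof (rule Bochner_Integration.integrable_bound)
    show "integrable lborel (\<lambda>x. (1 + 1) * (cmod (f x))\<^sup>2 + (1 + 1 / 1) * (cmod (g x))\<^sup>2)"
      using square_integrableD(3)[OF f] square_integrableD(3)[OF g] by simp
    show "AE x in lborel. norm ((cmod (f x + g x))\<^sup>2)
        \<le> norm ((1 + 1) * (cmod (f x))\<^sup>2 + (1 + 1 / 1) * (cmod (g x))\<^sup>2)"
      using cmod_add_power2_le[of 1] by auto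
  qed measurable
qed

definition l2_norm :: "(real \<Rightarrow> complex) \<Rightarrow> real" where
  "l2_norm f = sqrt (LINT x|lborel. (cmod (f x))\<^sup>2)"

lemma l2_norm_power2: "(l2_norm f)\<^sup>2 = (LINT x|lborel. (cmod (f x))\<^sup>2)"
  by (simp add: l2_norm_def)

lemma l2_norm_ge_0: "l2_norm f \<ge> 0"
  by (simp add: l2_norm_def)

lemma l2_norm_eq_0_iff:
  assumes f: "square_integrable f"
  shows "l2_norm f = 0 \<longleftrightarrow> (AE x in lborel. f x = 0)"
  using integral_nonneg_eq_0_iff_AE[OF square_integrableD(3)[OF f]]
  by (simp add: l2_norm_def)

lemma l2_norm_cong_AE:
  assumes f: "square_integrable f" and g: "square_integrable g"
    and eq: "AE x in lborel. f x = g x"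
  shows "l2_norm f = l2_norm g"
proof -
  note [measurable] = square_integrableD(2)[OF f] square_integrableD(2)[OF g]
  have "(LINT x|lborel. (cmod (f x))\<^sup>2) = (LINT x|lborel. (cmod (g x))\<^sup>2)"
    using eq by (intro integral_cong_AE) auto
  then show ?thesis by (simp add: l2_norm_def)
qed

lemma l2_norm_cmult: "l2_norm (\<lambda>x. c * f x) = cmod c * l2_norm f"
  by (simp add: l2_norm_def norm_mult power_mult_distrib real_sqrt_mult)

lemma l2_norm_triangle:
  assumes f: "square_integrable f" and g: "square_integrable g"
  shows "l2_norm (\<lambda>x. f x + g x) \<le> l2_norm f + l2_norm g"
proof -
  note fg = square_integrable_add[OF f g]
  consider "l2_norm f = 0" | "l2_norm g = 0" | "l2_norm f > 0" "l2_norm g > 0"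
    using l2_norm_ge_0[of f] l2_norm_ge_0[of g] by linarith
  then show ?thesis
  proof cases
    case 1
    then have "l2_norm (\<lambda>x. f x + g x) = l2_norm g"
      using l2_norm_eq_0_iff[OF f] by (intro l2_norm_cong_AE fg g) auto
    then show ?thesis using 1 by simp
  next
    case 2
    then have "l2_norm (\<lambda>x. f x + g x) = l2_norm f"
      using l2_norm_eq_0_iff[OF g] by (intro l2_norm_cong_AE fg f) auto
    then show ?thesis using 2 by simp
  next
    case 3
    define s where "s = l2_norm g / l2_norm f"
    have s: "s > 0" using 3 by (simp add: s_def)
    have "(l2_norm (\<lambda>x. f x + g x))\<^sup>2 \<le>
        (LINT x|lborel. (1 + s) * (cmod (f x))\<^sup>2 + (1 + 1 / s) * (cmod (g x))\<^sup>2)"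
      unfolding l2_norm_power2
      using square_integrableD(3)[OF f] square_integrableD(3)[OF g] square_integrableD(3)[OF fg]
      by (intro integral_mono Bochner_Integration.integrable_add integrable_mult_right cmod_add_power2_le s)
    also have "\<dots> = (1 + s) * (l2_norm f)\<^sup>2 + (1 + 1 / s) * (l2_norm g)\<^sup>2"
      unfolding l2_norm_power2
      using square_integrableD(3)[OF f] square_integrableD(3)[OF g] by simp
    also have "\<dots> = (l2_norm f + l2_norm g)\<^sup>2"
      using 3 by (simp add: s_def power2_eq_square field_simps)
    finally show ?thesis
      by (rule power2_le_imp_le) (use 3 in simp)
  qed
qed

definition l2_rel :: "(real \<Rightarrow> complex) \<Rightarrow> (real \<Rightarrow> complex) \<Rightarrow> bool" where
  "l2_rel f g \<longleftrightarrow> square_integrable f \<and> square_integrable g \<and> (AE x in lborel. f x = g x)"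

lemma part_equivp_l2_rel: "part_equivp l2_rel"
proof (rule part_equivpI)
  show "\<exists>f. l2_rel f f"
    using square_integrable_0 by (auto simp: l2_rel_def)
  show "symp l2_rel"
    by (auto simp: symp_def l2_rel_def)
  have "AE x in lborel. f x = h x"
    if "AE x in lborel. f x = g x" "AE x in lborel. g x = h x" for f g h :: "real \<Rightarrow> complex"
    using that by eventually_elim simp
  then show "transp l2_rel"
    unfolding transp_def l2_rel_def by blast
qed

quotient_type L2 = "real \<Rightarrow> complex" / partial: l2_rel
  by (rule part_equivp_l2_rel)

instantiation L2 :: ab_group_add
begin

lift_definition zero_L2 :: L2 is "\<lambda>x. 0"
  by (simp add: l2_rel_def square_integrable_0)

lift_definition plus_L2 :: "L2 \<Rightarrow> L2 \<Rightarrow> L2" is "\<lambda>f g x. f x + g x"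
  by (auto simp: l2_rel_def square_integrable_add)

lift_definition uminus_L2 :: "L2 \<Rightarrow> L2" is "\<lambda>f x. - f x"
  using square_integrable_cmult[of _ "-1"] by (auto simp: l2_rel_def)

definition minus_L2 :: "L2 \<Rightarrow> L2 \<Rightarrow> L2" where "minus_L2 u v = u + - v"

instance
proof
  fix a b c :: L2
  show "a + b + c = a + (b + c)"
    by transfer (auto simp: l2_rel_def square_integrable_add add.assoc)
  show "a + b = b + a"
    by transfer (auto simp: l2_rel_def square_integrable_add add.commute)
  show "0 + a = a" by transfer (auto simp: l2_rel_def)
  show "- a + a = 0"
    by transfer (auto simp: l2_rel_def square_integrable_0)
  show "a - b = a + - b" by (rule minus_L2_def)
qed

end

instantiation L2 :: complex_normed_vector
begin

lift_definition scaleC_L2 :: "complex \<Rightarrow> L2 \<Rightarrow> L2" is "\<lambda>c f x. c * f x"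
  by (auto simp: l2_rel_def square_integrable_cmult)

definition scaleR_L2 :: "real \<Rightarrow> L2 \<Rightarrow> L2" where "scaleR_L2 r u = complex_of_real r *\<^sub>C u"

lift_definition norm_L2 :: "L2 \<Rightarrow> real" is l2_norm
  by (auto simp: l2_rel_def intro: l2_norm_cong_AE)

definition sgn_L2 :: "L2 \<Rightarrow> L2" where "sgn_L2 u = inverse (norm u) *\<^sub>R u"

definition dist_L2 :: "L2 \<Rightarrow> L2 \<Rightarrow> real" where "dist_L2 u v = norm (u - v)"

definition uniformity_L2 :: "(L2 \<times> L2) filter" where
  "uniformity_L2 = (INF e\<in>{0 <..}. principal {(x, y). dist x y < e})"

definition open_L2 :: "L2 set \<Rightarrow> bool" where
  "open_L2 U \<longleftrightarrow> (\<forall>x\<in>U. \<forall>\<^sub>F (x', y) in uniformity. x' = x \<longrightarrow> y \<in> U)"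

instance
proof
  fix a b :: complex and r s :: real and x y :: L2 and U :: "L2 set"
  show CaddR: "a *\<^sub>C (x + y) = a *\<^sub>C x + a *\<^sub>C y" for a and x y :: L2
    by transfer (simp add: l2_rel_def algebra_simps square_integrable_add square_integrable_cmult)
  show CaddL: "(a + b) *\<^sub>C x = a *\<^sub>C x + b *\<^sub>C x" for a b and x :: L2
    by transfer (simp add: l2_rel_def algebra_simps square_integrable_add square_integrable_cmult)
  show CC: "a *\<^sub>C b *\<^sub>C x = (a * b) *\<^sub>C x" for a b and x :: L2
    by transfer (simp add: l2_rel_def mult.assoc square_integrable_cmult)
  show "complex_of_real r *\<^sub>C x = r *\<^sub>R x" by (simp add: scaleR_L2_def)
  show CN: "norm (a *\<^sub>C x) = cmod a * norm x" for a and x :: L2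
    by transfer (rule l2_norm_cmult)
  show "r *\<^sub>R (x + y) = r *\<^sub>R x + r *\<^sub>R y" by (simp add: scaleR_L2_def CaddR)
  show "(r + s) *\<^sub>R x = r *\<^sub>R x + s *\<^sub>R x" by (simp add: scaleR_L2_def CaddL)
  show "r *\<^sub>R s *\<^sub>R x = (r * s) *\<^sub>R x" by (simp add: scaleR_L2_def CC)
  show "1 *\<^sub>R x = x"
    unfolding scaleR_L2_def by transfer (auto simp: l2_rel_def)
  show "norm (r *\<^sub>R x) = \<bar>r\<bar> * norm x" by (simp add: scaleR_L2_def CN)
  show "norm x = 0 \<longleftrightarrow> x = 0"
    by transfer (auto simp: l2_rel_def l2_norm_eq_0_iff square_integrable_0)
  show "norm (x + y) \<le> norm x + norm y"
    by transfer (auto simp: l2_rel_def intro: l2_norm_triangle)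
  show "sgn x = inverse (norm x) *\<^sub>R x" by (rule sgn_L2_def)
  show "dist x y = norm (x - y)" by (rule dist_L2_def)
  show "uniformity = (INF e\<in>{0 <..}. principal {(x, y :: L2). dist x y < e})"
    by (rule uniformity_L2_def)
  show "open U \<longleftrightarrow> (\<forall>x\<in>U. \<forall>\<^sub>F (x', y) in uniformity. x' = x \<longrightarrow> y \<in> U)"
    by (rule open_L2_def)
qed

end


section \<open>Distributional derivatives\<close>

definition test_function :: "(real \<Rightarrow> complex) \<Rightarrow> bool" where
  "test_function \<psi> \<longleftrightarrow>
    (\<exists>d :: nat \<Rightarrow> real \<Rightarrow> complex. d 0 = \<psi> \<and>
      (\<forall>n x. (d n has_vector_derivative d (Suc n) x) (at x))) \<and>
    compact (closure {x. \<psi> x \<noteq> 0})"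

lemma test_function_measurable:
  assumes "test_function \<psi>"
  shows "\<psi> \<in> borel_measurable borel"
proof -
  from assms obtain \<psi>' where "\<And>x. (\<psi> has_vector_derivative \<psi>' x) (at x)"
    unfolding test_function_def by metis
  then show ?thesis
    by (intro borel_measurable_continuous_onI continuous_at_imp_continuous_on ballI
        has_vector_derivative_continuous)
qed

text \<open>The pairing $\langle v', \theta\rangle = -\int v \theta'$. For $v \in L^2$ it makes sense for
  every compactly supported Lipschitz function $\theta$; the classical derivative
  of \<open>\<theta>\<close> then exists almost everywhere, and the arbitrary value of
  \<^const>\<open>vector_derivative\<close> on the remaining null set does not matter.\<close>

definition deriv_pairing :: "(real \<Rightarrow> complex) \<Rightarrow> (real \<Rightarrow> complex) \<Rightarrow> complex" where
  "deriv_pairing v \<theta> = - (LINT x|lborel. v x * vector_derivative \<theta> (at x))"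


section \<open>The operator\<close>

definition phi :: "real \<Rightarrow> real" where
  "phi \<xi> = exp (- \<bar>\<xi>\<bar>)"

text \<open>The value at \<open>0\<close> is immaterial.\<close>

definition phi' :: "real \<Rightarrow> real" where
  "phi' \<xi> = - sgn \<xi> * exp (- \<bar>\<xi>\<bar>)"

lemma phi_measurable [measurable]: "phi \<in> borel_measurable borel"
  unfolding phi_def by measurable

lemma phi'_measurable [measurable]: "phi' \<in> borel_measurable borel"
  unfolding phi'_def by measurable

lemma phi_has_derivative:
  assumes "\<xi> \<noteq> 0"
  shows "(phi has_real_derivative phi' \<xi>) (at \<xi>)"
proof (cases "\<xi> > 0")
  case True
  have "((\<lambda>x. exp (- x)) has_real_derivative phi' \<xi>) (at \<xi>)"
    using True by (auto intro!: derivative_eq_intros simp: phi'_def)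
  then show ?thesis
    by (rule has_field_derivative_transform_within_open[where S = "{0<..}"])
      (use True in \<open>auto simp: phi_def\<close>)
next
  case False
  have "(exp has_real_derivative phi' \<xi>) (at \<xi>)"
    using False assms by (auto intro!: derivative_eq_intros simp: phi'_def)
  then show ?thesis
    by (rule has_field_derivative_transform_within_open[where S = "{..<0}"])
      (use False assms in \<open>auto simp: phi_def\<close>)
qed

lemma weighted_test_vector_derivative:
  assumes "(\<psi> has_vector_derivative \<psi>') (at \<xi>)" "\<xi> \<noteq> 0"
  shows "((\<lambda>\<xi>. complex_of_real (1 - (phi \<xi>)\<^sup>2) * \<psi> \<xi>) has_vector_derivative
    (complex_of_real (1 - (phi \<xi>)\<^sup>2) * \<psi>' + complex_of_real (- 2 * phi \<xi> * phi' \<xi>) * \<psi> \<xi>)) (at \<xi>)"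
proof -
  have "((\<lambda>\<xi>. 1 - (phi \<xi>)\<^sup>2) has_real_derivative - 2 * phi \<xi> * phi' \<xi>) (at \<xi>)"
    using phi_has_derivative[OF assms(2)] by (auto intro!: derivative_eq_intros)
  then have "((\<lambda>\<xi>. (1 - (phi \<xi>)\<^sup>2) *\<^sub>R \<psi> \<xi>) has_vector_derivative
      ((1 - (phi \<xi>)\<^sup>2) *\<^sub>R \<psi>' + (- 2 * phi \<xi> * phi' \<xi>) *\<^sub>R \<psi> \<xi>)) (at \<xi>)"
    using assms(1) by (rule has_vector_derivative_scaleR)
  then show ?thesis by (simp only: scaleR_conv_of_real)
qed

lemma weighted_test_deriv_measurable:
  assumes "test_function \<psi>"
  shows "(\<lambda>\<xi>. vector_derivative (\<lambda>\<xi>. complex_of_real (1 - (phi \<xi>)\<^sup>2) * \<psi> \<xi>) (at \<xi>))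
    \<in> borel_measurable lborel"
proof -
  from assms obtain d :: "nat \<Rightarrow> real \<Rightarrow> complex" where d0: "d 0 = \<psi>"
    and d: "\<And>n x. (d n has_vector_derivative d (Suc n) x) (at x)"
    by (auto simp: test_function_def)
  have "continuous_on UNIV (d n)" for n
    using d[of n] by (auto intro!: continuous_at_imp_continuous_on has_vector_derivative_continuous)
  then have m [measurable]: "d n \<in> borel_measurable borel" for n
    by (rule borel_measurable_continuous_onI)
  have "(\<lambda>\<xi>. complex_of_real (1 - (phi \<xi>)\<^sup>2) * d 1 \<xi> +
      complex_of_real (- 2 * phi \<xi> * phi' \<xi>) * d 0 \<xi>) \<in> borel_measurable lborel"
    by measurable
  then show ?thesis
  proof (rule measurable_discrete_difference[where X = "{0}"])
    fix x :: real
    assume "x \<notin> {0}"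
    then show "complex_of_real (1 - (phi x)\<^sup>2) * d 1 x +
        complex_of_real (- 2 * phi x * phi' x) * d 0 x =
        vector_derivative (\<lambda>\<xi>. complex_of_real (1 - (phi \<xi>)\<^sup>2) * \<psi> \<xi>) (at x)"
      using vector_derivative_at[OF weighted_test_vector_derivative[OF d[of 0 x]]]
      by (simp add: d0)
  qed auto
qed

text \<open>\<open>is_weighted_deriv v w\<close> says that the distribution $(1 - \phi^2) v'$ equals
  \<open>w\<close>. As $1 - \phi^2$ is Lipschitz but not smooth at \<open>0\<close>, its product with the distribution
  $v' \in H^{-1}(\mathbb{R})$ is taken by duality:
  $\langle (1 - \phi^2) v', \psi\rangle = \langle v', (1 - \phi^2)\psi\rangle$.\<close>

lift_definition is_weighted_deriv :: "L2 \<Rightarrow> L2 \<Rightarrow> bool" is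
  "\<lambda>v w. \<forall>\<psi>. test_function \<psi> \<longrightarrow>
    (LINT \<xi>|lborel. w \<xi> * \<psi> \<xi>) =
    deriv_pairing v (\<lambda>\<xi>. complex_of_real (1 - (phi \<xi>)\<^sup>2) * \<psi> \<xi>)"
proof -
  fix v1 v2 w1 w2
  assume v: "l2_rel v1 v2" and w: "l2_rel w1 w2"
  have "(LINT \<xi>|lborel. w1 \<xi> * \<psi> \<xi>) = (LINT \<xi>|lborel. w2 \<xi> * \<psi> \<xi>)"
    "deriv_pairing v1 (\<lambda>\<xi>. complex_of_real (1 - (phi \<xi>)\<^sup>2) * \<psi> \<xi>) =
     deriv_pairing v2 (\<lambda>\<xi>. complex_of_real (1 - (phi \<xi>)\<^sup>2) * \<psi> \<xi>)"
    if t: "test_function \<psi>" for \<psi>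
  proof -
    note [measurable] = test_function_measurable[OF t]
    have [measurable]: "v1 \<in> borel_measurable borel" "v2 \<in> borel_measurable borel"
      "w1 \<in> borel_measurable borel" "w2 \<in> borel_measurable borel"
      using v w by (auto simp: l2_rel_def square_integrableD)
    define \<theta>' where "\<theta>' = (\<lambda>\<xi>. vector_derivative
      (\<lambda>\<xi>. complex_of_real (1 - (phi \<xi>)\<^sup>2) * \<psi> \<xi>) (at \<xi>))"
    have [measurable]: "\<theta>' \<in> borel_measurable borel"
      using weighted_test_deriv_measurable[OF t] by (simp add: \<theta>'_def)
    have *: "AE \<xi> in lborel. v1 \<xi> = v2 \<xi>" "AE \<xi> in lborel. w1 \<xi> = w2 \<xi>"
      using v w by (simp_all add: l2_rel_def)
    show "(LINT \<xi>|lborel. w1 \<xi> * \<psi> \<xi>) = (LINT \<xi>|lborel. w2 \<xi> * \<psi> \<xi>)"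
    proof (rule integral_cong_AE)
      show "AE \<xi> in lborel. w1 \<xi> * \<psi> \<xi> = w2 \<xi> * \<psi> \<xi>"
        using *(2) by eventually_elim simp
    qed measurable
    have "(LINT \<xi>|lborel. v1 \<xi> * \<theta>' \<xi>) = (LINT \<xi>|lborel. v2 \<xi> * \<theta>' \<xi>)"
    proof (rule integral_cong_AE)
      show "AE \<xi> in lborel. v1 \<xi> * \<theta>' \<xi> = v2 \<xi> * \<theta>' \<xi>"
        using *(1) by eventually_elim simp
    qed measurable
    then show "deriv_pairing v1 (\<lambda>\<xi>. complex_of_real (1 - (phi \<xi>)\<^sup>2) * \<psi> \<xi>) =
      deriv_pairing v2 (\<lambda>\<xi>. complex_of_real (1 - (phi \<xi>)\<^sup>2) * \<psi> \<xi>)"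
      by (simp only: deriv_pairing_def \<theta>'_def)
  qed
  then show "(\<forall>\<psi>. test_function \<psi> \<longrightarrow> (LINT \<xi>|lborel. w1 \<xi> * \<psi> \<xi>) =
      deriv_pairing v1 (\<lambda>\<xi>. complex_of_real (1 - (phi \<xi>)\<^sup>2) * \<psi> \<xi>)) =
    (\<forall>\<psi>. test_function \<psi> \<longrightarrow> (LINT \<xi>|lborel. w2 \<xi> * \<psi> \<xi>) =
      deriv_pairing v2 (\<lambda>\<xi>. complex_of_real (1 - (phi \<xi>)\<^sup>2) * \<psi> \<xi>))"
    by (intro iff_allI imp_cong refl) simp
qed

lift_definition mult_phi_phi' :: "L2 \<Rightarrow> L2" is
  "\<lambda>v \<xi>. complex_of_real (phi \<xi> * phi' \<xi>) * v \<xi>"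
proof -
  have "cmod (complex_of_real (phi \<xi> * phi' \<xi>)) \<le> 1" for \<xi>
    by (auto simp: phi_def phi'_def abs_mult sgn_real_def norm_mult mult_le_one)
  then have "square_integrable (\<lambda>\<xi>. complex_of_real (phi \<xi> * phi' \<xi>) * v \<xi>)"
    if "square_integrable v" for v
    using that by (intro square_integrable_bounded_mult[where B = 1]) measurable
  then show "l2_rel v1 v2 \<Longrightarrow> l2_rel (\<lambda>\<xi>. complex_of_real (phi \<xi> * phi' \<xi>) * v1 \<xi>)
      (\<lambda>\<xi>. complex_of_real (phi \<xi> * phi' \<xi>) * v2 \<xi>)" for v1 v2
    by (auto simp: l2_rel_def)
qed

definition Dom_L :: "L2 set" where
  "Dom_L = {v. \<exists>w. is_weighted_deriv v w}"

text \<open>On \<^const>\<open>Dom_L\<close> the description is proper: an element of $L^2(\mathbb{R})$ is determined by its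
  integrals against test functions.\<close>

definition L :: "L2 \<Rightarrow> L2" where
  "L v = (THE w. is_weighted_deriv v w) + mult_phi_phi' v"

end

theory Submission
  imports Defs
begin

text \<open>The coefficient \<open>1 - \<phi>\<^sup>2\<close> vanishes at \<open>0\<close>, so \<open>L\<close> decouples into two first order operators on the half
  lines, and \<open>x \<mapsto> -x\<close> exchanges the right one with minus the left one. On \<open>x > 0\<close> take the travel time
  \<open>s = x + ln (1 - \<phi>\<^sup>2) / 2\<close>, for which \<open>(1 - \<phi>\<^sup>2) d/dx = d/ds\<close>. The homogeneous equation
  \<open>(L - \<mu>) h = 0\<close> has the solution \<open>h = sqrt (1 - \<phi>\<^sup>2) exp (\<mu> s)\<close>, which is square integrable at infinity
  iff \<open>Re \<mu> < 0\<close> and at zero iff \<open>Re \<mu> > -2\<close>. Hence on the right half line there is a kernel for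
  \<open>-2 < Re \<mu> < 0\<close>; outside the closed strip variation of constants gives a bounded inverse by a Schur
  test; on its boundary lines the range is dense but proper, as seen by perturbing \<open>\<mu>\<close> and by an
  explicit right-hand side. Combining \<open>\<mu>\<close> on the right with \<open>-\<mu>\<close> on the left gives the spectrum.\<close>

section \<open>Smooth functions and bumps\<close>

text \<open>The strip is found by measuring in \<open>s\<close>. Since
  \<open>dx = weight ds\<close>, the mass of \<open>fsol \<mu>\<close> is the integral of
  \<open>weight\<^sup>2 exp (2 Re \<mu> s) ds\<close> over the whole line. As \<open>weight\<close>
  tends to 1 at the upper end and behaves like \<open>exp (2 s)\<close> at the lower one, the
  critical exponents are \<open>2 Re \<mu>\<close> and \<open>4 + 2 Re \<mu>\<close>. The strip of
  the right half line and the reflected strip of the left one touch exactly along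
  \<open>Re \<mu> = 0\<close>; on \<open>Re \<mu> = 2\<close> and \<open>Re \<mu> = -2\<close> one
  half is critical and the other has a bounded inverse.

  The obstacle is that the domain is given by a weak condition tested across 0. A given
  \<open>v\<close> must first be shown to be a classical solution off 0, which requires a supply of
  test functions. Conversely, half line solutions extended by 0 must pass against test functions
  that do not vanish at 0, so the boundary term \<open>weight * fsol \<mu> * \<psi>\<close> has to
  vanish there. It does for \<open>Re \<mu> > -2\<close>; for \<open>Re \<mu> < -2\<close> the
  kernels used start at a positive point.\<close>

definition smooth_fun :: "(real \<Rightarrow> complex) \<Rightarrow> bool" where
  "smooth_fun f \<longleftrightarrow> (\<exists>d :: nat \<Rightarrow> real \<Rightarrow> complex. d 0 = f \<and>
      (\<forall>n x. (d n has_vector_derivative d (Suc n) x) (at x)))"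

lemma test_function_iff: "test_function f \<longleftrightarrow> smooth_fun f \<and> compact (closure {x. f x \<noteq> 0})"
  by (auto simp: test_function_def smooth_fun_def)

text \<open>Coinduction for smoothness: if every member of a class has a derivative in the same
  class, dependent choice strings these derivatives into the infinite sequence that smoothness asks
  for.\<close>

lemma smooth_funI:
  assumes "P f" and "\<And>f. P f \<Longrightarrow> \<exists>f'. P f' \<and> (\<forall>x. (f has_vector_derivative f' x) (at x))"
  shows "smooth_fun f"
proof -
  have "\<exists>d. \<forall>n. (P (d n) \<and> (n = 0 \<longrightarrow> d n = f)) \<and> (\<forall>x. (d n has_vector_derivative d (Suc n) x) (at x))"
    by (rule dependent_nat_choice) (use assms in auto)
  then show ?thesis unfolding smooth_fun_def by metis
qed

lemma smooth_fun_derivE: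
  assumes "smooth_fun f"
  obtains f' where "smooth_fun f'" "\<And>x. (f has_vector_derivative f' x) (at x)"
proof -
  from assms obtain d where d: "d 0 = f" "\<And>n x. (d n has_vector_derivative d (Suc n) x) (at x)"
    unfolding smooth_fun_def by blast
  have "smooth_fun (d 1)"
    unfolding smooth_fun_def by (rule exI[of _ "\<lambda>n. d (Suc n)"]) (use d in auto)
  moreover have "(f has_vector_derivative d 1 x) (at x)" for x
    using d(2)[of 0 x] by (simp add: d(1))
  ultimately show thesis by (rule that)
qed

lemma smooth_fun_antideriv:
  assumes "smooth_fun f'" "\<And>x. (f has_vector_derivative f' x) (at x)"
  shows "smooth_fun f"
proof -
  from assms(1) obtain d where d: "d 0 = f'" "\<And>n x. (d n has_vector_derivative d (Suc n) x) (at x)"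
    unfolding smooth_fun_def by blast
  show ?thesis unfolding smooth_fun_def
    by (rule exI[of _ "case_nat f d"]) (use d assms(2) in \<open>auto split: nat.split\<close>)
qed

lemma smooth_fun_imp_continuous: "smooth_fun f \<Longrightarrow> continuous_on S f"
  by (metis smooth_fun_derivE continuous_at_imp_continuous_on has_vector_derivative_continuous)

text \<open>One shape covers differences of rescaled steps, reflections, and (with
  \<open>b = 0\<close>) a single function. Differentiation only changes the coefficients to
  \<open>a * p\<close> and \<open>b * r\<close> and leaves the affine arguments alone, so the class
  for the coinduction keeps \<open>p\<close>, \<open>q\<close>, \<open>r\<close>, \<open>s\<close>
  fixed.\<close>

lemma smooth_fun_affine_comb:
  assumes "smooth_fun f" "smooth_fun g"
  shows "smooth_fun (\<lambda>x. a * f (p * x + q) + b * g (r * x + s))"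
proof (rule smooth_funI[where P = "\<lambda>h. \<exists>f g a b. smooth_fun f \<and> smooth_fun g \<and>
    h = (\<lambda>x. a * f (p * x + q) + b * g (r * x + s))"])
  show "\<exists>f' g' a' b'. smooth_fun f' \<and> smooth_fun g' \<and>
    (\<lambda>x. a * f (p * x + q) + b * g (r * x + s)) = (\<lambda>x. a' * f' (p * x + q) + b' * g' (r * x + s))"
    using assms by blast
next
  fix h assume "\<exists>f g a b. smooth_fun f \<and> smooth_fun g \<and>
    h = (\<lambda>x. a * f (p * x + q) + b * g (r * x + s))"
  then obtain f g a b where fg: "smooth_fun f" "smooth_fun g"
    and h: "h = (\<lambda>x. a * f (p * x + q) + b * g (r * x + s))" by blast
  obtain f' where f': "smooth_fun f'" "\<And>x. (f has_vector_derivative f' x) (at x)"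
    using fg(1) by (rule smooth_fun_derivE) blast
  obtain g' where g': "smooth_fun g'" "\<And>x. (g has_vector_derivative g' x) (at x)"
    using fg(2) by (rule smooth_fun_derivE) blast
  have c: "((\<lambda>x. k (u * x + t)) has_vector_derivative u * k' (u * x + t)) (at x)"
    if "\<And>x. (k has_vector_derivative k' x) (at x)" for k k' :: "real \<Rightarrow> complex" and u t x
  proof -
    have "((\<lambda>x. u * x + t) has_real_derivative u) (at x)"
      by (auto intro!: derivative_eq_intros)
    then have "((\<lambda>x. u * x + t) has_vector_derivative u) (at x)"
      by (simp add: has_real_derivative_iff_has_vector_derivative)
    from vector_diff_chain_at[OF this that]
    show ?thesis by (simp add: o_def scaleR_conv_of_real)
  qed
  have "(h has_vector_derivative (a * p) * f' (p * x + q) + (b * r) * g' (r * x + s)) (at x)" for x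
    unfolding h by (rule derivative_eq_intros c[OF f'(2)] c[OF g'(2)] refl)+ simp
  then show "\<exists>f'. (\<exists>f g a b. smooth_fun f \<and> smooth_fun g \<and>
      f' = (\<lambda>x. a * f (p * x + q) + b * g (r * x + s))) \<and> (\<forall>x. (h has_vector_derivative f' x) (at x))"
    using f'(1) g'(1) by blast
qed

lemma compact_support_iff:
  fixes f :: "real \<Rightarrow> complex"
  shows "compact (closure {x. f x \<noteq> 0}) \<longleftrightarrow> (\<exists>M>0. \<forall>x. \<bar>x\<bar> \<ge> M \<longrightarrow> f x = 0)"
proof
  assume "compact (closure {x. f x \<noteq> 0})"
  then have "bounded {x. f x \<noteq> 0}"
    by (metis bounded_subset closure_subset compact_imp_bounded)
  then obtain M where "M > 0" "\<forall>x\<in>{x. f x \<noteq> 0}. norm x < M"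
    by (metis bounded_pos_less)
  then show "\<exists>M>0. \<forall>x. \<bar>x\<bar> \<ge> M \<longrightarrow> f x = 0"
    by (intro exI[of _ M]) force
next
  assume "\<exists>M>0. \<forall>x. \<bar>x\<bar> \<ge> M \<longrightarrow> f x = 0"
  then obtain M where "\<forall>x. \<bar>x\<bar> \<ge> M \<longrightarrow> f x = 0" by blast
  then have "bounded {x. f x \<noteq> 0}"
    by (intro boundedI[of _ M]) (auto intro: ccontr)
  then show "compact (closure {x. f x \<noteq> 0})" by simp
qed

lemma test_functionE:
  assumes "test_function f"
  obtains f' M where "M > 0" "\<And>x. (f has_vector_derivative f' x) (at x)" "continuous_on UNIV f'"
    "\<And>x. \<bar>x\<bar> \<ge> M \<Longrightarrow> f x = 0" "\<And>x. \<bar>x\<bar> \<ge> M \<Longrightarrow> f' x = 0" "test_function f'"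
proof -
  from assms have "smooth_fun f" by (simp add: test_function_iff)
  then obtain f' where f': "smooth_fun f'" "\<And>x. (f has_vector_derivative f' x) (at x)"
    by (rule smooth_fun_derivE) blast
  obtain M where M: "M > 0" "\<And>x. \<bar>x\<bar> \<ge> M \<Longrightarrow> f x = 0"
    using assms unfolding test_function_iff compact_support_iff by blast
  have z: "f' x = 0" if "\<bar>x\<bar> \<ge> M + 1" for x
  proof -
    have "((\<lambda>x. 0) has_vector_derivative f' x) (at x)"
    proof (rule has_vector_derivative_transform_within_open[OF f'(2), of "- {-M..M}"])
      show "open (- {- M..M})" "x \<in> - {-M..M}"
        using that M(1) by (auto intro: open_Compl)
      show "\<And>x. x \<in> - {-M..M} \<Longrightarrow> f x = 0"
        using M(2) by force
    qed
    then show ?thesis by (metis vector_derivative_at has_vector_derivative_const)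
  qed
  show thesis
  proof
    show "M + 1 > 0" using M by simp
    show "test_function f'"
      unfolding test_function_iff compact_support_iff using f'(1) z \<open>M + 1 > 0\<close> by blast
  qed (use f' M z smooth_fun_imp_continuous in auto)
qed

section \<open>A compactly supported smooth bump and the smooth step made from it\<close>

lemma exp_neg_inverse_le:
  fixes t :: real
  assumes "t > 0"
  shows "exp (- 1 / t) / t ^ n \<le> fact (n + 2) * t ^ 2"
proof -
  have "(1 / t) ^ (n + 2) / fact (n + 2) \<le> exp (1 / t)"
  proof -
    \<comment> \<open>One term of the exponential series suffices. Index \<open>n + 2\<close> rather
      than \<open>n\<close> leaves a spare factor \<open>t ^ 2\<close>, which later makes the
      difference quotient at the edge of the support tend to 0.\<close>
    have "(\<Sum>k\<in>{n+2}. (1 / t) ^ k /\<^sub>R fact k) \<le> (\<Sum>k. (1 / t) ^ k /\<^sub>R fact k)"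
      using assms by (intro sum_le_suminf summable_exp_generic) auto
    then show ?thesis by (simp add: exp_def field_simps)
  qed
  then have "inverse (exp (1 / t)) \<le> inverse ((1 / t) ^ (n + 2) / fact (n + 2))"
    using assms by (intro le_imp_inverse_le) auto
  then have "exp (- 1 / t) \<le> fact (n + 2) * t ^ (n + 2)"
    by (simp add: exp_minus field_simps)
  then show ?thesis using assms
    by (simp add: divide_le_eq power_add power2_eq_square mult_ac del: fact_Suc)
qed

text \<open>A family closed under differentiation that contains the standard bump
  \<open>exp (- 1 / (1 - x\<^sup>2))\<close>: every derivative of it is a rational multiple of it
  with a power of \<open>1 - x\<^sup>2\<close> as denominator.\<close>

definition bump_term :: "real poly \<Rightarrow> nat \<Rightarrow> real \<Rightarrow> real" where
  "bump_term p n x = (if \<bar>x\<bar> < 1 then poly p x / (1 - x\<^sup>2) ^ n * exp (- 1 / (1 - x\<^sup>2)) else 0)"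

text \<open>Brings the derivative of \<open>B / u ^ n * exp (- 1 / u)\<close> back into the form of
  \<open>bump_term\<close>; here \<open>A\<close> and \<open>c\<close> stand for the derivatives of
  \<open>B\<close> and \<open>u\<close>, and \<open>E\<close> for the exponential. The case split
  removes the truncated exponent \<open>n - 1\<close>.\<close>

lemma power_quotient:
  fixes u A B c E :: real and n :: nat
  assumes "u > 0"
  shows "(A * u ^ n - B * (n * u ^ (n - 1) * c)) / (u ^ n * u ^ n) * E + E * (c / u\<^sup>2) * (B / u ^ n)
    = (A * u\<^sup>2 - n * B * c * u + B * c) / u ^ (n + 2) * E"
proof (cases n)
  case 0
  then show ?thesis using assms by (simp add: field_simps power2_eq_square)
next
  case (Suc m)
  define w where "w = u ^ m"
  have "w > 0" using assms by (simp add: w_def)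
  then show ?thesis
    using assms by (simp add: Suc w_def[symmetric] field_simps power2_eq_square)
qed

lemma bump_term_deriv:
  "\<exists>p' n'. \<forall>x. (bump_term p n has_real_derivative bump_term p' n' x) (at x)"
proof -
  define q :: "real poly" where "q = [:1, 0, -1:]"
  have q: "poly q x = 1 - x\<^sup>2" "poly (pderiv q) x = - 2 * x" for x
    by (simp_all add: q_def pderiv_pCons power2_eq_square)
  define p' where "p' = pderiv p * q\<^sup>2 - of_nat n * p * pderiv q * q + p * pderiv q"
  have "(bump_term p n has_real_derivative bump_term p' (n + 2) x) (at x)" for x
  proof -
    consider "\<bar>x\<bar> < 1" | "\<bar>x\<bar> > 1" | "\<bar>x\<bar> = 1" by linarith
    then show ?thesis
    proof cases
      case 1
      then have x2: "1 - x\<^sup>2 > 0" by (simp add: abs_square_less_1)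
      let ?u = "1 - x\<^sup>2"
      have 1: "((\<lambda>x. poly p x / (1 - x\<^sup>2) ^ n) has_real_derivative
          (poly (pderiv p) x * ?u ^ n - poly p x * (n * ?u ^ (n - 1) * (- 2 * x))) / (?u ^ n * ?u ^ n)) (at x)"
        using x2 by (auto intro!: derivative_eq_intros)
      have 2: "((\<lambda>x. exp (- 1 / (1 - x\<^sup>2))) has_real_derivative
          exp (- 1 / ?u) * (- 2 * x / ?u\<^sup>2)) (at x)"
        using x2 by (auto intro!: derivative_eq_intros simp: power2_eq_square)
      have "((\<lambda>x. poly p x / (1 - x\<^sup>2) ^ n * exp (- 1 / (1 - x\<^sup>2))) has_real_derivative
          ((poly (pderiv p) x * ?u ^ n - poly p x * (n * ?u ^ (n - 1) * (- 2 * x))) / (?u ^ n * ?u ^ n)) * exp (- 1 / ?u)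
          + exp (- 1 / ?u) * (- 2 * x / ?u\<^sup>2) * (poly p x / ?u ^ n)) (at x)"
        by (rule DERIV_mult[OF 1 2])
      also have "((poly (pderiv p) x * ?u ^ n - poly p x * (n * ?u ^ (n - 1) * (- 2 * x))) / (?u ^ n * ?u ^ n)) * exp (- 1 / ?u)
          + exp (- 1 / ?u) * (- 2 * x / ?u\<^sup>2) * (poly p x / ?u ^ n) = bump_term p' (n + 2) x"
        using \<open>\<bar>x\<bar> < 1\<close> unfolding power_quotient[OF x2] bump_term_def p'_def
        by (simp only: if_True poly_add poly_diff poly_mult poly_power q poly_of_nat)
      finally show ?thesis
        by (rule has_field_derivative_transform_within_open[where S = "{-1<..<1}"])
          (use \<open>\<bar>x\<bar> < 1\<close> in \<open>auto simp: bump_term_def\<close>)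
    next
      case 2
      have "((\<lambda>_. 0) has_real_derivative bump_term p' (n + 2) x) (at x)"
        using 2 by (simp add: bump_term_def)
      then show ?thesis
        by (rule has_field_derivative_transform_within_open[where S = "- {-1..1}"])
          (use 2 in \<open>auto simp: bump_term_def intro: open_Compl\<close>)
    next
      case 3
      have "bounded ((poly p) ` {-2..2})"
        by (intro compact_imp_bounded compact_continuous_image continuous_intros) auto
      then obtain B where B: "\<And>y. y \<in> {-2..2} \<Longrightarrow> \<bar>poly p y\<bar> \<le> B" "B > 0"
        unfolding bounded_pos by (auto simp del: atLeastAtMost_iff)
      \<comment> \<open>At an edge \<open>x\<close> of the support,
        \<open>1 - y\<^sup>2 = (x + y) * (x - y)\<close>, and
        \<open>\<bar>x + y\<bar> \<le> 3\<close> for \<open>\<bar>y\<bar> \<le> 2\<close>; this is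
        the 9. The bound is quadratic in \<open>y - x\<close>, so the derivative at the edge is
        0.\<close>
      define C where "C = B * (fact (n + 2) * 9)"
      have bd: "\<bar>bump_term p n y\<bar> \<le> C * (y - x)\<^sup>2" if "y \<in> {-2..2}" for y
      proof (cases "\<bar>y\<bar> < 1")
        case True
        then have y2: "1 - y\<^sup>2 > 0" by (simp add: abs_square_less_1)
        have "\<bar>bump_term p n y\<bar> = \<bar>poly p y\<bar> * (exp (- 1 / (1 - y\<^sup>2)) / (1 - y\<^sup>2) ^ n)"
          using y2 True by (simp add: bump_term_def abs_mult)
        also have "\<dots> \<le> B * (fact (n + 2) * (1 - y\<^sup>2) ^ 2)"
          using B that y2 by (intro mult_mono exp_neg_inverse_le) auto
        also have "(1 - y\<^sup>2)\<^sup>2 = (x + y)\<^sup>2 * (y - x)\<^sup>2"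
          using 3 by (auto simp: abs_if power2_eq_square algebra_simps split: if_splits)
        also have "(x + y)\<^sup>2 \<le> 3\<^sup>2"
          using that 3 by (intro abs_le_square_iff[THEN iffD1]) auto
        finally show ?thesis using B by (simp add: C_def mult_left_mono mult_right_mono algebra_simps del: fact_Suc)
      next
        case False
        then show ?thesis using B(2) by (simp add: bump_term_def C_def)
      qed
      have "((\<lambda>y. bump_term p n y / (y - x)) \<longlongrightarrow> 0) (at x)"
      proof (rule Lim_null_comparison)
        have "eventually (\<lambda>y. y \<in> {-2<..<2}) (at x)"
          using 3 by (intro eventually_at_in_open') auto
        moreover have "eventually (\<lambda>y. y \<noteq> x) (at x)" by (rule eventually_at_filter[THEN iffD2]) simp
        ultimately show "eventually (\<lambda>y. norm (bump_term p n y / (y - x)) \<le> C * \<bar>y - x\<bar>) (at x)"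
        proof eventually_elim
          case (elim y)
          then have "\<bar>bump_term p n y\<bar> \<le> C * \<bar>y - x\<bar> * \<bar>y - x\<bar>"
            using bd[of y] by (simp add: power2_eq_square mult.assoc)
          then show ?case using elim by (simp add: divide_le_eq)
        qed
        have "((\<lambda>y. C * \<bar>y - x\<bar>) \<longlongrightarrow> C * \<bar>x - x\<bar>) (at x)" by (intro tendsto_intros)
        then show "((\<lambda>y. C * \<bar>y - x\<bar>) \<longlongrightarrow> 0) (at x)" by simp
      qed
      then show ?thesis using 3 by (simp add: has_field_derivative_iff bump_term_def)
    qed
  qed
  then show ?thesis by blast
qed

definition bump :: "real \<Rightarrow> complex" where
  "bump x = complex_of_real (bump_term 1 0 x)"

lemma smooth_bump: "smooth_fun bump"
proof (rule smooth_funI[where P = "\<lambda>f. \<exists>p n. f = (\<lambda>x. complex_of_real (bump_term p n x))"])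
  show "\<exists>p n. bump = (\<lambda>x. complex_of_real (bump_term p n x))"
    by (intro exI ext) (rule bump_def)
next
  fix f assume "\<exists>p n. f = (\<lambda>x. complex_of_real (bump_term p n x))"
  then obtain p n where f: "f = (\<lambda>x. complex_of_real (bump_term p n x))" by blast
  obtain p' n' where "\<And>x. (bump_term p n has_real_derivative bump_term p' n' x) (at x)"
    using bump_term_deriv by blast
  then have "\<forall>x. (f has_vector_derivative complex_of_real (bump_term p' n' x)) (at x)"
    unfolding f by (auto intro!: has_vector_derivative_of_real
      simp: has_real_derivative_iff_has_vector_derivative)
  then show "\<exists>f'. (\<exists>p n. f' = (\<lambda>x. complex_of_real (bump_term p n x))) \<and>
      (\<forall>x. (f has_vector_derivative f' x) (at x))"
    by blast
qed

lemma continuous_antiderivative: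
  fixes f :: "real \<Rightarrow> 'a::euclidean_space"
  assumes "continuous_on UNIV f"
  obtains F where "\<And>x. (F has_vector_derivative f x) (at x)"
  using einterval_antiderivative[of "-\<infinity>" "\<infinity>" f] assms
  by (auto simp: continuous_on_eq_continuous_at)

text \<open>The primitive of \<open>bump\<close> is a smooth transition between two constants.\<close>

lemma smooth_step_exists:
  obtains N :: "real \<Rightarrow> complex" where "smooth_fun N" "\<And>x. x \<le> -1 \<Longrightarrow> N x = 0"
    "\<And>x. x \<ge> 1 \<Longrightarrow> N x = 1" "\<And>x. cmod (N x) \<le> 1"
proof -
  have "continuous_on UNIV (bump_term 1 0)"
    using bump_term_deriv[of 1 0] by (meson continuous_at_imp_continuous_on DERIV_isCont)
  then obtain F where F0: "\<And>x. (F has_vector_derivative bump_term 1 0 x) (at x)"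
    by (rule continuous_antiderivative) blast
  then have F: "(F has_real_derivative bump_term 1 0 x) (at x)" for x
    by (simp add: has_real_derivative_iff_has_vector_derivative)
  have mono: "F x \<le> F y" if "x \<le> y" for x y
    by (rule DERIV_nonneg_imp_nondecreasing[OF that], rule exI, rule conjI[OF F])
      (simp add: bump_term_def)
  have lt: "F (-1) < F 1"
  proof (rule DERIV_pos_imp_increasing_open[of "-1" 1 F])
    show "\<And>x. - 1 < x \<Longrightarrow> x < 1 \<Longrightarrow> \<exists>y. (F has_real_derivative y) (at x) \<and> 0 < y"
      by (rule exI, rule conjI[OF F]) (simp add: bump_term_def)
    show "continuous_on {-1..1} F"
      using F by (meson DERIV_isCont continuous_at_imp_continuous_on)
  qed simp
  have const: "F x = F y" if "x \<le> y" "y \<le> -1 \<or> x \<ge> 1" for x y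
  proof (cases "x = y")
    case False
    show ?thesis
    proof (rule DERIV_isconst2[symmetric, of x y F y])
      show "continuous_on {x..y} F"
        using F by (meson DERIV_isCont continuous_at_imp_continuous_on)
      show "(F has_real_derivative 0) (at z)" if "x < z" "z < y" for z
        using F[of z] that \<open>y \<le> -1 \<or> x \<ge> 1\<close> by (auto simp: bump_term_def)
    qed (use that False in auto)
  qed simp
  define d where "d = F 1 - F (-1)"
  define N where "N x = complex_of_real ((F x - F (-1)) / d)" for x
  have d: "d > 0" using lt by (simp add: d_def)
  have 1: "N x = 0" if "x \<le> -1" for x
    using const[of x "-1"] that by (simp add: N_def)
  have 2: "N x = 1" if "x \<ge> 1" for x
    using const[of 1 x] that d unfolding N_def d_def by simp
  show thesis
  proof
    have N': "(N has_vector_derivative (1 / d) * bump x) (at x)" for x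
    proof -
      have "((\<lambda>x. (F x - F (-1)) / d) has_real_derivative bump_term 1 0 x / d) (at x)"
        using d by (auto intro!: derivative_eq_intros F)
      then have "(N has_vector_derivative complex_of_real (bump_term 1 0 x / d)) (at x)"
        unfolding N_def by (intro has_vector_derivative_of_real)
          (simp only: has_real_derivative_iff_has_vector_derivative)
      then show ?thesis by (simp add: bump_def)
    qed
    have "smooth_fun (\<lambda>x. (1 / d) * bump (1 * x + 0) + 0 * bump (1 * x + 0))"
      by (intro smooth_fun_affine_comb smooth_bump)
    with N' show "smooth_fun N" by (intro smooth_fun_antideriv[of _ N]) auto
    fix x
    show "cmod (N x) \<le> 1"
    proof (cases "\<bar>x\<bar> \<le> 1")
      case True
      then show ?thesis using mono[of "-1" x] mono[of x 1] d
        unfolding N_def norm_of_real by (simp add: d_def divide_le_eq)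
    next
      case False
      then show ?thesis using 1[of x] 2[of x] by (cases "x \<le> -1") auto
    qed
  qed (use 1 2 in auto)
qed

section \<open>The lemma of du Bois-Reymond\<close>

text \<open>Dynkin's argument: the sets over which \<open>f\<close> integrates to 0 are closed under
  complements and disjoint unions and contain the open intervals, which are stable under
  intersection and generate the Borel sets. Bounded support makes the integral over the whole line
  one over an interval, as complements require.\<close>

lemma interval_integrals_zero_imp_AE_zero:
  fixes f :: "real \<Rightarrow> complex"
  assumes f: "integrable lborel f" and supp: "\<And>x. \<bar>x\<bar> \<ge> M \<Longrightarrow> f x = 0"
    and zero: "\<And>a b. (LINT x:{a<..<b}|lborel. f x) = 0"
  shows "AE x in lborel. f x = 0"
proof (rule sigma_finite_measure.density_zero[OF lborel.sigma_finite_measure_axioms f])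
  fix A :: "real set" assume "A \<in> sets lborel"
  then have A: "A \<in> sigma_sets UNIV (range (\<lambda>(a, b). box a b :: real set))"
    by (simp add: borel_eq_box)
  have meas: "A \<in> sets borel" if "A \<in> sigma_sets UNIV (range (\<lambda>(a, b). box a b :: real set))" for A
    using that by (simp add: borel_eq_box)
  have si: "set_integrable lborel A f" if "A \<in> sets borel" for A
    unfolding set_integrable_def using that f by (intro integrable_mult_indicator) auto
  have univ: "(LINT x:UNIV|lborel. f x) = 0"
  proof -
    have "(LINT x:UNIV|lborel. f x) = (LINT x:{-\<bar>M\<bar><..<\<bar>M\<bar>}|lborel. f x)"
      unfolding set_lebesgue_integral_def
      by (intro Bochner_Integration.integral_cong refl)
        (use supp in \<open>force simp: indicator_def\<close>)
    then show ?thesis using zero by simp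
  qed
  have "Int_stable (range (\<lambda>(a, b). box a b :: real set))"
    by (rule Int_stableI) (force simp: image_iff)
  moreover have "range (\<lambda>(a, b). box a b :: real set) \<subseteq> Pow UNIV" by simp
  ultimately show "(LINT x:A|lborel. f x) = 0"
    using A
  proof (induction rule: sigma_sets_induct_disjoint)
    case (basic A)
    then show ?case using zero by auto
  next
    case empty
    show ?case by (simp add: set_lebesgue_integral_def)
  next
    case (compl A)
    have "(LINT x:(A \<union> (UNIV - A))|lborel. f x) = (LINT x:A|lborel. f x) + (LINT x:(UNIV - A)|lborel. f x)"
      using meas[OF compl(1)] by (intro set_integral_Un si) auto
    then show ?case using univ compl by simp
  next
    case (union A)
    have Ai: "A i \<in> sets borel" for i using union(2) meas by blast
    have "(LINT x:(\<Union>i. A i)|lborel. f x) = (\<Sum>i. LINT x:A i|lborel. f x)"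
      using union(1) Ai
      by (intro lebesgue_integral_countable_add si sets.countable_UN)
        (auto simp: disjoint_family_on_def)
    then show ?case using union(3) by simp
  qed
qed

definition locally_integrable :: "(real \<Rightarrow> complex) \<Rightarrow> bool" where
  "locally_integrable f \<longleftrightarrow> (\<forall>M. set_integrable lborel {-M..M} f)"

lemma locally_integrable_measurable:
  assumes "locally_integrable f"
  shows "f \<in> borel_measurable borel"
proof -
  have "(\<lambda>x. indicator {- real n..real n} x *\<^sub>R f x) \<in> borel_measurable borel" for n
  proof -
    have "integrable lborel (\<lambda>x. indicator {- real n..real n} x *\<^sub>R f x)"
      using assms unfolding locally_integrable_def set_integrable_def by blast
    from borel_measurable_integrable[OF this] show ?thesis by simp
  qed
  moreover have "(\<lambda>n. indicator {- real n..real n} x *\<^sub>R f x) \<longlonglongrightarrow> f x" for x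
  proof (rule tendsto_eventually)
    have "eventually (\<lambda>n. real n \<ge> \<bar>x\<bar>) sequentially"
      using filterlim_real_sequentially by (simp add: filterlim_at_top)
    then show "eventually (\<lambda>n. indicator {- real n..real n} x *\<^sub>R f x = f x) sequentially"
      by eventually_elim (auto simp: indicator_def)
  qed
  ultimately show ?thesis by (rule borel_measurable_LIMSEQ_metric)
qed

lemma locally_integrable_diff:
  "locally_integrable f \<Longrightarrow> locally_integrable g \<Longrightarrow> locally_integrable (\<lambda>x. f x - g x)"
  by (auto simp: locally_integrable_def intro: set_integral_diff)

lemma continuous_imp_locally_integrable:
  "continuous_on UNIV f \<Longrightarrow> locally_integrable f"
  unfolding locally_integrable_def
  by (intro allI borel_integrable_atLeastAtMost') (erule continuous_on_subset, simp)

lemma locally_integrable_on_Icc: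
  assumes "locally_integrable f"
  shows "set_integrable lborel {a..b} f"
proof (rule set_integrable_subset)
  show "set_integrable lborel {-max \<bar>a\<bar> \<bar>b\<bar>..max \<bar>a\<bar> \<bar>b\<bar>} f"
    using assms by (simp add: locally_integrable_def)
qed auto

lemma integrable_mult_compact_support:
  assumes f: "locally_integrable f" and g: "g \<in> borel_measurable borel"
    and bd: "\<And>x. cmod (g x) \<le> B" and supp: "\<And>x. \<bar>x\<bar> \<ge> M \<Longrightarrow> g x = 0"
  shows "integrable lborel (\<lambda>x. f x * g x)"
proof (rule Bochner_Integration.integrable_bound)
  note [measurable] = locally_integrable_measurable[OF f] g
  show "integrable lborel (\<lambda>x. B *\<^sub>R (indicator {-M..M} x *\<^sub>R f x))"
    using f unfolding locally_integrable_def set_integrable_def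
    by (intro integrable_scaleR_right) blast
  show "(\<lambda>x. f x * g x) \<in> borel_measurable lborel" by measurable
  have "norm (f x * g x) \<le> norm (B *\<^sub>R (indicator {-M..M} x *\<^sub>R f x))" for x
  proof (cases "\<bar>x\<bar> \<ge> M")
    case True
    then show ?thesis using supp by simp
  next
    case False
    have "\<bar>B\<bar> \<ge> cmod (g x)" using bd[of x] by linarith
    then show ?thesis using False
      by (auto simp: norm_mult mult.commute[of "cmod (f x)"] indicator_def intro!: mult_right_mono)
  qed
  then show "AE x in lborel. norm (f x * g x) \<le> norm (B *\<^sub>R (indicator {-M..M} x *\<^sub>R f x))" by simp
qed

lemma continuous_compact_support_bounded:
  fixes g :: "real \<Rightarrow> complex"
  assumes "continuous_on UNIV g" "\<And>x. \<bar>x\<bar> \<ge> M \<Longrightarrow> g x = 0"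
  shows "\<exists>B>0. \<forall>x. cmod (g x) \<le> B"
proof -
  have "bounded (g ` {-M..M})"
    by (intro compact_imp_bounded compact_continuous_image continuous_on_subset[OF assms(1)]) auto
  then obtain B where B: "B > 0" "\<And>x. x \<in> {-M..M} \<Longrightarrow> cmod (g x) \<le> B"
    unfolding bounded_pos by (auto simp del: atLeastAtMost_iff)
  have "cmod (g x) \<le> B" for x
    using B(1) B(2)[of x] assms(2)[of x] by (cases "x \<in> {-M..M}") auto
  with B(1) show ?thesis by blast
qed

lemma integrable_mult_continuous:
  assumes f: "locally_integrable f" and g: "continuous_on UNIV g"
    and supp: "\<And>x. \<bar>x\<bar> \<ge> M \<Longrightarrow> g x = 0"
  shows "integrable lborel (\<lambda>x. f x * g x)"
proof -
  obtain B where "\<forall>x. cmod (g x) \<le> B"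
    using continuous_compact_support_bounded[OF g supp] by blast
  then show ?thesis
    by (intro integrable_mult_compact_support[OF f borel_measurable_continuous_onI[OF g], of B M] supp) auto
qed

lemma integrable_mult_test:
  assumes f: "locally_integrable f" and g: "test_function g"
  shows "integrable lborel (\<lambda>x. f x * g x)"
proof -
  obtain M where M: "M > 0" "\<And>x. \<bar>x\<bar> \<ge> M \<Longrightarrow> g x = 0"
    using g by (rule test_functionE) blast
  have "continuous_on UNIV g"
    using g by (intro smooth_fun_imp_continuous) (simp add: test_function_iff)
  then show ?thesis by (rule integrable_mult_continuous[OF f _ M(2)])
qed

text \<open>Differences of ever steeper smooth steps are test functions that converge, off the
  endpoints, to the indicator of an interval; dominated convergence reduces the claim to integrals
  over intervals.\<close>

lemma AE_zero_if_test_integrals_zero: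
  assumes f: "locally_integrable f"
    and zero: "\<And>\<psi>. test_function \<psi> \<Longrightarrow> (LINT x|lborel. f x * \<psi> x) = 0"
  shows "AE x in lborel. f x = 0"
proof -
  note [measurable] = locally_integrable_measurable[OF f]
  obtain N :: "real \<Rightarrow> complex" where N: "smooth_fun N" "\<And>x. x \<le> -1 \<Longrightarrow> N x = 0"
    "\<And>x. x \<ge> 1 \<Longrightarrow> N x = 1" "\<And>x. cmod (N x) \<le> 1"
    by (rule smooth_step_exists) blast
  have [measurable]: "N \<in> borel_measurable borel"
    using N(1) by (intro borel_measurable_continuous_onI smooth_fun_imp_continuous)
  have int0: "(LINT x:{a<..<b}|lborel. f x) = 0" for a b
  proof (cases "a < b")
    case True
    \<comment> \<open>The affine spelling matches \<open>smooth_fun_affine_comb\<close>. The slope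
      \<open>Suc n\<close> is never below 1, so the steps have width at most 1 on each side and one
      \<open>M\<close> bounds the support for all \<open>n\<close>.\<close>
    define \<kappa> where "\<kappa> n x = 1 * N (real (Suc n) * x + (- real (Suc n) * a)) +
        (- 1) * N (real (Suc n) * x + (- real (Suc n) * b))" for n :: nat and x
    define M where "M = \<bar>a\<bar> + \<bar>b\<bar> + 1"
    have \<kappa>: "\<kappa> n x = N (real (Suc n) * (x - a)) - N (real (Suc n) * (x - b))" for n x
      by (simp add: \<kappa>_def algebra_simps)
    have supp: "\<kappa> n x = 0" if "\<bar>x\<bar> \<ge> M" for n x
    proof (cases "x > 0")
      case True
      have "1 * 1 \<le> real (Suc n) * (x - a)" "1 * 1 \<le> real (Suc n) * (x - b)"
        using that True by (intro mult_mono; simp add: M_def)+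
      then show ?thesis by (simp add: \<kappa> N(3))
    next
      case False
      have "1 * 1 \<le> real (Suc n) * (a - x)" "1 * 1 \<le> real (Suc n) * (b - x)"
        using that False by (intro mult_mono; simp add: M_def)+
      then have "real (Suc n) * (x - a) \<le> -1" "real (Suc n) * (x - b) \<le> -1"
        by (simp_all add: algebra_simps)
      then show ?thesis by (simp add: \<kappa> N(2))
    qed
    have test: "test_function (\<kappa> n)" for n
      unfolding test_function_iff compact_support_iff
    proof
      show "smooth_fun (\<kappa> n)" unfolding \<kappa>_def by (intro smooth_fun_affine_comb N)
      show "\<exists>M>0. \<forall>x. M \<le> \<bar>x\<bar> \<longrightarrow> \<kappa> n x = 0"
        using supp by (intro exI[of _ M]) (auto simp: M_def)
    qed
    have lim: "(\<lambda>n. \<kappa> n x) \<longlonglongrightarrow> indicator {a<..<b} x" if "x \<noteq> a" "x \<noteq> b" for x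
    proof -
      have step: "(\<lambda>n. N (real (Suc n) * (x - c))) \<longlonglongrightarrow> indicator {c<..} x" if "x \<noteq> c" for c
      proof (rule tendsto_eventually)
        obtain k :: nat where k: "real k * \<bar>x - c\<bar> \<ge> 1"
          using ex_less_of_nat_mult[of "\<bar>x - c\<bar>" 1] \<open>x \<noteq> c\<close> by (auto intro: less_imp_le)
        have "N (real (Suc n) * (x - c)) = indicator {c<..} x" if "n \<ge> k" for n
        proof -
          have *: "real (Suc n) * \<bar>x - c\<bar> \<ge> 1"
            using k mult_right_mono[of "real k" "real (Suc n)" "\<bar>x - c\<bar>"] that by simp
          show ?thesis
          proof (cases "x > c")
            case True
            then show ?thesis using * by (simp add: N(3))
          next
            case False
            then have "\<bar>x - c\<bar> = c - x" by simp
            then have "real (Suc n) * (x - c) \<le> -1" using * by (simp add: algebra_simps)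
            then show ?thesis using False by (simp add: N(2))
          qed
        qed
        then show "eventually (\<lambda>n. N (real (Suc n) * (x - c)) = indicator {c<..} x) sequentially"
          unfolding eventually_sequentially by blast
      qed
      have "(\<lambda>n. \<kappa> n x) \<longlonglongrightarrow> indicator {a<..} x - indicator {b<..} x"
        unfolding \<kappa> by (intro tendsto_diff step that)
      also have "indicator {a<..} x - indicator {b<..} x = (indicator {a<..<b} x :: complex)"
        using that True by (auto simp: indicator_def)
      finally show ?thesis .
    qed
    have "(\<lambda>n. LINT x|lborel. f x * \<kappa> n x) \<longlonglongrightarrow> (LINT x|lborel. f x * indicator {a<..<b} x)"
    proof (rule integral_dominated_convergence)
      show "integrable lborel (\<lambda>x. 2 * norm (indicator {-M..M} x *\<^sub>R f x))"
        using f unfolding locally_integrable_def set_integrable_def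
        by (intro integrable_mult_right integrable_norm) blast
      show "AE x in lborel. (\<lambda>n. f x * \<kappa> n x) \<longlonglongrightarrow> f x * indicator {a<..<b} x"
        using AE_lborel_singleton[of a] AE_lborel_singleton[of b]
        by eventually_elim (intro tendsto_mult tendsto_const lim)
      show "AE x in lborel. norm (f x * \<kappa> n x) \<le> 2 * norm (indicator {-M..M} x *\<^sub>R f x)" for n
      proof (rule AE_I2)
        fix x
        have "cmod (\<kappa> n x) \<le> 2"
          unfolding \<kappa> by (rule order_trans[OF norm_triangle_ineq4]) (use N(4) in \<open>smt (verit)\<close>)
        then show "norm (f x * \<kappa> n x) \<le> 2 * norm (indicator {-M..M} x *\<^sub>R f x)"
          using supp[of x n] by (cases "\<bar>x\<bar> \<ge> M")
            (auto simp: norm_mult mult.commute[of "cmod (f x)"] indicator_def intro!: mult_right_mono)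
      qed
    qed (auto simp: \<kappa>)
    then have "(LINT x|lborel. f x * indicator {a<..<b} x) = 0"
      by (simp add: zero[OF test] LIMSEQ_const_iff)
    then show ?thesis
      by (simp add: set_lebesgue_integral_def scaleR_conv_of_real mult.commute of_real_indicator)
  qed (simp add: set_lebesgue_integral_def)
  \<comment> \<open>\<open>f\<close> is only locally integrable, so it is cut off to bounded
    intervals; countably many of them exhaust the line.\<close>
  have "AE x in lborel. indicator {- real n<..<real n} x *\<^sub>R f x = 0" for n
  proof (rule interval_integrals_zero_imp_AE_zero)
    have "set_integrable lborel {- real n<..<real n} f"
      by (rule set_integrable_subset[OF f[unfolded locally_integrable_def, rule_format, of "real n"]]) auto
    then show "integrable lborel (\<lambda>x. indicator {- real n<..<real n} x *\<^sub>R f x)"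
      by (simp add: set_integrable_def)
    show "\<And>x. \<bar>x\<bar> \<ge> real n \<Longrightarrow> indicator {- real n<..<real n} x *\<^sub>R f x = 0"
      by (auto simp: indicator_def)
    fix a b
    have "(LINT x:{a<..<b}|lborel. indicator {- real n<..<real n} x *\<^sub>R f x)
        = (LINT x:{max a (- real n)<..<min b (real n)}|lborel. f x)"
      unfolding set_lebesgue_integral_def
      by (intro Bochner_Integration.integral_cong) (auto simp: indicator_def)
    then show "(LINT x:{a<..<b}|lborel. indicator {- real n<..<real n} x *\<^sub>R f x) = 0"
      by (simp add: int0)
  qed
  then have "AE x in lborel. \<forall>n. indicator {- real n<..<real n} x *\<^sub>R f x = 0"
    by (subst AE_all_countable) blast
  then show ?thesis
  proof eventually_elim
    case (elim x)
    obtain n where "\<bar>x\<bar> < real n" using reals_Archimedean2 by blast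
    then show ?case using elim[rule_format, of n] by (simp add: indicator_def abs_less_iff)
  qed
qed

lemma integral_compactly_supported_derivative:
  fixes f :: "real \<Rightarrow> complex"
  assumes f: "\<And>x. (f has_vector_derivative f' x) (at x)" and c: "continuous_on UNIV f'"
    and supp: "\<And>x. \<bar>x\<bar> \<ge> M \<Longrightarrow> f' x = 0" and "M \<ge> 0"
  shows "(LINT x|lborel. f' x) = f M - f (- M)"
proof -
  have "(LINT x|lborel. f' x) = (LINT x|lborel. indicator {-M..M} x *\<^sub>R f' x)"
    by (intro Bochner_Integration.integral_cong) (use supp in \<open>force simp: indicator_def\<close>)+
  also have "\<dots> = f M - f (- M)"
    using assms by (intro integral_FTC_atLeastAtMost)
      (auto intro: has_vector_derivative_at_within continuous_on_subset)
  finally show ?thesis .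
qed

text \<open>Fix a test function \<open>\<eta>\<close> of total mass 1. Any test function
  \<open>\<kappa>\<close> of mass \<open>I\<close> equals \<open>I * \<eta>\<close> plus the
  derivative of a test function, so \<open>f\<close> acts on \<open>\<kappa>\<close> as the constant
  \<open>c\<close>, its integral against \<open>\<eta>\<close>.\<close>

lemma AE_const_if_test_derivative_integrals_zero:
  assumes f: "locally_integrable f"
    and zero: "\<And>\<psi> \<psi>'. test_function \<psi> \<Longrightarrow> (\<And>x. (\<psi> has_vector_derivative \<psi>' x) (at x)) \<Longrightarrow>
      (LINT x|lborel. f x * \<psi>' x) = 0"
  obtains c where "AE x in lborel. f x = c"
proof -
  obtain N :: "real \<Rightarrow> complex" where N: "smooth_fun N" "\<And>x. x \<le> -1 \<Longrightarrow> N x = 0"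
    "\<And>x. x \<ge> 1 \<Longrightarrow> N x = 1"
    by (rule smooth_step_exists) blast
  obtain \<eta> where \<eta>: "smooth_fun \<eta>" "\<And>x. (N has_vector_derivative \<eta> x) (at x)"
    using N(1) by (rule smooth_fun_derivE) blast
  have \<eta>0: "\<eta> x = 0" if "\<bar>x\<bar> > 1" for x
  proof -
    have "((\<lambda>_. if x > 0 then 1 else 0) has_vector_derivative \<eta> x) (at x)"
      by (rule has_vector_derivative_transform_within_open[OF \<eta>(2),
            of "if x > 0 then {1<..} else {..<-1}"])
        (use that N in auto)
    then show ?thesis by (metis vector_derivative_at has_vector_derivative_const)
  qed
  have c\<eta>: "continuous_on UNIV \<eta>" using \<eta>(1) by (rule smooth_fun_imp_continuous)
  have i\<eta>: "integrable lborel (\<lambda>x. f x * \<eta> x)"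
    by (rule integrable_mult_continuous[OF f c\<eta>, of 2]) (use \<eta>0 in force)
  define c where "c = (LINT x|lborel. f x * \<eta> x)"
  have "AE x in lborel. f x - c = 0"
  proof (rule AE_zero_if_test_integrals_zero)
    show "locally_integrable (\<lambda>x. f x - c)"
      by (intro locally_integrable_diff f continuous_imp_locally_integrable continuous_intros)
    fix \<kappa> assume \<kappa>: "test_function \<kappa>"
    obtain M where M: "M > 0" "\<And>x. \<bar>x\<bar> \<ge> M \<Longrightarrow> \<kappa> x = 0"
      using \<kappa> by (rule test_functionE) blast
    have s\<kappa>: "smooth_fun \<kappa>" using \<kappa> by (simp add: test_function_iff)
    then have c\<kappa>: "continuous_on UNIV \<kappa>" by (rule smooth_fun_imp_continuous)
    define I where "I = (LINT x|lborel. \<kappa> x)"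
    obtain G where G: "\<And>x. (G has_vector_derivative \<kappa> x) (at x)"
      using c\<kappa> by (rule continuous_antiderivative) blast
    \<comment> \<open>A primitive of \<open>\<kappa> - I * \<eta>\<close>. The constant makes it
      vanish on the left; on the right \<open>N = 1\<close>, and subtracting the total mass
      \<open>I\<close> makes it vanish there too.\<close>
    define \<psi> where "\<psi> x = G x - G (- (M + 1)) - I * N x" for x
    have \<psi>': "(\<psi> has_vector_derivative 1 * \<kappa> (1 * x + 0) + (- I) * \<eta> (1 * x + 0)) (at x)" for x
      unfolding \<psi>_def by (rule derivative_eq_intros G \<eta> refl)+ simp
    have Gc: "G x = G y" if "x \<le> y" "y \<le> - M \<or> x \<ge> M" for x y
    proof -
      have "(\<kappa> has_integral (G y - G x)) {x..y}"
        using that by (intro fundamental_theorem_of_calculus) (auto intro: has_vector_derivative_at_within G)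
      moreover have "(\<kappa> has_integral 0) {x..y}"
        by (rule has_integral_is_0) (use that M in auto)
      ultimately have "G y - G x = 0" by (rule has_integral_unique)
      then show ?thesis by simp
    qed
    have I: "I = G (M + 1) - G (- (M + 1))"
      unfolding I_def by (rule integral_compactly_supported_derivative[OF G c\<kappa>]) (use M in auto)
    have "test_function \<psi>"
      unfolding test_function_iff compact_support_iff
    proof
      show "smooth_fun \<psi>"
        by (rule smooth_fun_antideriv[OF smooth_fun_affine_comb \<psi>']) (use s\<kappa> \<eta> in auto)
      have "\<psi> x = 0" if "\<bar>x\<bar> \<ge> M + 1" for x
      proof (cases "x > 0")
        case True
        then show ?thesis using that Gc[of "M + 1" x] M(1) N(3)[of x] by (simp add: \<psi>_def I)
      next
        case False
        then show ?thesis using that Gc[of x "- (M + 1)"] M(1) N(2)[of x] by (simp add: \<psi>_def)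
      qed
      then show "\<exists>M>0. \<forall>x. M \<le> \<bar>x\<bar> \<longrightarrow> \<psi> x = 0"
        using M(1) by (intro exI[of _ "M + 1"]) auto
    qed
    from zero[OF this \<psi>'] have "(LINT x|lborel. f x * \<kappa> x - I * (f x * \<eta> x)) = 0"
      by (simp add: algebra_simps)
    then have "(LINT x|lborel. f x * \<kappa> x) = I * c"
      using i\<eta> integrable_mult_test[OF f \<kappa>] by (simp add: c_def)
    moreover have "integrable lborel (\<lambda>x. c * \<kappa> x)"
      using integrable_mult_test[OF continuous_imp_locally_integrable \<kappa>, of "\<lambda>_. c"] by simp
    moreover have "(LINT x|lborel. (f x - c) * \<kappa> x)
        = (LINT x|lborel. f x * \<kappa> x) - (LINT x|lborel. c * \<kappa> x)"
      unfolding left_diff_distrib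
      by (intro Bochner_Integration.integral_diff integrable_mult_test[OF f \<kappa>]) fact
    ultimately show "(LINT x|lborel. (f x - c) * \<kappa> x) = 0" by (simp add: I_def)
  qed
  then show thesis using that[of c] by simp
qed

lemma indefinite_integral_exists:
  assumes f: "locally_integrable f"
  obtains F :: "real \<Rightarrow> complex"
    where "\<And>x y. x \<le> y \<Longrightarrow> F y - F x = integral {x..y} f" "continuous_on UNIV F"
proof -
  have int: "f integrable_on {a..b}" for a b
    by (rule set_borel_integral_eq_integral(1)[OF locally_integrable_on_Icc[OF f]])
  define F where "F x = (if x \<ge> 0 then integral {0..x} f else - integral {x..0} f)" for x :: real
  have diff: "F y - F x = integral {x..y} f" if "x \<le> y" for x y
  proof -
    consider "0 \<le> x" | "x < 0" "0 \<le> y" | "y < 0" by linarith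
    then show ?thesis
    proof cases
      case 1
      then show ?thesis
        using that Henstock_Kurzweil_Integration.integral_combine[of 0 x y f] int by (simp add: F_def algebra_simps)
    next
      case 2
      then show ?thesis
        using that Henstock_Kurzweil_Integration.integral_combine[of x 0 y f] int by (simp add: F_def algebra_simps)
    next
      case 3
      then show ?thesis
        using that Henstock_Kurzweil_Integration.integral_combine[of x y 0 f] int by (simp add: F_def algebra_simps)
    qed
  qed
  have cM: "continuous_on {-M..M} F" for M
  proof (rule continuous_on_eq)
    show "continuous_on {-M..M} (\<lambda>x. F (-M) + integral {-M..x} f)"
      by (intro continuous_intros indefinite_integral_continuous_1 int)
    fix x assume "x \<in> {-M..M}"
    then have "integral {-M..x} f = F x - F (- M)" using diff[of "-M" x] by simp
    then show "F (- M) + integral {- M..x} f = F x" by simp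
  qed
  have cO: "continuous_on {-M<..<M} F" for M
    by (rule continuous_on_subset[OF cM[of M]]) auto
  have "isCont F x" for x
  proof -
    have "\<forall>y\<in>{-(\<bar>x\<bar> + 1)<..<\<bar>x\<bar> + 1}. isCont F y"
      using cO[of "\<bar>x\<bar> + 1"] by (simp only: continuous_on_eq_continuous_at open_greaterThanLessThan)
    then show ?thesis by (rule bspec) auto
  qed
  then have "continuous_on UNIV F" by (simp add: continuous_at_imp_continuous_on)
  with diff that show thesis by blast
qed

lemma integral_indefinite_integral_test:
  assumes W: "locally_integrable W" and F: "\<And>x y. x \<le> y \<Longrightarrow> F y - F x = integral {x..y} W"
    and cF: "continuous_on UNIV F"
    and \<psi>: "test_function \<psi>" "\<And>x. (\<psi> has_vector_derivative \<psi>' x) (at x)"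
  shows "(LINT x|lborel. F x * \<psi>' x) = - (LINT x|lborel. W x * \<psi> x)"
proof -
  obtain \<psi>'' M where M: "M > 0" "\<And>x. (\<psi> has_vector_derivative \<psi>'' x) (at x)"
    "continuous_on UNIV \<psi>''" "\<And>x. \<bar>x\<bar> \<ge> M \<Longrightarrow> \<psi> x = 0" "\<And>x. \<bar>x\<bar> \<ge> M \<Longrightarrow> \<psi>'' x = 0"
    using \<psi>(1) by (rule test_functionE) blast
  have eq: "\<psi>'' = \<psi>'"
    using \<psi>(2) M(2) by (metis ext vector_derivative_at)
  note M = M[unfolded eq]
  note [measurable] = locally_integrable_measurable[OF W] borel_measurable_continuous_onI[OF M(3)]
  define V where "V x = indicator {-M..M} x *\<^sub>R W x" for x
  have V: "integrable lborel V"
    unfolding V_def[abs_def] using W by (simp add: locally_integrable_def set_integrable_def)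
  have [measurable]: "V \<in> borel_measurable borel" unfolding V_def[abs_def] by measurable
  \<comment> \<open>Integrating over \<open>t\<close> produces
    \<open>(F x - F (- M)) * \<psi>' x\<close>, integrating over \<open>x\<close> produces
    \<open>- (W t * \<psi> t)\<close>. The cut-off \<open>V\<close> of \<open>W\<close> makes
    \<open>k\<close> integrable on the plane.\<close>
  define k where "k x t = (if t \<le> x then \<psi>' x * V t else 0)" for x t :: real
  have [measurable]: "case_prod k \<in> borel_measurable (lborel \<Otimes>\<^sub>M lborel)"
    unfolding k_def[abs_def] by measurable
  have i\<psi>: "integrable lborel \<psi>'"
    using integrable_mult_continuous[OF continuous_imp_locally_integrable M(3,5), of "\<lambda>_. 1"] by simp
  have k_le: "norm (k x t) \<le> cmod (\<psi>' x) * cmod (V t)" for x t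
    by (simp add: k_def norm_mult)
  have ik: "integrable lborel (k x)" for x
    by (rule Bochner_Integration.integrable_bound[of _ "\<lambda>t. \<psi>' x * V t"])
      (use V in \<open>auto simp: k_def[abs_def] norm_mult\<close>)
  have intk: "integrable (lborel \<Otimes>\<^sub>M lborel) (case_prod k)"
  proof (rule lborel_pair.Fubini_integrable)
    show "integrable lborel (\<lambda>x. LINT y|lborel. norm (case_prod k (x, y)))"
    proof (rule Bochner_Integration.integrable_bound)
      show "integrable lborel (\<lambda>x. cmod (\<psi>' x) * (LINT t|lborel. cmod (V t)))"
        using i\<psi> by simp
      have "(LINT y|lborel. norm (k x y)) \<le> (LINT t|lborel. cmod (\<psi>' x) * cmod (V t))" for x
        using V ik k_le by (intro integral_mono) auto
      then show "AE x in lborel. norm (LINT y|lborel. norm (case_prod k (x, y)))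
          \<le> norm (cmod (\<psi>' x) * (LINT t|lborel. cmod (V t)))"
        by (simp add: abs_mult)
    qed measurable
  qed (use ik in auto)
  have inner: "(LINT t|lborel. k x t) = (F x - F (-M)) * \<psi>' x" for x
  proof (cases "\<bar>x\<bar> \<ge> M")
    case False
    have "(LINT t|lborel. k x t) = (LINT t|lborel. \<psi>' x * (indicator {-M..x} t *\<^sub>R W t))"
      by (intro Bochner_Integration.integral_cong) (use False in \<open>auto simp: k_def V_def indicator_def\<close>)
    also have "\<dots> = \<psi>' x * integral {-M..x} W"
      using set_borel_integral_eq_integral(2)[OF locally_integrable_on_Icc[OF W, of "-M" x]]
      by (subst integral_mult_right_zero) (simp add: set_lebesgue_integral_def)
    finally show ?thesis using F[of "-M" x] False by simp
  qed (simp add: k_def M(5) cong: if_cong)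
  have outer: "(LINT x|lborel. k x t) = - (W t * \<psi> t)" for t
  proof (cases "t \<in> {-M..<M}")
    case True
    have "(LINT x|lborel. k x t) = (LINT x|lborel. V t * (indicator {t..M} x *\<^sub>R \<psi>' x))"
    proof (intro Bochner_Integration.integral_cong refl)
      fix x
      show "k x t = V t * (indicator {t..M} x *\<^sub>R \<psi>' x)"
        using M(5)[of x] True by (cases "x \<le> M") (auto simp: k_def)
    qed
    also have "\<dots> = V t * (\<psi> M - \<psi> t)"
      using True M(2,3) by (subst integral_mult_right_zero, subst integral_FTC_atLeastAtMost)
        (auto intro: has_vector_derivative_at_within continuous_on_subset)
    finally show ?thesis using True M(1,4) by (auto simp: V_def)
  next
    case False
    have "k x t = 0" for x
      using False M(5)[of x] by (auto simp: k_def V_def indicator_def)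
    moreover have "\<bar>t\<bar> \<ge> M" using False by (simp add: linorder_not_less) linarith
    ultimately show ?thesis using M(4)[of t] by simp
  qed
  have "(LINT x|lborel. \<psi>' x) = \<psi> M - \<psi> (- M)"
    by (rule integral_compactly_supported_derivative) (use M in auto)
  also have "\<dots> = 0" using M by simp
  finally have z: "(LINT x|lborel. F (- M) * \<psi>' x) = 0" by simp
  have "(LINT x|lborel. (F x - F (-M)) * \<psi>' x) = - (LINT x|lborel. W x * \<psi> x)"
    using lborel_pair.Fubini_integral[OF intk] by (simp add: inner outer)
  moreover have "(LINT x|lborel. (F x - F (-M)) * \<psi>' x)
      = (LINT x|lborel. F x * \<psi>' x) - (LINT x|lborel. F (- M) * \<psi>' x)"
    unfolding left_diff_distrib
    by (intro Bochner_Integration.integral_diff integrable_mult_right i\<psi>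
        integrable_mult_continuous[OF continuous_imp_locally_integrable M(3,5)] cF)
  ultimately show ?thesis unfolding z by simp
qed

lemma du_Bois_Reymond:
  assumes f: "locally_integrable f" and W: "locally_integrable W"
    and eq: "\<And>\<psi> \<psi>'. test_function \<psi> \<Longrightarrow> (\<And>x. (\<psi> has_vector_derivative \<psi>' x) (at x)) \<Longrightarrow>
      (LINT x|lborel. f x * \<psi>' x) = - (LINT x|lborel. W x * \<psi> x)"
  obtains F where "AE x in lborel. f x = F x" "continuous_on UNIV F"
    "\<And>x y. x \<le> y \<Longrightarrow> F y - F x = integral {x..y} W"
proof -
  obtain F where F: "\<And>x y. x \<le> y \<Longrightarrow> F y - F x = integral {x..y} W" "continuous_on UNIV F"
    using W by (rule indefinite_integral_exists) blast
  have lF: "locally_integrable F" using F(2) by (rule continuous_imp_locally_integrable)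
  obtain c where c: "AE x in lborel. f x - F x = c"
  proof (rule AE_const_if_test_derivative_integrals_zero[of "\<lambda>x. f x - F x"])
    show "locally_integrable (\<lambda>x. f x - F x)" by (intro locally_integrable_diff f lF)
    fix \<psi> \<psi>' assume \<psi>: "test_function \<psi>" "\<And>x. (\<psi> has_vector_derivative \<psi>' x) (at x)"
    obtain \<psi>'' where \<psi>'': "test_function \<psi>''" "\<And>x. (\<psi> has_vector_derivative \<psi>'' x) (at x)"
      using \<psi>(1) by (rule test_functionE) blast
    have "\<psi>'' = \<psi>'"
      using \<psi>(2) \<psi>''(2) by (metis ext vector_derivative_at)
    then have "(LINT x|lborel. (f x - F x) * \<psi>' x)
        = (LINT x|lborel. f x * \<psi>' x) - (LINT x|lborel. F x * \<psi>' x)"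
      unfolding left_diff_distrib using \<psi>''(1)
      by (intro Bochner_Integration.integral_diff integrable_mult_test f lF) auto
    then show "(LINT x|lborel. (f x - F x) * \<psi>' x) = 0"
      using eq[OF \<psi>] integral_indefinite_integral_test[OF W F \<psi>] by simp
  qed blast
  show thesis
  proof (rule that[of "\<lambda>x. F x + c"])
    show "AE x in lborel. f x = F x + c" using c by eventually_elim (simp add: algebra_simps)
    show "continuous_on UNIV (\<lambda>x. F x + c)" by (intro continuous_intros F)
  qed (simp add: F)
qed

section \<open>The weak form of the resolvent equation\<close>

lemma square_integrable_imp_locally_integrable:
  assumes f: "square_integrable f"
  shows "locally_integrable f"
  unfolding locally_integrable_def set_integrable_def
proof
  fix M :: real
  note [measurable] = square_integrableD(2)[OF f]
  show "integrable lborel (\<lambda>x. indicator {-M..M} x *\<^sub>R f x)"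
  proof (rule Bochner_Integration.integrable_bound)
    show "integrable lborel (\<lambda>x. indicator {-M..M} x + (cmod (f x))\<^sup>2)"
      using square_integrableD(3)[OF f] by (intro Bochner_Integration.integrable_add) (auto simp: emeasure_lborel_Icc_eq)
    have "norm (indicator {-M..M} x *\<^sub>R f x) \<le> norm (indicator {-M..M} x + (cmod (f x))\<^sup>2)" for x
    proof -
      have "0 \<le> (cmod (f x) - 1)\<^sup>2 + (cmod (f x))\<^sup>2 + 1" by simp
      then have "cmod (f x) \<le> 1 + (cmod (f x))\<^sup>2" by (simp add: power2_eq_square algebra_simps)
      then show ?thesis by (auto simp: indicator_def)
    qed
    then show "AE x in lborel. norm (indicator {-M..M} x *\<^sub>R f x)
        \<le> norm (indicator {-M..M} x + (cmod (f x))\<^sup>2)" by simp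
  qed measurable
qed

definition weight :: "real \<Rightarrow> real" where "weight x = 1 - (phi x)\<^sup>2"

lemma weight_measurable [measurable]: "weight \<in> borel_measurable borel"
  unfolding weight_def by measurable

lemma weight_bounds: "0 \<le> weight x" "weight x \<le> 1"
  by (auto simp: weight_def phi_def power_le_one)

lemma weight_minus: "weight (- x) = weight x"
  by (simp add: weight_def phi_def)

lemma weight_pos_eq: "x > 0 \<Longrightarrow> weight x = 1 - exp (- 2 * x)"
  by (simp add: weight_def phi_def power2_eq_square flip: exp_add)

lemma phi_phi'_pos_eq: "x > 0 \<Longrightarrow> phi x * phi' x = - exp (- 2 * x)"
  by (simp add: phi_def phi'_def flip: exp_add)

lemma phi_phi'_minus: "phi (- x) * phi' (- x) = - (phi x * phi' x)"
  by (simp add: phi_def phi'_def sgn_minus)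

lemma phi_phi'_bound: "\<bar>phi x * phi' x\<bar> \<le> 1"
  by (auto simp: phi_def phi'_def abs_mult sgn_real_def mult_le_one)

text \<open>The pairing of \<open>(L - \<mu>) v = g\<close> with a test function \<open>\<psi>\<close>, with the derivative moved to \<open>\<psi>\<close>: the
  coefficient \<open>-3\<close> is \<open>-2\<close> from differentiating \<open>1 - \<phi>\<^sup>2\<close> and \<open>-1\<close> from the zeroth order term.\<close>

definition adjoint_term :: "complex \<Rightarrow> (real \<Rightarrow> complex) \<Rightarrow> (real \<Rightarrow> complex) \<Rightarrow> real \<Rightarrow> complex" where
  "adjoint_term \<mu> \<psi> \<psi>' x = complex_of_real (weight x) * \<psi>' x + (\<mu> - 3 * complex_of_real (phi x * phi' x)) * \<psi> x"

text \<open>Stated for representatives instead of classes, and with the classical derivative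
  \<open>\<psi>'\<close> as a variable of its own, so that no choice of
  \<open>vector_derivative\<close> at 0 enters later computations.\<close>

definition weak_resolvent_eq :: "complex \<Rightarrow> (real \<Rightarrow> complex) \<Rightarrow> (real \<Rightarrow> complex) \<Rightarrow> bool" where
  "weak_resolvent_eq \<mu> v g \<longleftrightarrow> square_integrable v \<and> square_integrable g \<and>
    (\<forall>\<psi> \<psi>'. test_function \<psi> \<longrightarrow> (\<forall>x. (\<psi> has_vector_derivative \<psi>' x) (at x)) \<longrightarrow>
      (LINT x|lborel. g x * \<psi> x) = - (LINT x|lborel. v x * adjoint_term \<mu> \<psi> \<psi>' x))"

lemma test_function_derivE:
  assumes "test_function \<psi>" "\<And>x. (\<psi> has_vector_derivative \<psi>' x) (at x)"
  obtains M where "M > 0" "\<And>x. \<bar>x\<bar> \<ge> M \<Longrightarrow> \<psi> x = 0" "\<And>x. \<bar>x\<bar> \<ge> M \<Longrightarrow> \<psi>' x = 0"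
    "continuous_on UNIV \<psi>" "continuous_on UNIV \<psi>'" "test_function \<psi>'"
proof -
  obtain \<psi>'' M where M: "M > 0" "\<And>x. (\<psi> has_vector_derivative \<psi>'' x) (at x)"
    "continuous_on UNIV \<psi>''" "\<And>x. \<bar>x\<bar> \<ge> M \<Longrightarrow> \<psi> x = 0" "\<And>x. \<bar>x\<bar> \<ge> M \<Longrightarrow> \<psi>'' x = 0"
    "test_function \<psi>''"
    using assms(1) by (rule test_functionE) blast
  have "\<psi>'' = \<psi>'"
    using assms(2) M(2) by (metis ext vector_derivative_at)
  moreover have "continuous_on UNIV \<psi>"
    using assms(1) by (simp add: test_function_iff smooth_fun_imp_continuous)
  ultimately show thesis using M that by simp
qed

lemma integrable_coeff_test:
  assumes v: "square_integrable v" and \<psi>: "test_function \<psi>"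
    and c: "c \<in> borel_measurable borel" "\<And>x. cmod (c x) \<le> B"
  shows "integrable lborel (\<lambda>x. v x * (c x * \<psi> x))"
proof -
  have "integrable lborel (\<lambda>x. (c x * v x) * \<psi> x)"
    by (intro integrable_mult_test \<psi> square_integrable_imp_locally_integrable
        square_integrable_bounded_mult[OF v c])
  then show ?thesis by (simp add: mult_ac)
qed

text \<open>The left side is spelled as the representative of
  \<open>y + \<mu> *\<^sub>C u + - mult_phi_phi' u\<close>, the form in which the operator equation
  arrives from \<open>L_eq_iff\<close>. Both sides are the same linear relation between four
  integrals \<open>A\<close>, \<open>B\<close>, \<open>C\<close>, \<open>G\<close>.\<close>

lemma is_weighted_deriv_iff_weak_resolvent_eq:
  assumes v: "square_integrable v" and g: "square_integrable g"
  shows "(\<forall>\<psi>. test_function \<psi> \<longrightarrow>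
      (LINT x|lborel. (g x + \<mu> * v x + - (complex_of_real (phi x * phi' x) * v x)) * \<psi> x) =
      deriv_pairing v (\<lambda>x. complex_of_real (1 - (phi x)\<^sup>2) * \<psi> x))
    \<longleftrightarrow> weak_resolvent_eq \<mu> v g"
proof -
  note [measurable] = square_integrableD(2)[OF v] square_integrableD(2)[OF g]
  have *: "(LINT x|lborel. (g x + \<mu> * v x + - (complex_of_real (phi x * phi' x) * v x)) * \<psi> x) =
      deriv_pairing v (\<lambda>x. complex_of_real (1 - (phi x)\<^sup>2) * \<psi> x) \<longleftrightarrow>
      (LINT x|lborel. g x * \<psi> x) = - (LINT x|lborel. v x * adjoint_term \<mu> \<psi> \<psi>' x)"
    if \<psi>: "test_function \<psi>" "\<And>x. (\<psi> has_vector_derivative \<psi>' x) (at x)" for \<psi> \<psi>'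
  proof -
    have t': "test_function \<psi>'" using \<psi> by (rule test_function_derivE)
    note [measurable] = test_function_measurable[OF \<psi>(1)] test_function_measurable[OF t']
    have bw: "cmod (complex_of_real (weight x)) \<le> 1" for x
      using weight_bounds[of x] by simp
    have bp: "cmod (complex_of_real (phi x * phi' x)) \<le> 1" for x
      using phi_phi'_bound[of x] by (simp only: norm_of_real)
    have i1: "integrable lborel (\<lambda>x. v x * (complex_of_real (weight x) * \<psi>' x))"
      by (intro integrable_coeff_test[OF v t' _ bw]) measurable
    have i2: "integrable lborel (\<lambda>x. v x * (complex_of_real (phi x * phi' x) * \<psi> x))"
      by (intro integrable_coeff_test[OF v \<psi>(1) _ bp]) measurable
    have i3: "integrable lborel (\<lambda>x. v x * (\<mu> * \<psi> x))"
      by (rule integrable_coeff_test[OF v \<psi>(1), of _ "cmod \<mu>"]) auto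
    have i4: "integrable lborel (\<lambda>x. g x * \<psi> x)"
      by (intro integrable_mult_test \<psi> square_integrable_imp_locally_integrable g)
    define A where "A = (LINT x|lborel. v x * (complex_of_real (weight x) * \<psi>' x))"
    define B where "B = (LINT x|lborel. v x * (complex_of_real (phi x * phi' x) * \<psi> x))"
    define C where "C = (LINT x|lborel. v x * (\<mu> * \<psi> x))"
    define G where "G = (LINT x|lborel. g x * \<psi> x)"
    have "deriv_pairing v (\<lambda>x. complex_of_real (1 - (phi x)\<^sup>2) * \<psi> x)
        = - (LINT x|lborel. v x * (complex_of_real (weight x) * \<psi>' x)
              + (- 2) * (v x * (complex_of_real (phi x * phi' x) * \<psi> x)))"
      unfolding deriv_pairing_def
    proof (intro arg_cong[where f = uminus] integral_cong_AE)
      show "(\<lambda>x. v x * vector_derivative (\<lambda>x. complex_of_real (1 - (phi x)\<^sup>2) * \<psi> x) (at x))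
          \<in> borel_measurable lborel"
        using weighted_test_deriv_measurable[OF \<psi>(1)] by measurable
      show "AE x in lborel. v x * vector_derivative (\<lambda>x. complex_of_real (1 - (phi x)\<^sup>2) * \<psi> x) (at x)
          = v x * (complex_of_real (weight x) * \<psi>' x)
              + (- 2) * (v x * (complex_of_real (phi x * phi' x) * \<psi> x))"
        using AE_lborel_singleton[of 0]
      proof eventually_elim
        case (elim x)
        then show ?case
          unfolding vector_derivative_at[OF weighted_test_vector_derivative[OF \<psi>(2) elim]] weight_def
          by (simp add: algebra_simps)
      qed
    qed measurable
    also have "\<dots> = - (A + (- 2) * B)"
      unfolding A_def B_def using i1 i2 by (simp del: of_real_mult)
    finally have 1: "deriv_pairing v (\<lambda>x. complex_of_real (1 - (phi x)\<^sup>2) * \<psi> x) = - (A + (- 2) * B)" .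
    have "(LINT x|lborel. (g x + \<mu> * v x + - (complex_of_real (phi x * phi' x) * v x)) * \<psi> x)
      = (LINT x|lborel. g x * \<psi> x + v x * (\<mu> * \<psi> x)
          - v x * (complex_of_real (phi x * phi' x) * \<psi> x))"
      by (intro Bochner_Integration.integral_cong) (simp_all add: algebra_simps)
    also have "\<dots> = G + C - B"
      unfolding G_def C_def B_def
      using i2 i3 i4 by (simp del: of_real_mult)
    finally have 2: "(LINT x|lborel. (g x + \<mu> * v x + - (complex_of_real (phi x * phi' x) * v x)) * \<psi> x)
      = G + C - B" .
    have "(LINT x|lborel. v x * adjoint_term \<mu> \<psi> \<psi>' x)
      = (LINT x|lborel. v x * (complex_of_real (weight x) * \<psi>' x) + v x * (\<mu> * \<psi> x)
          - 3 * (v x * (complex_of_real (phi x * phi' x) * \<psi> x)))"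
      unfolding adjoint_term_def
      by (intro Bochner_Integration.integral_cong) (simp_all add: algebra_simps)
    also have "\<dots> = A + C - 3 * B"
      unfolding A_def C_def B_def
      using i1 i2 i3 by (simp del: of_real_mult)
    finally have 3: "(LINT x|lborel. v x * adjoint_term \<mu> \<psi> \<psi>' x) = A + C - 3 * B" .
    show ?thesis
      unfolding 1 2 3 G_def[symmetric] by (auto simp: algebra_simps)
  qed
  show ?thesis
    unfolding weak_resolvent_eq_def using v g *
    by (metis (no_types, lifting) test_functionE)
qed

section \<open>Kernel, range and closure in terms of representatives\<close>

lemma l2_relI: "square_integrable f \<Longrightarrow> l2_rel f f"
  by (simp add: l2_rel_def)

lemma L2_exhaust:
  obtains f where "square_integrable f" "u = abs_L2 f"
proof -
  have "l2_rel (rep_L2 u) (rep_L2 u)" "abs_L2 (rep_L2 u) = u"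
    using Quotient3_rep_reflp[OF Quotient3_L2] Quotient3_abs_rep[OF Quotient3_L2] by auto
  with that[of "rep_L2 u"] show thesis by (simp add: l2_rel_def)
qed

lemma abs_L2_eq_iff:
  assumes "square_integrable f" "square_integrable g"
  shows "abs_L2 f = abs_L2 g \<longleftrightarrow> (AE x in lborel. f x = g x)"
  using Quotient3_rel[OF Quotient3_L2, of f g] assms by (simp add: l2_rel_def)

text \<open>Justifies the definite description in \<open>L\<close>: two weighted derivatives have
  the same integrals against all test functions.\<close>

lemma is_weighted_deriv_unique:
  assumes "is_weighted_deriv u w1" "is_weighted_deriv u w2"
  shows "w1 = w2"
proof -
  obtain v where v: "square_integrable v" "u = abs_L2 v" by (rule L2_exhaust)
  obtain f1 where f1: "square_integrable f1" "w1 = abs_L2 f1" by (rule L2_exhaust)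
  obtain f2 where f2: "square_integrable f2" "w2 = abs_L2 f2" by (rule L2_exhaust)
  note l1 = square_integrable_imp_locally_integrable[OF f1(1)]
  note l2 = square_integrable_imp_locally_integrable[OF f2(1)]
  have "AE x in lborel. f1 x - f2 x = 0"
  proof (rule AE_zero_if_test_integrals_zero)
    show "locally_integrable (\<lambda>x. f1 x - f2 x)" by (intro locally_integrable_diff l1 l2)
    fix \<psi> assume \<psi>: "test_function \<psi>"
    have "(LINT x|lborel. f1 x * \<psi> x) = (LINT x|lborel. f2 x * \<psi> x)"
      using assms \<psi> unfolding v f1(2) f2(2)
      by (simp add: is_weighted_deriv.abs_eq l2_relI v(1) f1(1) f2(1))
    then show "(LINT x|lborel. (f1 x - f2 x) * \<psi> x) = 0"
      unfolding left_diff_distrib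
      by (simp add: integrable_mult_test[OF l1 \<psi>] integrable_mult_test[OF l2 \<psi>])
  qed
  then show ?thesis unfolding f1(2) f2(2) by (simp add: abs_L2_eq_iff f1(1) f2(1))
qed

text \<open>Removes the definite description: domain membership and the operator equation together
  become a single instance of the relation \<open>is_weighted_deriv\<close>.\<close>

lemma L_eq_iff: "u \<in> Dom_L \<and> L u - \<mu> *\<^sub>C u = y \<longleftrightarrow>
  is_weighted_deriv u (y + \<mu> *\<^sub>C u + - mult_phi_phi' u)"
proof -
  have *: "L u = w + mult_phi_phi' u" if "is_weighted_deriv u w" for w
    unfolding L_def using that is_weighted_deriv_unique by (metis the_equality)
  show ?thesis
    using * by (auto simp: Dom_L_def algebra_simps)
qed

lemma L_abs_L2_eq_iff:
  assumes v: "square_integrable v" and g: "square_integrable g"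
  shows "abs_L2 v \<in> Dom_L \<and> L (abs_L2 v) - \<mu> *\<^sub>C abs_L2 v = abs_L2 g \<longleftrightarrow> weak_resolvent_eq \<mu> v g"
proof -
  have m: "square_integrable (\<lambda>x. complex_of_real (phi x * phi' x) * v x)"
    using phi_phi'_bound by (intro square_integrable_bounded_mult[OF v, of _ 1])
      (measurable, simp only: norm_of_real)
  have n: "square_integrable (\<lambda>x. - (complex_of_real (phi x * phi' x) * v x))"
    using square_integrable_cmult[OF m, of "-1"] by simp
  note s = square_integrable_cmult[OF v, of \<mu>]
  have e: "abs_L2 g + \<mu> *\<^sub>C abs_L2 v + - mult_phi_phi' (abs_L2 v)
      = abs_L2 (\<lambda>x. g x + \<mu> * v x + - (complex_of_real (phi x * phi' x) * v x))"
    by (simp add: scaleC_L2.abs_eq mult_phi_phi'.abs_eq plus_L2.abs_eq uminus_L2.abs_eq l2_relI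
        v g m n s square_integrable_add del: of_real_mult)
  show ?thesis
    unfolding L_eq_iff e is_weighted_deriv_iff_weak_resolvent_eq[OF v g, symmetric]
    by (rule is_weighted_deriv.abs_eq) (intro l2_relI v g n s square_integrable_add)+
qed

lemma zero_L2_eq: "0 = abs_L2 (\<lambda>_. 0)"
  by (simp add: zero_L2_def)

lemma abs_L2_in_op_ker_iff:
  assumes "square_integrable v"
  shows "abs_L2 v \<in> op_ker Dom_L L \<mu> \<longleftrightarrow> weak_resolvent_eq \<mu> v (\<lambda>_. 0)"
  using L_abs_L2_eq_iff[OF assms square_integrable_0, of \<mu>] by (auto simp: op_ker_def zero_L2_eq)

lemma zero_in_op_ker: "0 \<in> op_ker Dom_L L \<mu>"
  using abs_L2_in_op_ker_iff[OF square_integrable_0, of \<mu>]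
  by (simp add: zero_L2_eq weak_resolvent_eq_def square_integrable_0)

lemma op_ker_eq_0_iff:
  "op_ker Dom_L L \<mu> = {0} \<longleftrightarrow> (\<forall>v. weak_resolvent_eq \<mu> v (\<lambda>_. 0) \<longrightarrow> (AE x in lborel. v x = 0))"
proof
  assume ker: "op_ker Dom_L L \<mu> = {0}"
  show "\<forall>v. weak_resolvent_eq \<mu> v (\<lambda>_. 0) \<longrightarrow> (AE x in lborel. v x = 0)"
  proof (intro allI impI)
    fix v assume w: "weak_resolvent_eq \<mu> v (\<lambda>_. 0)"
    then have sv: "square_integrable v" by (simp add: weak_resolvent_eq_def)
    have "abs_L2 v = 0" using abs_L2_in_op_ker_iff[OF sv, of \<mu>] w ker by simp
    then show "AE x in lborel. v x = 0"
      using abs_L2_eq_iff[OF sv square_integrable_0] by (simp add: zero_L2_eq)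
  qed
next
  assume h: "\<forall>v. weak_resolvent_eq \<mu> v (\<lambda>_. 0) \<longrightarrow> (AE x in lborel. v x = 0)"
  have "u = 0" if "u \<in> op_ker Dom_L L \<mu>" for u
  proof -
    obtain v where v: "square_integrable v" "u = abs_L2 v" by (rule L2_exhaust)
    then have "AE x in lborel. v x = 0" using abs_L2_in_op_ker_iff[OF v(1), of \<mu>] that h by simp
    then show ?thesis using abs_L2_eq_iff[OF v(1) square_integrable_0] by (simp add: v(2) zero_L2_eq)
  qed
  with zero_in_op_ker show "op_ker Dom_L L \<mu> = {0}" by auto
qed

lemma abs_L2_in_op_ran_iff:
  assumes "square_integrable g"
  shows "abs_L2 g \<in> op_ran Dom_L L \<mu> \<longleftrightarrow> (\<exists>v. weak_resolvent_eq \<mu> v g)"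
proof
  assume "abs_L2 g \<in> op_ran Dom_L L \<mu>"
  then obtain u where u: "u \<in> Dom_L" "L u - \<mu> *\<^sub>C u = abs_L2 g" by (auto simp: op_ran_def)
  obtain v where v: "square_integrable v" "u = abs_L2 v" by (rule L2_exhaust)
  then show "\<exists>v. weak_resolvent_eq \<mu> v g" using L_abs_L2_eq_iff[OF v(1) assms] u by blast
next
  assume "\<exists>v. weak_resolvent_eq \<mu> v g"
  then obtain v where v: "weak_resolvent_eq \<mu> v g" by blast
  then have "square_integrable v" by (simp add: weak_resolvent_eq_def)
  from L_abs_L2_eq_iff[OF this assms, of \<mu>] v show "abs_L2 g \<in> op_ran Dom_L L \<mu>"
    by (force simp: op_ran_def)
qed

lemma op_ran_eq_UNIV_iff:
  "op_ran Dom_L L \<mu> = UNIV \<longleftrightarrow> (\<forall>g. square_integrable g \<longrightarrow> (\<exists>v. weak_resolvent_eq \<mu> v g))"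
proof
  assume "op_ran Dom_L L \<mu> = UNIV"
  then show "\<forall>g. square_integrable g \<longrightarrow> (\<exists>v. weak_resolvent_eq \<mu> v g)"
    using abs_L2_in_op_ran_iff by blast
next
  assume h: "\<forall>g. square_integrable g \<longrightarrow> (\<exists>v. weak_resolvent_eq \<mu> v g)"
  have "u \<in> op_ran Dom_L L \<mu>" for u
  proof -
    obtain g where g: "square_integrable g" "u = abs_L2 g" by (rule L2_exhaust)
    then show ?thesis using h abs_L2_in_op_ran_iff[OF g(1)] by simp
  qed
  then show "op_ran Dom_L L \<mu> = UNIV" by blast
qed

lemma dist_abs_L2:
  assumes "square_integrable f" "square_integrable g"
  shows "dist (abs_L2 f) (abs_L2 g) = l2_norm (\<lambda>x. f x - g x)"
proof -
  have n: "square_integrable (\<lambda>x. - g x)"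
    using square_integrable_cmult[OF assms(2), of "-1"] by simp
  have "abs_L2 f - abs_L2 g = abs_L2 (\<lambda>x. f x + - g x)"
    by (simp add: minus_L2_def plus_L2.abs_eq uminus_L2.abs_eq l2_relI assms n)
  then show ?thesis
    using square_integrable_add[OF assms(1) n]
    by (simp add: dist_L2_def norm_L2.abs_eq l2_relI)
qed

lemma closure_op_ran_eq_UNIV:
  assumes "\<And>g e. square_integrable g \<Longrightarrow> e > 0 \<Longrightarrow>
    \<exists>v f. weak_resolvent_eq \<mu> v f \<and> l2_norm (\<lambda>x. f x - g x) < e"
  shows "closure (op_ran Dom_L L \<mu>) = UNIV"
proof -
  have "u \<in> closure (op_ran Dom_L L \<mu>)" for u
    unfolding closure_approachable
  proof (intro allI impI)
    fix e :: real assume "e > 0"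
    obtain g where g: "square_integrable g" "u = abs_L2 g" by (rule L2_exhaust)
    obtain v f where f: "weak_resolvent_eq \<mu> v f" "l2_norm (\<lambda>x. f x - g x) < e"
      using assms[OF g(1) \<open>e > 0\<close>] by blast
    then have sf: "square_integrable f" by (simp add: weak_resolvent_eq_def)
    show "\<exists>y\<in>op_ran Dom_L L \<mu>. dist y u < e"
    proof
      show "abs_L2 f \<in> op_ran Dom_L L \<mu>" using f(1) abs_L2_in_op_ran_iff[OF sf] by blast
      show "dist (abs_L2 f) u < e" using f(2) by (simp add: g(2) dist_abs_L2 sf g(1))
    qed
  qed
  then show ?thesis by blast
qed

section \<open>Variation of constants on the right half line\<close>

lemma weight_pos: "x > 0 \<Longrightarrow> weight x > 0"
  by (simp add: weight_pos_eq)

lemma weight_has_derivative: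
  assumes "x > 0"
  shows "(weight has_real_derivative 2 * exp (- 2 * x)) (at x)"
proof -
  have "((\<lambda>x. 1 - exp (- 2 * x)) has_real_derivative 2 * exp (- 2 * x)) (at x)"
    by (auto intro!: derivative_eq_intros)
  then show ?thesis
    by (rule has_field_derivative_transform_within_open[where S = "{0<..}"])
      (use assms in \<open>auto simp: weight_pos_eq\<close>)
qed

lemma weight_mono: "0 < x \<Longrightarrow> x \<le> y \<Longrightarrow> weight x \<le> weight y"
  by (simp add: weight_pos_eq)

text \<open>For \<open>x > 0\<close> this is \<open>ln (exp (2 * x) - 1) / 2\<close>, an increasing
  bijection of the half line onto the whole line: the end 0 is moved to minus infinity, where the
  coefficient of the derivative no longer degenerates.\<close>

definition travel :: "real \<Rightarrow> real" where "travel x = x + ln (weight x) / 2"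

lemma travel_measurable [measurable]: "travel \<in> borel_measurable borel"
  unfolding travel_def by measurable

lemma travel_has_derivative:
  assumes "x > 0"
  shows "(travel has_real_derivative 1 / weight x) (at x)"
proof -
  have "(travel has_real_derivative 1 + (1 / weight x * (2 * exp (- 2 * x))) / 2) (at x)"
    unfolding travel_def
    by (auto intro!: derivative_eq_intros weight_has_derivative assms weight_pos[OF assms])
  also have "1 + (1 / weight x * (2 * exp (- 2 * x))) / 2 = (weight x + exp (- 2 * x)) / weight x"
    using weight_pos[OF assms] by (simp add: field_simps)
  also have "weight x + exp (- 2 * x) = 1" using assms by (simp add: weight_pos_eq)
  finally show ?thesis .
qed

lemma travel_mono:
  assumes "0 < x" "x \<le> y"
  shows "travel x \<le> travel y"
proof -
  have "ln (weight x) \<le> ln (weight y)"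
    using assms weight_mono[OF assms] weight_pos[of x] weight_pos[of y]
    by (subst ln_le_cancel_iff) auto
  then show ?thesis using assms by (simp add: travel_def)
qed

lemma exp_travel: "x > 0 \<Longrightarrow> exp (2 * travel x) = exp (2 * x) * weight x"
  using weight_pos[of x] by (simp add: travel_def exp_add distrib_left)

text \<open>The extra decay of the weight at the end \<open>x = 0\<close>; it is the source of the
  shift by 2 that puts the lower edge of the strip at \<open>-2\<close>.\<close>

lemma weight_le_exp_travel:
  assumes "x > 0"
  shows "weight x \<le> exp (2 * travel x)"
  using exp_travel[OF assms] weight_pos[OF assms] mult_right_mono[of 1 "exp (2 * x)" "weight x"] assms
  by simp

text \<open>Absorbing the square root of the weight into one exponential makes the function nonzero
  everywhere and lets a single chain rule differentiate it.\<close>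

definition fsol :: "complex \<Rightarrow> real \<Rightarrow> complex" where
  "fsol \<mu> x = exp (complex_of_real (ln (weight x) / 2) + \<mu> * complex_of_real (travel x))"

lemma fsol_measurable [measurable]: "fsol \<mu> \<in> borel_measurable borel"
  unfolding fsol_def by measurable

lemma fsol_nonzero: "fsol \<mu> x \<noteq> 0"
  by (simp add: fsol_def)

lemma norm_fsol:
  assumes "x > 0"
  shows "cmod (fsol \<mu> x) = sqrt (weight x) * exp (Re \<mu> * travel x)"
proof -
  have "sqrt (weight x) = exp (ln (weight x) / 2)"
    using weight_pos[OF assms] by (simp add: ln_sqrt[symmetric])
  then show ?thesis by (simp add: fsol_def norm_exp_eq_Re exp_add norm_mult)
qed

lemma norm_fsol_power2:
  assumes "x > 0"
  shows "(cmod (fsol \<mu> x))\<^sup>2 = weight x * exp (2 * Re \<mu> * travel x)"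
  using weight_pos[OF assms]
  by (simp add: norm_fsol[OF assms] power_mult_distrib exp_double[symmetric] mult.assoc)

lemma fsol_has_derivative:
  assumes "x > 0"
  shows "(fsol \<mu> has_vector_derivative
    (\<mu> + complex_of_real (exp (- 2 * x))) / complex_of_real (weight x) * fsol \<mu> x) (at x)"
proof -
  have 1: "((\<lambda>x. ln (weight x) / 2) has_real_derivative exp (- 2 * x) / weight x) (at x)"
    using weight_pos[OF assms]
    by (auto intro!: derivative_eq_intros weight_has_derivative assms)
  have "((\<lambda>x. complex_of_real (ln (weight x) / 2) + \<mu> * complex_of_real (travel x)) has_vector_derivative
      (complex_of_real (exp (- 2 * x) / weight x) + \<mu> * complex_of_real (1 / weight x))) (at x)"
    using 1 travel_has_derivative[OF assms]
    by (intro has_vector_derivative_add has_vector_derivative_mult_right has_vector_derivative_of_real)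
      (simp_all add: has_real_derivative_iff_has_vector_derivative)
  from field_vector_diff_chain_at[OF this DERIV_exp]
  have "(fsol \<mu> has_vector_derivative
      (complex_of_real (exp (- 2 * x) / weight x) + \<mu> * complex_of_real (1 / weight x)) * fsol \<mu> x) (at x)"
    by (simp add: o_def fsol_def[abs_def])
  moreover have "complex_of_real (exp (- 2 * x) / weight x) + \<mu> * complex_of_real (1 / weight x)
      = (\<mu> + complex_of_real (exp (- 2 * x))) / complex_of_real (weight x)"
    by (simp add: add_divide_distrib)
  ultimately show ?thesis by simp
qed

text \<open>The weight contributes \<open>2 * exp (- 2 * x)\<close> and \<open>fsol\<close>
  contributes \<open>\<mu> + exp (- 2 * x)\<close>. As
  \<open>phi x * phi' x = - exp (- 2 * x)\<close> here, the sum is exactly the zeroth order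
  coefficient of \<open>adjoint_term\<close>.\<close>

lemma weighted_fsol_has_derivative:
  assumes "x > 0"
  shows "((\<lambda>x. complex_of_real (weight x) * fsol \<mu> x) has_vector_derivative
    (\<mu> - 3 * complex_of_real (phi x * phi' x)) * fsol \<mu> x) (at x)"
proof -
  have w: "((\<lambda>x. complex_of_real (weight x)) has_vector_derivative complex_of_real (2 * exp (- 2 * x))) (at x)"
    using weight_has_derivative[OF assms]
    by (intro has_vector_derivative_of_real) (simp add: has_real_derivative_iff_has_vector_derivative)
  have p: "complex_of_real (phi x * phi' x) = - complex_of_real (exp (- 2 * x))"
    by (simp only: phi_phi'_pos_eq[OF assms] of_real_minus)
  show ?thesis
    unfolding p
    by (rule has_vector_derivative_eq_rhs[OF has_vector_derivative_mult[OF w fsol_has_derivative[OF assms]]])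
      (use weight_pos[OF assms] in \<open>simp add: field_simps\<close>)
qed

lemma continuous_on_weight: "continuous_on S weight"
  unfolding weight_def phi_def by (intro continuous_intros)

lemma continuous_on_coefficient:
  "continuous_on {0<..} (\<lambda>x. (\<mu> - 3 * complex_of_real (phi x * phi' x)))"
proof (rule continuous_on_eq)
  show "continuous_on {0<..} (\<lambda>x::real. (\<mu> - 3 * complex_of_real (- exp (- 2 * x))))"
    by (intro continuous_intros)
qed (simp add: phi_phi'_pos_eq del: of_real_mult)

lemma coefficient_bound: "cmod (\<mu> - 3 * complex_of_real (phi x * phi' x)) \<le> cmod \<mu> + 3"
proof -
  have "cmod (complex_of_real (phi x * phi' x)) \<le> 1"
    using phi_phi'_bound[of x] by (simp only: norm_of_real)
  then show ?thesis
    by (intro order_trans[OF norm_triangle_ineq4]) (simp add: norm_mult del: of_real_mult)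
qed

lemma integral_cong_AE_Icc:
  fixes f g :: "real \<Rightarrow> complex"
  assumes "set_integrable lborel {a..b} f" "set_integrable lborel {a..b} g"
    and ae: "AE x in lborel. x \<in> {a..b} \<longrightarrow> f x = g x"
  shows "integral {a..b} f = integral {a..b} g"
proof -
  have "(LINT x:{a..b}|lborel. f x) = (LINT x:{a..b}|lborel. g x)"
    unfolding set_lebesgue_integral_def
  proof (rule integral_cong_AE)
    show "AE x in lborel. indicator {a..b} x *\<^sub>R f x = indicator {a..b} x *\<^sub>R g x"
      using ae by eventually_elim (auto simp: indicator_def)
  qed (use assms(1,2) in \<open>auto simp: set_integrable_def dest: borel_measurable_integrable\<close>)
  then show ?thesis
    using set_borel_integral_eq_integral(2)[OF assms(1)] set_borel_integral_eq_integral(2)[OF assms(2)]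
    by simp
qed

text \<open>By \<open>du_Bois_Reymond\<close> the function \<open>(1 - \<phi>\<^sup>2) v\<close> is an indefinite integral, so on \<open>x > 0\<close> the equation
  becomes a classical linear ODE as soon as its right-hand side is continuous there; variation of
  constants gives all its solutions.\<close>

lemma weak_solution_right_half_line:
  assumes v: "weak_resolvent_eq \<mu> v g"
    and y: "\<And>x. x > 0 \<Longrightarrow> (y has_vector_derivative y' x) (at x)"
    and g: "\<And>x. x > 0 \<Longrightarrow> g x = complex_of_real (weight x) * fsol \<mu> x * y' x"
    and cont: "continuous_on {0<..} g"
  obtains C where "AE x in lborel. x > 0 \<longrightarrow> v x = fsol \<mu> x * (C + y x)"
proof -
  define b where "b x = \<mu> - 3 * complex_of_real (phi x * phi' x)" for x
  have sv: "square_integrable v" and sg: "square_integrable g"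
    using v by (auto simp: weak_resolvent_eq_def)
  have bw: "cmod (complex_of_real (weight x)) \<le> 1" for x
    using weight_bounds[of x] by simp
  have bb: "cmod (b x) \<le> cmod \<mu> + 3" for x
    unfolding b_def by (rule coefficient_bound)
  have mb [measurable]: "b \<in> borel_measurable borel" unfolding b_def by measurable
  have lV: "locally_integrable (\<lambda>x. complex_of_real (weight x) * v x)"
    by (intro square_integrable_imp_locally_integrable square_integrable_bounded_mult[OF sv _ bw]) measurable
  define W where "W x = g x + b x * v x" for x
  have sW: "square_integrable W" unfolding W_def
    by (intro square_integrable_add sg square_integrable_bounded_mult[OF sv mb bb])
  then have lW: "locally_integrable W" by (rule square_integrable_imp_locally_integrable)
  have "(LINT x|lborel. complex_of_real (weight x) * v x * \<psi>' x) = - (LINT x|lborel. W x * \<psi> x)"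
    if \<psi>: "test_function \<psi>" "\<And>x. (\<psi> has_vector_derivative \<psi>' x) (at x)" for \<psi> \<psi>'
  proof -
    have t': "test_function \<psi>'" using \<psi> by (rule test_function_derivE)
    have i1: "integrable lborel (\<lambda>x. v x * (complex_of_real (weight x) * \<psi>' x))"
      by (intro integrable_coeff_test[OF sv t' _ bw]) measurable
    have i2: "integrable lborel (\<lambda>x. v x * (b x * \<psi> x))"
      by (rule integrable_coeff_test[OF sv \<psi>(1) mb bb])
    have i3: "integrable lborel (\<lambda>x. g x * \<psi> x)"
      by (intro integrable_mult_test \<psi> square_integrable_imp_locally_integrable sg)
    have "(LINT x|lborel. g x * \<psi> x) = - (LINT x|lborel. v x * (complex_of_real (weight x) * \<psi>' x) + v x * (b x * \<psi> x))"
      using v \<psi> unfolding weak_resolvent_eq_def adjoint_term_def b_def[symmetric] distrib_left by blast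
    then have "(LINT x|lborel. v x * (complex_of_real (weight x) * \<psi>' x))
        = - ((LINT x|lborel. g x * \<psi> x) + (LINT x|lborel. v x * (b x * \<psi> x)))"
      using i1 i2 by simp
    also have "\<dots> = - (LINT x|lborel. g x * \<psi> x + v x * (b x * \<psi> x))"
      using i2 i3 by simp
    also have "(\<lambda>x. g x * \<psi> x + v x * (b x * \<psi> x)) = (\<lambda>x. W x * \<psi> x)"
      by (simp add: W_def fun_eq_iff algebra_simps)
    finally show ?thesis by (simp add: mult_ac)
  qed
  then obtain F where F: "AE x in lborel. complex_of_real (weight x) * v x = F x" "continuous_on UNIV F"
    "\<And>x y. x \<le> y \<Longrightarrow> F y - F x = integral {x..y} W"
    by (rule du_Bois_Reymond[OF lV lW]) blast+
  \<comment> \<open>\<open>W\<close> with \<open>v\<close> replaced by \<open>F / weight\<close>. It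
    agrees with \<open>W\<close> almost everywhere on \<open>x > 0\<close> but is continuous there,
    so \<open>F\<close>, an indefinite integral of \<open>W\<close>, is differentiable at every
    positive point.\<close>
  define Y where "Y x = g x + b x / complex_of_real (weight x) * F x" for x
  have cY: "continuous_on {0<..} Y"
    unfolding Y_def b_def
    by (intro continuous_intros cont continuous_on_coefficient continuous_on_weight continuous_on_subset[OF F(2)])
      (auto dest: weight_pos)
  have WY: "AE x in lborel. x > 0 \<longrightarrow> W x = Y x"
    using F(1)
  proof eventually_elim
    case (elim x)
    then show ?case using weight_pos[of x] by (auto simp: W_def Y_def field_simps)
  qed
  have F': "(F has_vector_derivative Y x) (at x)" if "x > 0" for x
  proof -
    \<comment> \<open>A base point strictly between 0 and \<open>x\<close>, since continuity of
      \<open>Y\<close> is available only on the open half line.\<close>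
    define a where "a = x / 2"
    have a: "0 < a" "a < x" using that by (auto simp: a_def)
    have ca: "continuous_on {a..x + 1} Y"
      by (rule continuous_on_subset[OF cY]) (use a in auto)
    have eq: "F t = F a + integral {a..t} Y" if "t \<in> {a..x + 1}" for t
    proof -
      have "integral {a..t} W = integral {a..t} Y"
      proof (rule integral_cong_AE_Icc)
        show "set_integrable lborel {a..t} Y"
          by (intro borel_integrable_atLeastAtMost' continuous_on_subset[OF ca]) (use that in auto)
        show "AE x in lborel. x \<in> {a..t} \<longrightarrow> W x = Y x"
          using WY by eventually_elim (use a in auto)
      qed (rule locally_integrable_on_Icc[OF lW])
      then show ?thesis using F(3)[of a t] that by (simp add: algebra_simps)
    qed
    have "((\<lambda>t. F a + integral {a..t} Y) has_vector_derivative Y x) (at x within {a..x + 1})"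
      using integral_has_vector_derivative[OF ca, of x] a
      by (auto intro!: derivative_eq_intros)
    then have "(F has_vector_derivative Y x) (at x within {a..x + 1})"
      by (rule has_vector_derivative_transform[OF _ eq, rotated -1]) (use a in auto)
    moreover have "at x within {a..x + 1} = at x"
      using a by (intro at_within_interior) auto
    ultimately show ?thesis by simp
  qed
  \<comment> \<open>The integrating factor: \<open>K\<close> solves the homogeneous equation
    satisfied by \<open>F\<close> when \<open>g = 0\<close>, so the quotient \<open>F / K\<close>
    has derivative \<open>g / K = y'\<close>.\<close>
  define K where "K x = complex_of_real (weight x) * fsol \<mu> x" for x
  have K0: "K x \<noteq> 0" if "x > 0" for x
    using weight_pos[OF that] by (simp add: K_def fsol_nonzero)
  have "((\<lambda>x. F x * inverse (K x) - y x) has_vector_derivative 0) (at x within {0<..})" if "x > 0" for x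
  proof -
    have "(K has_vector_derivative b x * fsol \<mu> x) (at x)"
      unfolding K_def[abs_def] b_def by (rule weighted_fsol_has_derivative[OF that])
    from field_vector_diff_chain_at[OF this DERIV_inverse[OF K0[OF that]]]
    have "((\<lambda>x. inverse (K x)) has_vector_derivative b x * fsol \<mu> x * - (inverse (K x) ^ Suc (Suc 0))) (at x)"
      by (simp add: o_def)
    from has_vector_derivative_diff[OF has_vector_derivative_mult[OF F'[OF that] this] y[OF that]]
    have "((\<lambda>x. F x * inverse (K x) - y x) has_vector_derivative
        F x * (b x * fsol \<mu> x * - (inverse (K x) ^ Suc (Suc 0))) + Y x * inverse (K x) - y' x) (at x)" .
    also have "F x * (b x * fsol \<mu> x * - (inverse (K x) ^ Suc (Suc 0))) + Y x * inverse (K x) - y' x = 0"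
      using weight_pos[OF that] fsol_nonzero[of \<mu> x]
      by (simp add: Y_def g[OF that] K_def field_simps)
    finally show ?thesis by (rule has_vector_derivative_at_within)
  qed
  then obtain C where C: "\<And>x. x \<in> {0<..} \<Longrightarrow> F x * inverse (K x) - y x = C"
    using has_vector_derivative_zero_constant[of "{0<..}" "\<lambda>x. F x * inverse (K x) - y x"] by auto
  have "AE x in lborel. x > 0 \<longrightarrow> v x = fsol \<mu> x * (C + y x)"
    using F(1)
  proof eventually_elim
    case (elim x)
    show ?case
    proof
      assume x: "x > 0"
      have "F x * inverse (K x) = C + y x" using C[of x] x by (simp add: algebra_simps)
      then have "F x = K x * (C + y x)" using K0[OF x] by (simp add: field_simps)
      then show "v x = fsol \<mu> x * (C + y x)"
        using elim weight_pos[OF x] by (simp add: K_def)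
    qed
  qed
  then show thesis by (rule that)
qed

section \<open>Failure of square integrability at the two ends\<close>

lemma integral_ge_primitive:
  fixes f q q' :: "real \<Rightarrow> real"
  assumes f: "integrable lborel f" "\<And>x. f x \<ge> 0" and "a \<le> b"
    and q: "\<And>x. x \<in> {a..b} \<Longrightarrow> (q has_real_derivative q' x) (at x)" "continuous_on {a..b} q'"
    and le: "AE x in lborel. x \<in> {a..b} \<longrightarrow> q' x \<le> f x"
  shows "q b - q a \<le> (LINT x|lborel. f x)"
proof -
  have "q b - q a = (LINT x|lborel. indicator {a..b} x *\<^sub>R q' x)"
    using assms
    by (intro integral_FTC_atLeastAtMost[symmetric])
      (auto simp: has_real_derivative_iff_has_vector_derivative intro: has_vector_derivative_at_within)
  also have "\<dots> \<le> (LINT x|lborel. f x)"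
  proof (rule integral_mono_AE)
    show "integrable lborel (\<lambda>x. indicator {a..b} x *\<^sub>R q' x)"
      using borel_integrable_atLeastAtMost'[OF q(2)] by (simp add: set_integrable_def)
    show "AE x in lborel. indicator {a..b} x *\<^sub>R q' x \<le> f x"
      using le by eventually_elim (use f(2) in \<open>auto simp: indicator_def\<close>)
  qed (rule f)
  finally show ?thesis .
qed

text \<open>For \<open>Re \<mu> \<ge> 0\<close> both factors of
  \<open>(cmod (fsol \<mu> x))\<^sup>2\<close> are nondecreasing, so the integrand stays above a
  positive constant on an unbounded interval.\<close>

lemma fsol_mult_not_square_integrable_at_infinity:
  assumes v: "square_integrable v" "AE x in lborel. x > 0 \<longrightarrow> v x = fsol \<mu> x * z x"
    and "Re \<mu> \<ge> 0" and z: "\<delta> > 0" "X > 0" "\<And>x. x \<ge> X \<Longrightarrow> cmod (z x) \<ge> \<delta>"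
  shows False
proof -
  define c where "c = weight X * exp (2 * Re \<mu> * travel X) * \<delta>\<^sup>2"
  have c: "c > 0" using weight_pos z by (simp add: c_def)
  have le: "c \<le> (cmod (fsol \<mu> x * z x))\<^sup>2" if "x \<ge> X" for x
  proof -
    have "weight X * exp (2 * Re \<mu> * travel X) \<le> (cmod (fsol \<mu> x))\<^sup>2"
      using that z(2) weight_mono[OF z(2) that] travel_mono[OF z(2) that] weight_bounds[of X] assms(3)
      by (subst norm_fsol_power2) (auto intro!: mult_mono mult_left_mono)
    moreover have "\<delta>\<^sup>2 \<le> (cmod (z x))\<^sup>2" using z that by (intro power_mono) auto
    ultimately show ?thesis
      using weight_bounds[of X] unfolding c_def norm_mult power_mult_distrib
      by (intro mult_mono) auto
  qed
  define I where "I = (LINT x|lborel. (cmod (v x))\<^sup>2)"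
  have "c * (X + t) - c * X \<le> I" if "t \<ge> 0" for t
    unfolding I_def
  proof (rule integral_ge_primitive[where q' = "\<lambda>_. c" and q = "(*) c"])
    show "AE x in lborel. x \<in> {X..X + t} \<longrightarrow> c \<le> (cmod (v x))\<^sup>2"
      using v(2) by eventually_elim (use le z(2) in auto)
    show "((*) c has_real_derivative c) (at x)" for x
      by (auto intro!: derivative_eq_intros)
  qed (use that square_integrableD(3)[OF v(1)] in auto)
  \<comment> \<open>An interval long enough for the lower bound to reach
    \<open>\<bar>I\<bar> + 1\<close>, which exceeds \<open>I\<close>.\<close>
  from this[of "(\<bar>I\<bar> + 1) / c"] have "c * ((\<bar>I\<bar> + 1) / c) \<le> I"
    using c by (simp only: distrib_left) simp
  then show False using c by simp
qed

text \<open>Where \<open>travel x \<le> 0\<close> and \<open>Re \<mu> \<le> -2\<close>, the factor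
  \<open>exp (2 * Re \<mu> * travel x)\<close> is at least \<open>exp (- 4 * travel x)\<close>,
  which turns the weight into \<open>exp (- 4 * x) / weight x\<close>. As
  \<open>weight x \<le> 2 * x\<close> and \<open>x \<le> 1\<close>, this dominates a multiple of
  \<open>1 / x\<close>, whose integral diverges logarithmically.\<close>

lemma fsol_mult_not_square_integrable_at_zero:
  assumes v: "square_integrable v" "AE x in lborel. x > 0 \<longrightarrow> v x = fsol \<mu> x * z x"
    and r: "Re \<mu> \<le> - 2" and z: "\<delta> > 0" "X > 0" "\<And>x. 0 < x \<Longrightarrow> x \<le> X \<Longrightarrow> cmod (z x) \<ge> \<delta>"
    and X: "travel X \<le> 0" "X \<le> 1"
  shows False
proof -
  define c where "c = exp (- 4) / 2 * \<delta>\<^sup>2"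
  have c: "c > 0" using z by (simp add: c_def)
  have le: "c / x \<le> (cmod (fsol \<mu> x * z x))\<^sup>2" if x: "0 < x" "x \<le> X" for x
  proof -
    have t: "travel x \<le> 0" using travel_mono[OF x] X by simp
    have wx: "weight x \<le> 2 * x" using exp_ge_add_one_self[of "- 2 * x"] by (simp add: weight_pos_eq[OF x(1)])
    have "exp (2 * travel x) * exp (2 * travel x) = exp (4 * x) * (weight x)\<^sup>2"
      unfolding exp_travel[OF x(1)] by (simp add: power2_eq_square flip: exp_add)
    then have e4: "exp (4 * travel x) = exp (4 * x) * (weight x)\<^sup>2"
      by (simp flip: exp_add)
    have "exp (- 4) / 2 / x = exp (- 4) / (2 * x)" by simp
    also have "\<dots> \<le> exp (- 4 * x) / weight x"
      using wx weight_pos[OF x(1)] x X by (intro frac_le) auto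
    also have "\<dots> = weight x * (1 / exp (4 * travel x))"
      unfolding e4 using weight_pos[OF x(1)] by (simp add: exp_minus field_simps power2_eq_square)
    also have "1 / exp (4 * travel x) = exp (- 4 * travel x)" by (simp add: exp_minus field_simps)
    also have "\<dots> \<le> exp (2 * Re \<mu> * travel x)"
      using t r mult_right_mono_neg[of "2 * Re \<mu>" "- 4" "travel x"] by simp
    finally have "exp (- 4) / 2 / x \<le> (cmod (fsol \<mu> x))\<^sup>2"
      using weight_bounds[of x] by (simp add: norm_fsol_power2[OF x(1)] mult_left_mono)
    moreover have "\<delta>\<^sup>2 \<le> (cmod (z x))\<^sup>2" using z x by (intro power_mono) auto
    ultimately have "exp (- 4) / 2 / x * \<delta>\<^sup>2 \<le> (cmod (fsol \<mu> x * z x))\<^sup>2"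
      unfolding norm_mult power_mult_distrib using x by (intro mult_mono) auto
    then show ?thesis by (simp add: c_def)
  qed
  define I where "I = (LINT x|lborel. (cmod (v x))\<^sup>2)"
  have "c * ln X - c * ln \<epsilon> \<le> I" if "\<epsilon> > 0" "\<epsilon> \<le> X" for \<epsilon>
    unfolding I_def
  proof (rule integral_ge_primitive[where q' = "\<lambda>x. c / x" and q = "\<lambda>x. c * ln x"])
    show "AE x in lborel. x \<in> {\<epsilon>..X} \<longrightarrow> c / x \<le> (cmod (v x))\<^sup>2"
      using v(2) by eventually_elim (use le that in auto)
    show "((\<lambda>x. c * ln x) has_real_derivative c / x) (at x)" if "x \<in> {\<epsilon>..X}" for x
      using that \<open>\<epsilon> > 0\<close> by (auto intro!: derivative_eq_intros)
    show "continuous_on {\<epsilon>..X} (\<lambda>x. c / x)"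
      using \<open>\<epsilon> > 0\<close> by (intro continuous_intros) auto
  qed (use that square_integrableD(3)[OF v(1)] in auto)
  \<comment> \<open>This value of \<open>\<epsilon>\<close> makes the logarithmic lower bound equal
    to \<open>\<bar>I\<bar> + 1\<close>.\<close>
  moreover have "ln (X * exp (- ((\<bar>I\<bar> + 1) / c))) = ln X - (\<bar>I\<bar> + 1) / c"
    using z(2) by (simp add: ln_mult)
  ultimately have "c * ln X - c * (ln X - (\<bar>I\<bar> + 1) / c) \<le> I"
    using z(2) c by (metis divide_nonneg_pos abs_ge_zero add_nonneg_nonneg exp_gt_zero exp_le_one_iff
        less_eq_real_def mult_pos_pos mult_right_le_one_le neg_le_0_iff_le zero_le_one)
  then have "c * ((\<bar>I\<bar> + 1) / c) \<le> I" by (simp add: right_diff_distrib)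
  then show False using c by simp
qed

lemma travel_at_zero:
  obtains X where "0 < X" "X \<le> 1" "travel X \<le> - B"
proof -
  \<comment> \<open>From \<open>weight X \<le> 2 * X\<close> the logarithmic part of
    \<open>travel X\<close> is at most \<open>- \<bar>B\<bar> - 1\<close>; the additional 1 pays for
    the summand \<open>X \<le> 1\<close>.\<close>
  define X where "X = min 1 (exp (- 2 * (\<bar>B\<bar> + 1)) / 2)"
  have X: "0 < X" "X \<le> 1" "2 * X \<le> exp (- 2 * (\<bar>B\<bar> + 1))" by (auto simp: X_def min_def)
  have "weight X \<le> 2 * X" using exp_ge_add_one_self[of "- 2 * X"] by (simp add: weight_pos_eq[OF X(1)])
  then have "ln (weight X) \<le> ln (exp (- 2 * (\<bar>B\<bar> + 1)))"
    using X weight_pos[OF X(1)] by (subst ln_le_cancel_iff) auto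
  then have "travel X \<le> - B" using X by (simp add: travel_def)
  with X that show thesis by blast
qed

lemma travel_at_infinity:
  obtains X where "0 < X" "travel X \<ge> B"
proof -
  define X where "X = 1 + max 0 (B - travel 1)"
  have "X + ln (weight 1) / 2 \<le> travel X"
    using weight_mono[of 1 X] weight_pos[of 1] weight_pos[of X] by (simp add: travel_def X_def)
  then have "travel X \<ge> B" by (simp add: X_def travel_def max_def split: if_splits)
  moreover have "X > 0" by (simp add: X_def)
  ultimately show thesis using that by blast
qed

text \<open>Large \<open>\<bar>travel x\<bar>\<close> describes neighbourhoods of both ends at once,
  so one hypothesis on \<open>z\<close> serves whichever end is responsible for the
  divergence.\<close>

lemma fsol_mult_not_square_integrable:
  assumes v: "square_integrable v" "AE x in lborel. x > 0 \<longrightarrow> v x = fsol \<mu> x * z x"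
    and r: "Re \<mu> \<ge> 0 \<or> Re \<mu> \<le> - 2"
    and z: "\<delta> > 0" "\<And>x. x > 0 \<Longrightarrow> \<bar>travel x\<bar> \<ge> B \<Longrightarrow> cmod (z x) \<ge> \<delta>"
  shows False
  using r
proof
  assume r: "Re \<mu> \<ge> 0"
  obtain X where X: "0 < X" "travel X \<ge> B" by (rule travel_at_infinity)
  show False
  proof (rule fsol_mult_not_square_integrable_at_infinity[OF v r z(1) X(1)])
    fix x assume "x \<ge> X"
    then show "cmod (z x) \<ge> \<delta>" using z(2)[of x] X travel_mono[of X x] by auto
  qed
next
  assume r: "Re \<mu> \<le> - 2"
  obtain X where X: "0 < X" "X \<le> 1" "travel X \<le> - \<bar>B\<bar>" by (rule travel_at_zero)
  show False
  proof (rule fsol_mult_not_square_integrable_at_zero[OF v r z(1) X(1)])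
    fix x assume "0 < x" "x \<le> X"
    then show "cmod (z x) \<ge> \<delta>" using z(2)[of x] X travel_mono[of x X] by auto
  qed (use X in auto)
qed

lemma homogeneous_solution_right_half_line:
  assumes "weak_resolvent_eq \<mu> v g" "\<And>x. x > 0 \<Longrightarrow> g x = 0" "Re \<mu> \<ge> 0 \<or> Re \<mu> \<le> - 2"
  shows "AE x in lborel. x > 0 \<longrightarrow> v x = 0"
proof -
  have cont: "continuous_on {0<..} g"
    by (rule continuous_on_eq[of _ "\<lambda>_. 0"]) (use assms in auto)
  obtain C where C: "AE x in lborel. x > 0 \<longrightarrow> v x = fsol \<mu> x * (C + 0)"
    by (rule weak_solution_right_half_line[OF assms(1) _ _ cont, of "\<lambda>_. 0" "\<lambda>_. 0"])
      (use assms(2) in auto)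
  have "C = 0"
  proof (rule ccontr)
    assume "C \<noteq> 0"
    then show False
      using fsol_mult_not_square_integrable[OF _ C assms(3), of "cmod C" 0] assms(1)
      by (simp add: weak_resolvent_eq_def)
  qed
  then show ?thesis using C by simp
qed

section \<open>Square integrability by integration in the travel time\<close>

lemma exp_minus_le_inverse_quadratic:
  fixes u :: real
  assumes "u \<ge> 0"
  shows "exp (- u) \<le> 1 / (1 + u\<^sup>2)"
proof -
  have "1 + u / 2 + (u / 2)\<^sup>2 / 2 \<le> exp (u / 2)"
    using assms by (intro exp_lower_Taylor_quadratic) simp
  then have "(1 + u / 2 + (u / 2)\<^sup>2 / 2)\<^sup>2 \<le> (exp (u / 2))\<^sup>2"
    using assms by (intro power_mono) auto
  also have "(exp (u / 2))\<^sup>2 = exp u" by (simp add: exp_double[symmetric])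
  finally have 1: "(1 + u / 2 + (u / 2)\<^sup>2 / 2)\<^sup>2 \<le> exp u" .
  \<comment> \<open>The second order Taylor bound at \<open>u\<close> itself is too weak for large
    \<open>u\<close>. Squaring the one at \<open>u / 2\<close> adds a cubic term, and the excess
    \<open>u - u\<^sup>2 / 2 + u ^ 3 / 8\<close> is \<open>u\<close> times a sum of squares.\<close>
  have "(1 + u / 2 + (u / 2)\<^sup>2 / 2)\<^sup>2 = 1 + u\<^sup>2 + u * ((1 - u / 4)\<^sup>2 + u\<^sup>2 / 16) + u ^ 4 / 64"
    by (simp add: power2_eq_square power4_eq_xxxx algebra_simps)
  moreover have "0 \<le> u * ((1 - u / 4)\<^sup>2 + u\<^sup>2 / 16) + u ^ 4 / 64"
    using assms by simp
  ultimately have "1 + u\<^sup>2 \<le> exp u" using 1 by linarith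
  moreover have "1 + u\<^sup>2 > 0" by (simp add: add_pos_nonneg)
  ultimately show ?thesis by (simp add: exp_minus le_imp_inverse_le flip: inverse_eq_divide)
qed

text \<open>After the substitution \<open>s = travel x\<close> this is the integral of \<open>1 / (1 + (\<rho> (s - c))\<^sup>2)\<close>.\<close>

lemma nn_integral_travel_le:
  assumes "\<rho> > 0"
  shows "(\<integral>\<^sup>+x. ennreal (1 / (weight x * (1 + (\<rho> * (travel x - c))\<^sup>2))) * indicator {0<..} x \<partial>lborel)
    \<le> ennreal (pi / \<rho>)"
proof -
  define f where "f x = 1 / (weight x * (1 + (\<rho> * (travel x - c))\<^sup>2))" for x
  define q where "q x = arctan (\<rho> * (travel x - c)) / \<rho>" for x
  define J where "J n = {1 / real (Suc n)..real (Suc n)}" for n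
  have [measurable]: "f \<in> borel_measurable borel" unfolding f_def by measurable
  have pos: "1 + (\<rho> * (travel x - c))\<^sup>2 > 0" for x by (simp add: add_pos_nonneg)
  have q: "(q has_real_derivative f x) (at x)" if "x > 0" for x
  proof -
    define E where "E = 1 + (\<rho> * (travel x - c))\<^sup>2"
    have E: "E > 0" using pos by (simp add: E_def)
    have "((\<lambda>x. \<rho> * (travel x - c)) has_real_derivative \<rho> * (1 / weight x)) (at x)"
      using travel_has_derivative[OF that] by (auto intro!: derivative_eq_intros)
    from DERIV_cdivide[OF DERIV_chain2[OF DERIV_arctan this], of \<rho>]
    have "(q has_real_derivative inverse E * (\<rho> * (1 / weight x)) / \<rho>) (at x)"
      by (simp add: q_def[abs_def] E_def)
    also have "inverse E * (\<rho> * (1 / weight x)) / \<rho> = f x"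
      unfolding f_def E_def[symmetric] using E assms weight_pos[OF that] by (simp add: field_simps)
    finally show ?thesis .
  qed
  have f0: "f x \<ge> 0" for x
    using weight_bounds[of x] pos[of x] by (simp add: f_def)
  have J0: "x > 0" if "x \<in> J n" for x n
    using that by (auto simp: J_def intro: less_le_trans[rotated])
  have I: "(\<integral>\<^sup>+x. ennreal (f x) * indicator (J n) x \<partial>lborel) = ennreal (q (real (Suc n)) - q (1 / real (Suc n)))" for n
    unfolding J_def
  proof (rule nn_integral_FTC_Icc)
    fix x assume "x \<in> {1 / real (Suc n)..real (Suc n)}"
    then have "x > 0" using J0[of x n] by (simp add: J_def)
    then show "(q has_real_derivative f x) (at x)" by (rule q)
  qed (use f0 in \<open>auto simp: field_simps\<close>)
  have qb: "q (real (Suc n)) - q (1 / real (Suc n)) \<le> pi / \<rho>" for n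
  proof -
    have "q (real (Suc n)) - q (1 / real (Suc n)) = (arctan (\<rho> * (travel (Suc n) - c)) - arctan (\<rho> * (travel (1 / Suc n) - c))) / \<rho>"
      by (simp add: q_def diff_divide_distrib)
    also have "\<dots> \<le> pi / \<rho>"
      using assms arctan_bounded[of "\<rho> * (travel (Suc n) - c)"] arctan_bounded[of "\<rho> * (travel (1 / Suc n) - c)"]
      by (intro divide_right_mono) auto
    finally show ?thesis .
  qed
  have le: "(\<integral>\<^sup>+x. ennreal (f x) * indicator (J n) x \<partial>lborel) \<le> ennreal (pi / \<rho>)" for n
    unfolding I by (rule ennreal_leI) (rule qb)
  have "(\<integral>\<^sup>+x. ennreal (f x) * indicator {0<..} x \<partial>lborel)
      = (\<integral>\<^sup>+x. (SUP n. ennreal (f x) * indicator (J n) x) \<partial>lborel)"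
  proof (intro nn_integral_cong)
    fix x :: real
    show "ennreal (f x) * indicator {0<..} x = (SUP n. ennreal (f x) * indicator (J n) x)"
    proof (cases "x > 0")
      case True
      obtain n where n: "real n \<ge> max x (1 / x)" using real_arch_simple by blast
      have "x \<in> J n" using n True by (auto simp: J_def field_simps)
      then have "ennreal (f x) \<le> (SUP n. ennreal (f x) * indicator (J n) x)"
        by (intro SUP_upper2[of n]) auto
      moreover have "(SUP n. ennreal (f x) * indicator (J n) x) \<le> ennreal (f x)"
        by (intro SUP_least) (auto simp: indicator_def)
      ultimately show ?thesis using True by (simp add: antisym)
    next
      case False
      then have "x \<notin> J n" for n using J0 by blast
      then show ?thesis using False by simp
    qed
  qed
  also have "\<dots> = (SUP n. \<integral>\<^sup>+x. ennreal (f x) * indicator (J n) x \<partial>lborel)"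
  proof (rule nn_integral_monotone_convergence_SUP)
    have "J m \<subseteq> J n" if "m \<le> n" for m n
      using that by (auto simp: J_def field_simps intro: order_trans frac_le)
    then show "incseq (\<lambda>n x. ennreal (f x) * indicator (J n) x)"
      by (auto simp: incseq_def le_fun_def indicator_def)
    show "(\<lambda>x. ennreal (f x) * indicator (J n) x) \<in> borel_measurable lborel" for n
      unfolding J_def by measurable
  qed
  also have "\<dots> \<le> ennreal (pi / \<rho>)" by (intro SUP_least le)
  finally show ?thesis by (simp add: f_def)
qed

text \<open>Because \<open>dx = weight ds\<close>, the factor \<open>1 / weight x\<close> in the
  hypothesis cancels in the variable \<open>s\<close>. The explicit bound on the norm matters as
  well: its dependence on \<open>\<rho>\<close> carries the density argument on the boundary
  lines.\<close>

lemma square_integrableI_travel: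
  assumes f [measurable]: "f \<in> borel_measurable borel" and zero: "\<And>x. x \<le> 0 \<Longrightarrow> f x = 0"
    and "\<rho> > 0" "C \<ge> 0"
    and le: "\<And>x. x > 0 \<Longrightarrow> (cmod (f x))\<^sup>2 \<le> C / (weight x * (1 + (\<rho> * (travel x - c))\<^sup>2))"
  shows "square_integrable f" "(l2_norm f)\<^sup>2 \<le> C * (pi / \<rho>)"
proof -
  have "(\<integral>\<^sup>+x. ennreal ((cmod (f x))\<^sup>2) \<partial>lborel)
    \<le> (\<integral>\<^sup>+x. ennreal C * (ennreal (1 / (weight x * (1 + (\<rho> * (travel x - c))\<^sup>2))) * indicator {0<..} x) \<partial>lborel)"
  proof (intro nn_integral_mono)
    fix x
    show "ennreal ((cmod (f x))\<^sup>2) \<le> ennreal C * (ennreal (1 / (weight x * (1 + (\<rho> * (travel x - c))\<^sup>2))) * indicator {0<..} x)"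
      using zero[of x] le[of x] \<open>C \<ge> 0\<close> weight_bounds[of x]
      by (cases "x > 0") (auto simp flip: ennreal_mult intro!: ennreal_leI)
  qed
  also have "\<dots> = ennreal C * (\<integral>\<^sup>+x. ennreal (1 / (weight x * (1 + (\<rho> * (travel x - c))\<^sup>2))) * indicator {0<..} x \<partial>lborel)"
    by (rule nn_integral_cmult) measurable
  also have "\<dots> \<le> ennreal C * ennreal (pi / \<rho>)"
    by (intro mult_left_mono nn_integral_travel_le assms) simp
  also have "\<dots> = ennreal (C * (pi / \<rho>))"
    using assms by (intro ennreal_mult[symmetric]) auto
  finally have le: "(\<integral>\<^sup>+x. ennreal ((cmod (f x))\<^sup>2) \<partial>lborel) \<le> ennreal (C * (pi / \<rho>))" .
  then have "integrable lborel (\<lambda>x. (cmod (f x))\<^sup>2)"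
    by (intro integrableI_bounded) (auto simp: le_less_trans)
  then show "square_integrable f" by (simp add: square_integrable_def)
  have "(LINT x|lborel. (cmod (f x))\<^sup>2) \<le> C * (pi / \<rho>)"
    using le assms by (intro integral_real_bounded) auto
  then show "(l2_norm f)\<^sup>2 \<le> C * (pi / \<rho>)" by (simp only: l2_norm_power2)
qed

text \<open>Both bounds hold everywhere, but each has the right growth at one end only: the first
  uses \<open>weight x \<le> 1\<close> and is meant for large \<open>travel x\<close>, the second
  uses \<open>weight x \<le> exp (2 * travel x)\<close> and is meant for \<open>x\<close> near
  0.\<close>

lemma norm_fsol_power2_le:
  assumes "x > 0"
  shows "(cmod (fsol \<mu> x))\<^sup>2 \<le> exp ((2 * Re \<mu>) * travel x) / weight x"
    "(cmod (fsol \<mu> x))\<^sup>2 \<le> exp ((4 + 2 * Re \<mu>) * travel x) / weight x"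
proof -
  have w: "0 < weight x" "weight x \<le> 1" using weight_pos[OF assms] weight_bounds[of x] by auto
  have eq: "(cmod (fsol \<mu> x))\<^sup>2 = (weight x)\<^sup>2 * exp (2 * Re \<mu> * travel x) / weight x"
    unfolding norm_fsol_power2[OF assms] using w by (simp add: power2_eq_square)
  have "(weight x)\<^sup>2 \<le> 1" using w by (simp add: power_le_one)
  then have "(weight x)\<^sup>2 * exp (2 * Re \<mu> * travel x) \<le> 1 * exp (2 * Re \<mu> * travel x)"
    by (intro mult_right_mono) auto
  then show "(cmod (fsol \<mu> x))\<^sup>2 \<le> exp ((2 * Re \<mu>) * travel x) / weight x"
    unfolding eq using w by (intro divide_right_mono) auto
  have "(weight x)\<^sup>2 \<le> (exp (2 * travel x))\<^sup>2"
    using w weight_le_exp_travel[OF assms] by (intro power_mono) auto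
  also have "\<dots> = exp (4 * travel x)" by (simp add: exp_double[symmetric])
  finally have "(weight x)\<^sup>2 * exp (2 * Re \<mu> * travel x) \<le> exp (4 * travel x) * exp (2 * Re \<mu> * travel x)"
    by (intro mult_right_mono) auto
  also have "\<dots> = exp ((4 + 2 * Re \<mu>) * travel x)" by (simp add: exp_add[symmetric] distrib_right)
  finally show "(cmod (fsol \<mu> x))\<^sup>2 \<le> exp ((4 + 2 * Re \<mu>) * travel x) / weight x"
    unfolding eq using w by (intro divide_right_mono) auto
qed

text \<open>Weakens exponential decay to a function with the single primitive \<open>arctan\<close>
  on the whole line, so that integrals need no splitting at the sign of \<open>t\<close>.\<close>

lemma exp_minus_abs_le:
  fixes t :: real
  shows "exp (- \<bar>t\<bar>) \<le> 1 / (1 + t\<^sup>2)"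
  using exp_minus_le_inverse_quadratic[of "\<bar>t\<bar>"] by simp

lemma fsol_square_integrable:
  assumes "- 2 < Re \<mu>" "Re \<mu> < 0"
  shows "square_integrable (\<lambda>x. indicator {0<..} x *\<^sub>R fsol \<mu> x)"
proof (rule square_integrableI_travel(1)[where c = 0 and C = 1])
  \<comment> \<open>The slower of the decay rates at the two ends; it is positive exactly inside the
    open strip.\<close>
  define \<rho> where "\<rho> = min (- 2 * Re \<mu>) (4 + 2 * Re \<mu>)"
  show "\<rho> > 0" using assms by (simp add: \<rho>_def)
  show "(\<lambda>x. indicator {0<..} x *\<^sub>R fsol \<mu> x) \<in> borel_measurable borel" by measurable
  fix x :: real assume x: "x > 0"
  have w: "weight x > 0" by (rule weight_pos[OF x])
  have "(cmod (fsol \<mu> x))\<^sup>2 \<le> exp (- \<bar>\<rho> * travel x\<bar>) / weight x"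
  proof (cases "travel x \<ge> 0")
    case True
    have "(2 * Re \<mu>) * travel x \<le> (- \<rho>) * travel x"
      using True by (intro mult_right_mono) (auto simp: \<rho>_def)
    then have "exp ((2 * Re \<mu>) * travel x) / weight x \<le> exp (- \<bar>\<rho> * travel x\<bar>) / weight x"
      using True \<open>\<rho> > 0\<close> w by (intro divide_right_mono) (auto simp: abs_mult)
    then show ?thesis using norm_fsol_power2_le(1)[OF x, of \<mu>] by linarith
  next
    case False
    have "(4 + 2 * Re \<mu>) * travel x \<le> \<rho> * travel x"
      using False by (intro mult_right_mono_neg) (auto simp: \<rho>_def)
    then have "exp ((4 + 2 * Re \<mu>) * travel x) / weight x \<le> exp (- \<bar>\<rho> * travel x\<bar>) / weight x"
      using False \<open>\<rho> > 0\<close> w by (intro divide_right_mono) (auto simp: abs_mult)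
    then show ?thesis using norm_fsol_power2_le(2)[OF x, of \<mu>] by linarith
  qed
  also have "\<dots> \<le> 1 / (1 + (\<rho> * travel x)\<^sup>2) / weight x"
    using w by (intro divide_right_mono exp_minus_abs_le) auto
  finally show "(cmod (indicator {0<..} x *\<^sub>R fsol \<mu> x))\<^sup>2 \<le> 1 / (weight x * (1 + (\<rho> * (travel x - 0))\<^sup>2))"
    using x by (simp add: mult.commute)
qed auto

text \<open>Only the end 0 matters here, hence only the lower edge of the strip. Centring the decay
  at \<open>travel y\<close> leaves the constant \<open>exp (\<rho> * travel y)\<close>.\<close>

lemma fsol_square_integrable_near_zero:
  assumes "- 2 < Re \<mu>" "y > 0"
  shows "square_integrable (\<lambda>x. indicator {0<..<y} x *\<^sub>R fsol \<mu> x)"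
proof (rule square_integrableI_travel(1)[where c = "travel y"])
  define \<rho> where "\<rho> = 4 + 2 * Re \<mu>"
  show \<rho>: "\<rho> > 0" using assms by (simp add: \<rho>_def)
  show "(\<lambda>x. indicator {0<..<y} x *\<^sub>R fsol \<mu> x) \<in> borel_measurable borel" by measurable
  fix x :: real assume x: "x > 0"
  have w: "weight x > 0" by (rule weight_pos[OF x])
  show "(cmod (indicator {0<..<y} x *\<^sub>R fsol \<mu> x))\<^sup>2 \<le> exp (\<rho> * travel y) / (weight x * (1 + (\<rho> * (travel x - travel y))\<^sup>2))"
  proof (cases "x < y")
    case True
    have "travel x \<le> travel y" using x True by (intro travel_mono) auto
    then have "\<bar>\<rho> * (travel x - travel y)\<bar> = \<rho> * (travel y - travel x)"
      using \<rho> by (simp add: abs_mult)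
    then have "(4 + 2 * Re \<mu>) * travel x = \<rho> * travel y + - \<bar>\<rho> * (travel x - travel y)\<bar>"
      unfolding \<rho>_def[symmetric] by (simp add: algebra_simps)
    then have "(cmod (fsol \<mu> x))\<^sup>2 \<le> exp (\<rho> * travel y) * exp (- \<bar>\<rho> * (travel x - travel y)\<bar>) / weight x"
      using norm_fsol_power2_le(2)[OF x, of \<mu>] by (simp only: exp_add)
    also have "\<dots> \<le> exp (\<rho> * travel y) * (1 / (1 + (\<rho> * (travel x - travel y))\<^sup>2)) / weight x"
      using w by (intro divide_right_mono mult_left_mono exp_minus_abs_le) auto
    finally show ?thesis using x True by (simp add: mult.commute)
  next
    case False
    then show ?thesis using w by (simp add: zero_le_mult_iff add_nonneg_nonneg)
  qed
qed auto

section \<open>Pairing the homogeneous solution with the adjoint\<close>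

lemma adjoint_term_props:
  assumes \<psi>: "test_function \<psi>" "\<And>x. (\<psi> has_vector_derivative \<psi>' x) (at x)"
  obtains M B where "M > 0" "\<And>x. \<bar>x\<bar> \<ge> M \<Longrightarrow> adjoint_term \<mu> \<psi> \<psi>' x = 0" "\<And>x. \<bar>x\<bar> \<ge> M \<Longrightarrow> \<psi> x = 0"
    "\<And>x. cmod (adjoint_term \<mu> \<psi> \<psi>' x) \<le> B" "\<And>x. cmod (\<psi> x) \<le> B"
    "adjoint_term \<mu> \<psi> \<psi>' \<in> borel_measurable borel" "continuous_on {0<..} (adjoint_term \<mu> \<psi> \<psi>')"
proof -
  obtain M where M: "M > 0" "\<And>x. \<bar>x\<bar> \<ge> M \<Longrightarrow> \<psi> x = 0" "\<And>x. \<bar>x\<bar> \<ge> M \<Longrightarrow> \<psi>' x = 0"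
    "continuous_on UNIV \<psi>" "continuous_on UNIV \<psi>'" "test_function \<psi>'"
    using \<psi> by (rule test_function_derivE) blast
  note [measurable] = test_function_measurable[OF \<psi>(1)] test_function_measurable[OF M(6)]
  obtain B1 where B1: "B1 > 0" "\<And>x. cmod (\<psi> x) \<le> B1"
    using continuous_compact_support_bounded[OF M(4,2)] by blast
  obtain B2 where B2: "B2 > 0" "\<And>x. cmod (\<psi>' x) \<le> B2"
    using continuous_compact_support_bounded[OF M(5,3)] by blast
  \<comment> \<open>The summand 3 comes from \<open>coefficient_bound\<close>; the further 1 lets
    the same \<open>B\<close> also bound \<open>\<psi>\<close>.\<close>
  define B where "B = B2 + (cmod \<mu> + 3 + 1) * B1"
  show thesis
  proof (rule that[of M B])
    show "adjoint_term \<mu> \<psi> \<psi>' x = 0" if "\<bar>x\<bar> \<ge> M" for x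
      using M(2,3)[OF that] by (simp add: adjoint_term_def)
    fix x
    have "cmod (complex_of_real (weight x) * \<psi>' x) \<le> 1 * B2"
      unfolding norm_mult using weight_bounds[of x] B2 by (intro mult_mono) auto
    moreover have "cmod ((\<mu> - 3 * complex_of_real (phi x * phi' x)) * \<psi> x) \<le> (cmod \<mu> + 3) * B1"
      unfolding norm_mult using B1 coefficient_bound by (intro mult_mono) (auto simp del: of_real_mult)
    ultimately have "cmod (adjoint_term \<mu> \<psi> \<psi>' x) \<le> B2 + (cmod \<mu> + 3) * B1"
      unfolding adjoint_term_def using norm_triangle_mono by fastforce
    then show "cmod (adjoint_term \<mu> \<psi> \<psi>' x) \<le> B" using B1(1) by (simp add: B_def algebra_simps)
    have "0 \<le> (cmod \<mu> + 3) * B1" using B1(1) by simp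
    then show "cmod (\<psi> x) \<le> B" using B1(2)[of x] B2(1) by (simp add: B_def algebra_simps)
  next
    show "adjoint_term \<mu> \<psi> \<psi>' \<in> borel_measurable borel"
      unfolding adjoint_term_def[abs_def] by measurable
    show "continuous_on {0<..} (adjoint_term \<mu> \<psi> \<psi>')"
      unfolding adjoint_term_def[abs_def]
      by (intro continuous_intros continuous_on_coefficient continuous_on_weight
          continuous_on_subset[OF M(4)] continuous_on_subset[OF M(5)]) auto
  qed (use M in auto)
qed

lemma weighted_fsol_test_has_derivative:
  assumes "x > 0" "(\<psi> has_vector_derivative \<psi>' x) (at x)"
  shows "((\<lambda>x. complex_of_real (weight x) * fsol \<mu> x * \<psi> x) has_vector_derivative
    fsol \<mu> x * adjoint_term \<mu> \<psi> \<psi>' x) (at x)"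
  by (rule has_vector_derivative_eq_rhs[OF has_vector_derivative_mult[OF weighted_fsol_has_derivative[OF assms(1)] assms(2)]])
    (simp add: adjoint_term_def algebra_simps)

lemma continuous_on_fsol: "continuous_on {0<..} (fsol \<mu>)"
  using fsol_has_derivative[of _ \<mu>]
  by (intro continuous_at_imp_continuous_on) (metis greaterThan_iff has_vector_derivative_continuous)

text \<open>The integrand is the derivative of \<open>weight * fsol \<mu> * \<psi>\<close>, and the
  boundary value at 0 vanishes because \<open>(weight x * cmod (fsol \<mu> x))\<^sup>2\<close> is at
  most a constant times \<open>weight x\<close> when \<open>Re \<mu> > -2\<close>. Hence cutting
  \<open>fsol \<mu>\<close> off at 0 leaves no singular term there.\<close>

lemma integral_fsol_adjoint_term_left:
  assumes \<mu>: "- 2 < Re \<mu>" and "y > 0"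
    and \<psi>: "test_function \<psi>" "\<And>x. (\<psi> has_vector_derivative \<psi>' x) (at x)"
  shows "(LINT x:{0<..<y}|lborel. fsol \<mu> x * adjoint_term \<mu> \<psi> \<psi>' x)
    = complex_of_real (weight y) * fsol \<mu> y * \<psi> y"
proof -
  obtain M B where T: "M > 0" "\<And>x. \<bar>x\<bar> \<ge> M \<Longrightarrow> adjoint_term \<mu> \<psi> \<psi>' x = 0" "\<And>x. \<bar>x\<bar> \<ge> M \<Longrightarrow> \<psi> x = 0"
    "\<And>x. cmod (adjoint_term \<mu> \<psi> \<psi>' x) \<le> B" "\<And>x. cmod (\<psi> x) \<le> B"
    "adjoint_term \<mu> \<psi> \<psi>' \<in> borel_measurable borel" "continuous_on {0<..} (adjoint_term \<mu> \<psi> \<psi>')"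
    by (rule adjoint_term_props[OF \<psi>, of \<mu>]) blast
  define F where "F x = complex_of_real (weight x) * fsol \<mu> x * \<psi> x" for x
  define f where "f x = fsol \<mu> x * adjoint_term \<mu> \<psi> \<psi>' x" for x
  have F': "(F has_vector_derivative f x) (at x)" if "x > 0" for x
    unfolding F_def[abs_def] f_def using that \<psi>(2) by (rule weighted_fsol_test_has_derivative)
  have "integrable lborel (\<lambda>x. (indicator {0<..<y} x *\<^sub>R fsol \<mu> x) * adjoint_term \<mu> \<psi> \<psi>' x)"
    by (rule integrable_mult_compact_support[OF square_integrable_imp_locally_integrable
          [OF fsol_square_integrable_near_zero[OF \<mu> \<open>y > 0\<close>]] T(6,4,2)])
  then have int: "set_integrable lborel {0<..<y} f"
    by (simp add: set_integrable_def f_def)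
  define C where "C = exp ((4 + 2 * Re \<mu>) * travel y)"
  have small: "cmod (F x) \<le> sqrt (C * weight x) * B" if x: "0 < x" "x < y" for x
  proof -
    have w: "weight x > 0" by (rule weight_pos[OF x(1)])
    have "(cmod (fsol \<mu> x))\<^sup>2 \<le> C / weight x"
      using norm_fsol_power2_le(2)[OF x(1), of \<mu>] w \<mu> travel_mono[of x y] x
      by (elim order_trans) (auto simp: C_def intro!: divide_right_mono mult_left_mono)
    then have "(weight x * cmod (fsol \<mu> x))\<^sup>2 \<le> (weight x)\<^sup>2 * (C / weight x)"
      unfolding power_mult_distrib by (intro mult_left_mono) auto
    also have "\<dots> = C * weight x" using w by (simp add: power2_eq_square)
    finally have "weight x * cmod (fsol \<mu> x) \<le> sqrt (C * weight x)" by (rule real_le_rsqrt)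
    then show ?thesis
      unfolding F_def norm_mult using T(5)[of x] w by (intro mult_mono) (auto simp: C_def)
  qed
  have lim0: "(F \<longlongrightarrow> 0) (at_right 0)"
  proof (rule Lim_null_comparison)
    show "eventually (\<lambda>x. norm (F x) \<le> sqrt (C * weight x) * B) (at_right 0)"
      using eventually_at_right_less[of 0] eventually_at_right_real[OF \<open>y > 0\<close>]
      by eventually_elim (use small in auto)
    have "continuous (at_right 0) weight"
      using continuous_on_weight[of UNIV]
      by (simp add: continuous_on_eq_continuous_within continuous_at_imp_continuous_at_within)
    then have "(weight \<longlongrightarrow> weight 0) (at_right 0)" by (simp add: continuous_within)
    then have "((\<lambda>x. sqrt (C * weight x) * B) \<longlongrightarrow> sqrt (C * weight 0) * B) (at_right 0)"
      by (intro tendsto_intros)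
    then show "((\<lambda>x. sqrt (C * weight x) * B) \<longlongrightarrow> 0) (at_right 0)"
      by (simp add: weight_def phi_def)
  qed
  have limy: "(F \<longlongrightarrow> F y) (at_left y)"
    using continuous_at_imp_continuous_at_within[OF has_vector_derivative_continuous[OF F'[OF \<open>y > 0\<close>]]]
    by (simp add: continuous_within)
  have "(LBINT x=ereal 0..ereal y. f x) = F y - 0"
  proof (rule interval_integral_FTC_integrable)
    show "(F has_vector_derivative f x) (at x)" if "ereal 0 < ereal x" for x
      using F' that by simp
    show "isCont f x" if "ereal 0 < ereal x" for x
    proof -
      have "continuous_on {0<..} f" unfolding f_def
        by (intro continuous_intros continuous_on_fsol T)
      then show ?thesis using that by (simp add: continuous_on_eq_continuous_at)
    qed
    show "set_integrable lborel (einterval (ereal 0) (ereal y)) f"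
      using int by simp
    show "((F \<circ> real_of_ereal) \<longlongrightarrow> 0) (at_right (ereal 0))"
      using lim0 by (simp only: ereal_tendsto_simps)
    show "((F \<circ> real_of_ereal) \<longlongrightarrow> F y) (at_left (ereal y))"
      using limy by (simp only: ereal_tendsto_simps)
  qed (use \<open>y > 0\<close> in auto)
  then show ?thesis using \<open>y > 0\<close>
    by (simp add: interval_lebesgue_integral_def einterval_eq f_def F_def)
qed

text \<open>Here the same primitive is cut off at the far end by the support of
  \<open>\<psi>\<close>, and \<open>y > 0\<close> keeps away from 0, so \<open>\<mu>\<close> is
  arbitrary.\<close>

lemma integral_fsol_adjoint_term_right:
  assumes "y > 0" and \<psi>: "test_function \<psi>" "\<And>x. (\<psi> has_vector_derivative \<psi>' x) (at x)"
  shows "(LINT x:{y..}|lborel. fsol \<mu> x * adjoint_term \<mu> \<psi> \<psi>' x)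
    = - (complex_of_real (weight y) * fsol \<mu> y * \<psi> y)"
proof -
  obtain M B where T: "M > 0" "\<And>x. \<bar>x\<bar> \<ge> M \<Longrightarrow> adjoint_term \<mu> \<psi> \<psi>' x = 0" "\<And>x. \<bar>x\<bar> \<ge> M \<Longrightarrow> \<psi> x = 0"
    "\<And>x. cmod (adjoint_term \<mu> \<psi> \<psi>' x) \<le> B" "\<And>x. cmod (\<psi> x) \<le> B"
    "adjoint_term \<mu> \<psi> \<psi>' \<in> borel_measurable borel" "continuous_on {0<..} (adjoint_term \<mu> \<psi> \<psi>')"
    by (rule adjoint_term_props[OF \<psi>, of \<mu>]) blast
  define b where "b = y + M"
  have "(LINT x:{y..}|lborel. fsol \<mu> x * adjoint_term \<mu> \<psi> \<psi>' x)
      = (LINT x|lborel. indicator {y..b} x *\<^sub>R (fsol \<mu> x * adjoint_term \<mu> \<psi> \<psi>' x))"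
    unfolding set_lebesgue_integral_def
  proof (intro Bochner_Integration.integral_cong refl)
    fix x
    show "indicator {y..} x *\<^sub>R (fsol \<mu> x * adjoint_term \<mu> \<psi> \<psi>' x)
      = indicator {y..b} x *\<^sub>R (fsol \<mu> x * adjoint_term \<mu> \<psi> \<psi>' x)"
      using T(2)[of x] \<open>y > 0\<close> by (auto simp: indicator_def b_def)
  qed
  also have "\<dots> = complex_of_real (weight b) * fsol \<mu> b * \<psi> b - complex_of_real (weight y) * fsol \<mu> y * \<psi> y"
  proof (rule integral_FTC_atLeastAtMost)
    show "((\<lambda>x. complex_of_real (weight x) * fsol \<mu> x * \<psi> x) has_vector_derivative
        fsol \<mu> x * adjoint_term \<mu> \<psi> \<psi>' x) (at x within {y..b})" if "y \<le> x" for x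
      using that \<open>y > 0\<close>
      by (intro has_vector_derivative_at_within[OF weighted_fsol_test_has_derivative] \<psi>) auto
    show "continuous_on {y..b} (\<lambda>x. fsol \<mu> x * adjoint_term \<mu> \<psi> \<psi>' x)"
      using \<open>y > 0\<close>
      by (intro continuous_on_mult continuous_on_subset[OF continuous_on_fsol] continuous_on_subset[OF T(7)]) auto
  qed (use T in \<open>simp add: b_def\<close>)
  also have "\<psi> b = 0" using T(1,3) \<open>y > 0\<close> by (simp add: b_def)
  finally show ?thesis by simp
qed

lemma fsol_weak_resolvent_eq:
  assumes "- 2 < Re \<mu>" "Re \<mu> < 0"
  shows "weak_resolvent_eq \<mu> (\<lambda>x. indicator {0<..} x *\<^sub>R fsol \<mu> x) (\<lambda>_. 0)"
  unfolding weak_resolvent_eq_def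
proof (intro conjI allI impI fsol_square_integrable square_integrable_0 assms)
  fix \<psi> \<psi>' assume \<psi>: "test_function \<psi>" "\<forall>x. (\<psi> has_vector_derivative \<psi>' x) (at x)"
  then obtain M B where T: "M > 0" "\<And>x. \<bar>x\<bar> \<ge> M \<Longrightarrow> adjoint_term \<mu> \<psi> \<psi>' x = 0" "\<And>x. \<bar>x\<bar> \<ge> M \<Longrightarrow> \<psi> x = 0"
    using adjoint_term_props[of \<psi> \<psi>' \<mu>] by metis
  have "(LINT x|lborel. (indicator {0<..} x *\<^sub>R fsol \<mu> x) * adjoint_term \<mu> \<psi> \<psi>' x)
      = (LINT x:{0<..<M}|lborel. fsol \<mu> x * adjoint_term \<mu> \<psi> \<psi>' x)"
    unfolding set_lebesgue_integral_def
  proof (intro Bochner_Integration.integral_cong refl)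
    fix x
    show "(indicator {0<..} x *\<^sub>R fsol \<mu> x) * adjoint_term \<mu> \<psi> \<psi>' x
      = indicator {0<..<M} x *\<^sub>R (fsol \<mu> x * adjoint_term \<mu> \<psi> \<psi>' x)"
      using T(2)[of x] by (auto simp: indicator_def)
  qed
  also have "\<dots> = complex_of_real (weight M) * fsol \<mu> M * \<psi> M"
    using \<psi> by (intro integral_fsol_adjoint_term_left assms T) auto
  finally show "(LINT x|lborel. 0 * \<psi> x)
      = - (LINT x|lborel. (indicator {0<..} x *\<^sub>R fsol \<mu> x) * adjoint_term \<mu> \<psi> \<psi>' x)"
    using T(1,3) by simp
qed

text \<open>In the variable \<open>s = travel x\<close> the solutions for this right-hand side are
  \<open>fsol \<mu> (C + ln (1 + s\<^sup>2) / 2)\<close>: the factor grows although its \<open>s\<close>-derivative is square integrable.\<close>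

lemma right_half_line_not_surjective:
  assumes "Re \<mu> = 0 \<or> Re \<mu> = - 2"
  obtains g where "square_integrable g" "\<And>v. \<not> weak_resolvent_eq \<mu> v g"
proof -
  define p where "p t = t / (1 + t\<^sup>2)" for t :: real
  define g where "g x = indicator {0<..} x *\<^sub>R (complex_of_real (p (travel x)) * fsol \<mu> x)" for x
  define y where "y x = complex_of_real (ln (1 + (travel x)\<^sup>2) / 2)" for x
  define y' where "y' x = complex_of_real (p (travel x) / weight x)" for x
  have pos: "1 + t\<^sup>2 > 0" for t :: real by (simp add: add_pos_nonneg)
  have [measurable]: "p \<in> borel_measurable borel" unfolding p_def by measurable
  have sg: "square_integrable g"
  proof (rule square_integrableI_travel(1)[where c = 0 and C = 1 and \<rho> = 1])
    show "g \<in> borel_measurable borel" unfolding g_def by measurable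
    fix x :: real assume x: "x > 0"
    have w: "weight x > 0" by (rule weight_pos[OF x])
    \<comment> \<open>On each of the two lines one of the exponents \<open>2 * Re \<mu>\<close> and
      \<open>4 + 2 * Re \<mu>\<close> is 0, so the corresponding bound loses its
      exponential.\<close>
    have "(cmod (fsol \<mu> x))\<^sup>2 \<le> 1 / weight x"
      using assms norm_fsol_power2_le[OF x, of \<mu>] by auto
    moreover have "(cmod (complex_of_real (p (travel x))))\<^sup>2 \<le> 1 / (1 + (travel x)\<^sup>2)"
    proof -
      have "(p (travel x))\<^sup>2 = (travel x)\<^sup>2 / (1 + (travel x)\<^sup>2) * (1 / (1 + (travel x)\<^sup>2))"
        by (simp add: p_def power_divide power2_eq_square)
      also have "\<dots> \<le> 1 * (1 / (1 + (travel x)\<^sup>2))"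
        using pos[of "travel x"] by (intro mult_right_mono) auto
      finally show ?thesis by simp
    qed
    ultimately have "(cmod (fsol \<mu> x))\<^sup>2 * (cmod (complex_of_real (p (travel x))))\<^sup>2
        \<le> 1 / weight x * (1 / (1 + (travel x)\<^sup>2))"
      using w by (intro mult_mono) auto
    then show "(cmod (g x))\<^sup>2 \<le> 1 / (weight x * (1 + (1 * (travel x - 0))\<^sup>2))"
      using x by (simp add: g_def norm_mult power_mult_distrib mult.commute)
  qed (auto simp: g_def)
  have dy: "(y has_vector_derivative y' x) (at x)" if "x > 0" for x
  proof -
    note x0 = that
    have "((\<lambda>x. 1 + (travel x)\<^sup>2) has_real_derivative 2 * travel x * (1 / weight x)) (at x)"
      using travel_has_derivative[OF that] by (auto intro!: derivative_eq_intros)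
    from DERIV_cdivide[OF DERIV_chain2[OF DERIV_ln[OF pos] this], of 2]
    have "((\<lambda>x. ln (1 + (travel x)\<^sup>2) / 2) has_real_derivative p (travel x) / weight x) (at x)"
    proof (rule DERIV_cong)
      have "inverse E * (2 * travel x * (1 / weight x)) / 2 = travel x / E / weight x" if "E > 0" for E
        using that weight_pos[OF x0] by (simp add: field_simps)
      from this[OF pos[of "travel x"]]
      show "inverse (1 + (travel x)\<^sup>2) * (2 * travel x * (1 / weight x)) / 2 = p (travel x) / weight x"
        by (simp only: p_def)
    qed
    then show ?thesis
      unfolding y_def[abs_def] y'_def
      by (intro has_vector_derivative_of_real) (simp add: has_real_derivative_iff_has_vector_derivative)
  qed
  have gy: "g x = complex_of_real (weight x) * fsol \<mu> x * y' x" if "x > 0" for x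
    using that weight_pos[OF that] by (simp add: g_def y'_def)
  have ct: "continuous_on {0<..} travel"
    using travel_has_derivative by (intro continuous_at_imp_continuous_on) (metis DERIV_isCont greaterThan_iff)
  have cg: "continuous_on {0<..} g"
  proof (rule continuous_on_eq)
    show "continuous_on {0<..} (\<lambda>x. complex_of_real (p (travel x)) * fsol \<mu> x)"
      unfolding p_def using pos by (intro continuous_intros ct continuous_on_fsol) (auto simp: less_imp_neq[symmetric])
  qed (simp add: g_def)
  have "\<not> weak_resolvent_eq \<mu> v g" for v
  proof
    assume v: "weak_resolvent_eq \<mu> v g"
    obtain C where C: "AE x in lborel. x > 0 \<longrightarrow> v x = fsol \<mu> x * (C + y x)"
      using weak_solution_right_half_line[OF v dy gy cg] by blast
    show False
    proof (rule fsol_mult_not_square_integrable[OF _ C])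
      \<comment> \<open>Beyond this threshold \<open>ln \<bar>travel x\<bar>\<close> is at least
        \<open>cmod C + 1\<close>, so \<open>y x\<close> outweighs the unknown constant
        \<open>C\<close> by at least 1.\<close>
      fix x assume x: "x > 0" "\<bar>travel x\<bar> \<ge> exp (cmod C + 1)"
      then have t: "\<bar>travel x\<bar> > 0" using exp_gt_zero[of "cmod C + 1"] by linarith
      have "cmod C + 1 \<le> ln \<bar>travel x\<bar>"
        using x(2) t by (simp only: ln_ge_iff)
      then have "2 * (cmod C + 1) \<le> 2 * ln \<bar>travel x\<bar>" by simp
      also have "\<dots> = ln (\<bar>travel x\<bar>\<^sup>2)" using t by (subst ln_realpow) auto
      also have "\<dots> \<le> ln (1 + (travel x)\<^sup>2)" using t pos by (subst ln_le_cancel_iff) auto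
      finally have "cmod C + 1 \<le> cmod (y x)" by (simp add: y_def)
      then show "1 \<le> cmod (C + y x)"
        using norm_diff_ineq[of "y x" C] by (simp add: add.commute)
    qed (use v assms in \<open>auto simp: weak_resolvent_eq_def\<close>)
  qed
  with sg that show thesis by blast
qed

section \<open>The resolvent on the right half line\<close>

text \<open>In the variable \<open>s = travel x\<close> and after conjugation by \<open>sqrt weight\<close> this dominates the kernel of the
  resolvent of a first order operator on the whole line.\<close>

definition travel_kernel :: "real \<Rightarrow> (real \<Rightarrow> real \<Rightarrow> complex) \<Rightarrow> bool" where
  "travel_kernel \<rho> k \<longleftrightarrow> case_prod k \<in> borel_measurable (borel \<Otimes>\<^sub>M borel) \<and>
    (\<forall>x y. x > 0 \<longrightarrow> y > 0 \<longrightarrow>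
      cmod (k x y) \<le> exp (- \<bar>\<rho> * (travel x - travel y)\<bar>) / (sqrt (weight x) * sqrt (weight y))) \<and>
    (\<forall>x y. \<not> (x > 0 \<and> y > 0) \<longrightarrow> k x y = 0)"

text \<open>The Schur test: Cauchy-Schwarz for the two factors \<open>sqrt (E x y / weight y)\<close> and \<open>sqrt (E x y) * cmod (g y)\<close>.\<close>

lemma travel_kernel_nn_integral_finite:
  assumes k: "travel_kernel \<rho> k" and "\<rho> > 0" and g: "square_integrable g"
  shows "(\<integral>\<^sup>+x. (\<integral>\<^sup>+y. ennreal (cmod (k x y * g y)) \<partial>lborel)\<^sup>2 \<partial>lborel) < \<infinity>"
proof -
  have [measurable]: "case_prod k \<in> borel_measurable (borel \<Otimes>\<^sub>M borel)"
    using k by (simp add: travel_kernel_def)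
  note [measurable] = square_integrableD(2)[OF g]
  \<comment> \<open>The symmetric kernel that replaces the exponential. Half of it goes into each
    Cauchy-Schwarz factor, so that after squaring each factor carries \<open>E\<close> once.\<close>
  define E where "E x y = 1 / (1 + (\<rho> * (travel x - travel y))\<^sup>2)" for x y
  have E: "E x y > 0" for x y by (simp add: E_def add_pos_nonneg)
  have Esym: "E x y = E y x" for x y by (simp add: E_def power2_commute right_diff_distrib)
  have [measurable]: "case_prod E \<in> borel_measurable (borel \<Otimes>\<^sub>M borel)"
    unfolding E_def by measurable
  define D where "D x y = ennreal (1 / weight y * E x y) * indicator {0<..} y" for x y
  have [measurable]: "case_prod D \<in> borel_measurable (borel \<Otimes>\<^sub>M borel)"
    unfolding D_def by measurable
  have D: "(\<integral>\<^sup>+y. D x y \<partial>lborel) \<le> ennreal (pi / \<rho>)" for x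
    using nn_integral_travel_le[OF \<open>\<rho> > 0\<close>, of "travel x"]
    by (simp add: D_def E_def power2_commute right_diff_distrib)
  define G where "G x y = ennreal (E x y * (cmod (g y))\<^sup>2)" for x y
  have [measurable]: "case_prod G \<in> borel_measurable (borel \<Otimes>\<^sub>M borel)"
    unfolding G_def by measurable
  have pointwise: "(\<integral>\<^sup>+y. ennreal (cmod (k x y * g y)) \<partial>lborel)\<^sup>2
    \<le> ennreal (pi / \<rho>) * (\<integral>\<^sup>+y. (ennreal (1 / weight x) * indicator {0<..} x) * G x y \<partial>lborel)" for x
  proof (cases "x > 0")
    case True
    define B where "B y = ennreal (sqrt (1 / weight y * E x y)) * indicator {0<..} y" for y
    define H where "H y = ennreal (sqrt (E x y) * cmod (g y))" for y
    define A where "A = ennreal (1 / sqrt (weight x))"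
    have [measurable]: "B \<in> borel_measurable borel" "H \<in> borel_measurable borel"
      unfolding B_def H_def by measurable
    have w: "weight x > 0" by (rule weight_pos[OF True])
    have "ennreal (cmod (k x y * g y)) \<le> A * (B y * H y)" for y
    proof (cases "y > 0")
      case y: True
      have wy: "weight y > 0" by (rule weight_pos[OF y])
      have "cmod (k x y) \<le> exp (- \<bar>\<rho> * (travel x - travel y)\<bar>) / (sqrt (weight x) * sqrt (weight y))"
        using k True y by (simp add: travel_kernel_def)
      also have "\<dots> \<le> E x y / (sqrt (weight x) * sqrt (weight y))"
        unfolding E_def using w wy by (intro divide_right_mono exp_minus_abs_le) auto
      also have "\<dots> = 1 / sqrt (weight x) * (sqrt (1 / weight y * E x y) * sqrt (E x y))"
        using E[of x y] wy by (simp add: real_sqrt_mult real_sqrt_divide)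
      finally have "cmod (k x y * g y) \<le> (1 / sqrt (weight x) * (sqrt (1 / weight y * E x y) * sqrt (E x y))) * cmod (g y)"
        unfolding norm_mult by (rule mult_right_mono) simp
      then show ?thesis
        using y E[of x y] w wy
        by (simp add: A_def B_def H_def ennreal_mult[symmetric] ennreal_leI mult.assoc)
    next
      case False
      then show ?thesis using k by (simp add: travel_kernel_def)
    qed
    then have "(\<integral>\<^sup>+y. ennreal (cmod (k x y * g y)) \<partial>lborel) \<le> (\<integral>\<^sup>+y. A * (B y * H y) \<partial>lborel)"
      by (intro nn_integral_mono)
    also have "\<dots> = A * (\<integral>\<^sup>+y. B y * H y \<partial>lborel)"
      by (rule nn_integral_cmult) measurable
    finally have "(\<integral>\<^sup>+y. ennreal (cmod (k x y * g y)) \<partial>lborel)\<^sup>2 \<le> (A * (\<integral>\<^sup>+y. B y * H y \<partial>lborel))\<^sup>2"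
      by (intro power_mono) auto
    also have "\<dots> = A\<^sup>2 * (\<integral>\<^sup>+y. B y * H y \<partial>lborel)\<^sup>2" by (rule power_mult_distrib)
    also have "\<dots> \<le> A\<^sup>2 * ((\<integral>\<^sup>+y. (B y)\<^sup>2 \<partial>lborel) * (\<integral>\<^sup>+y. (H y)\<^sup>2 \<partial>lborel))"
      by (intro mult_left_mono Cauchy_Schwarz_nn_integral) auto
    also have "(\<lambda>y. (B y)\<^sup>2) = D x"
    proof
      fix y show "(B y)\<^sup>2 = D x y"
        using E[of x y] weight_pos[of y] 
        by (cases "y > 0") (auto simp: B_def D_def ennreal_power)
    qed
    also have "(\<lambda>y. (H y)\<^sup>2) = G x"
    proof
      fix y show "(H y)\<^sup>2 = G x y"
        using E[of x y] by (simp add: H_def G_def ennreal_power power_mult_distrib)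
    qed
    also have "A\<^sup>2 = ennreal (1 / weight x)"
      using w by (simp add: A_def ennreal_power power_divide)
    also have "ennreal (1 / weight x) * (integral\<^sup>N lborel (D x) * integral\<^sup>N lborel (G x))
      \<le> ennreal (1 / weight x) * (ennreal (pi / \<rho>) * integral\<^sup>N lborel (G x))"
      by (intro mult_left_mono mult_right_mono D) auto
    also have "\<dots> = ennreal (pi / \<rho>) * (ennreal (1 / weight x) * integral\<^sup>N lborel (G x))"
      by (simp add: mult_ac)
    also have "ennreal (1 / weight x) * integral\<^sup>N lborel (G x)
      = (\<integral>\<^sup>+y. (ennreal (1 / weight x) * indicator {0<..} x) * G x y \<partial>lborel)"
      using True by (simp add: nn_integral_cmult)
    finally show ?thesis .
  next
    case False
    then have "k x y = 0" for y using k by (simp add: travel_kernel_def)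
    then show ?thesis by simp
  qed
  have "(\<integral>\<^sup>+x. (\<integral>\<^sup>+y. ennreal (cmod (k x y * g y)) \<partial>lborel)\<^sup>2 \<partial>lborel)
    \<le> (\<integral>\<^sup>+x. ennreal (pi / \<rho>) * (\<integral>\<^sup>+y. (ennreal (1 / weight x) * indicator {0<..} x) * G x y \<partial>lborel) \<partial>lborel)"
    by (intro nn_integral_mono pointwise)
  also have "\<dots> = ennreal (pi / \<rho>) * (\<integral>\<^sup>+x. \<integral>\<^sup>+y. (ennreal (1 / weight x) * indicator {0<..} x) * G x y \<partial>lborel \<partial>lborel)"
    by (rule nn_integral_cmult) measurable
  \<comment> \<open>Second half of the Schur test: once the integrals are exchanged, the symmetry of
    \<open>E\<close> turns the integral over \<open>x\<close> into that of \<open>D y\<close>, which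
    has the same bound \<open>pi / \<rho>\<close>.\<close>
  also have "(\<integral>\<^sup>+x. \<integral>\<^sup>+y. (ennreal (1 / weight x) * indicator {0<..} x) * G x y \<partial>lborel \<partial>lborel)
      = (\<integral>\<^sup>+y. \<integral>\<^sup>+x. (ennreal (1 / weight x) * indicator {0<..} x) * G x y \<partial>lborel \<partial>lborel)"
    by (rule lborel_pair.Fubini'[symmetric]) measurable
  also have "\<dots> = (\<integral>\<^sup>+y. (\<integral>\<^sup>+x. ennreal ((cmod (g y))\<^sup>2) * D y x \<partial>lborel) \<partial>lborel)"
  proof (intro nn_integral_cong)
    fix x y
    show "(ennreal (1 / weight x) * indicator {0<..} x) * G x y = ennreal ((cmod (g y))\<^sup>2) * D y x"
    proof -
      have "ennreal (1 / weight x * E x y) = ennreal (1 / weight x) * ennreal (E x y)"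
        "ennreal (E x y * (cmod (g y))\<^sup>2) = ennreal (E x y) * ennreal ((cmod (g y))\<^sup>2)"
        using E[of x y] weight_bounds[of x] by (intro ennreal_mult; simp)+
      then show ?thesis unfolding D_def G_def Esym[of y x] by (simp only: mult_ac)
    qed
  qed
  also have "\<dots> \<le> (\<integral>\<^sup>+y. ennreal ((cmod (g y))\<^sup>2) * ennreal (pi / \<rho>) \<partial>lborel)"
    by (intro nn_integral_mono) (simp add: nn_integral_cmult mult_left_mono D)
  also have "\<dots> = (\<integral>\<^sup>+y. ennreal ((cmod (g y))\<^sup>2) \<partial>lborel) * ennreal (pi / \<rho>)"
    by (rule nn_integral_multc) measurable
  finally have *: "(\<integral>\<^sup>+x. (\<integral>\<^sup>+y. ennreal (cmod (k x y * g y)) \<partial>lborel)\<^sup>2 \<partial>lborel)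
    \<le> ennreal (pi / \<rho>) * ((\<integral>\<^sup>+y. ennreal ((cmod (g y))\<^sup>2) \<partial>lborel) * ennreal (pi / \<rho>))"
    by (simp add: mult_left_mono)
  have "(\<integral>\<^sup>+y. ennreal ((cmod (g y))\<^sup>2) \<partial>lborel) < \<infinity>"
    using square_integrableD(3)[OF g] unfolding integrable_iff_bounded by simp
  then have "ennreal (pi / \<rho>) * ((\<integral>\<^sup>+y. ennreal ((cmod (g y))\<^sup>2) \<partial>lborel) * ennreal (pi / \<rho>)) < \<infinity>"
    by (simp add: ennreal_mult_less_top)
  with * show ?thesis by (rule le_less_trans)
qed

lemma travel_kernel_square_integrable:
  assumes k: "travel_kernel \<rho> k" and "\<rho> > 0" and g: "square_integrable g"
  shows "square_integrable (\<lambda>x. LINT y|lborel. k x y * g y)"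
  unfolding square_integrable_def
proof
  have [measurable]: "case_prod k \<in> borel_measurable (borel \<Otimes>\<^sub>M borel)"
    using k by (simp add: travel_kernel_def)
  note [measurable] = square_integrableD(2)[OF g]
  show m: "(\<lambda>x. LINT y|lborel. k x y * g y) \<in> borel_measurable lborel" by measurable
  \<comment> \<open>Where the row is not integrable the left integral has the default value 0, so
    the inequality holds for every \<open>x\<close> and no exceptional set has to be
    tracked.\<close>
  have "ennreal (cmod (LINT y|lborel. k x y * g y)) \<le> (\<integral>\<^sup>+y. ennreal (cmod (k x y * g y)) \<partial>lborel)" for x
    by (cases "integrable lborel (\<lambda>y. k x y * g y)")
      (auto intro: integral_norm_bound_ennreal simp: not_integrable_integral_eq)
  then have "(ennreal (cmod (LINT y|lborel. k x y * g y)))\<^sup>2 \<le> (\<integral>\<^sup>+y. ennreal (cmod (k x y * g y)) \<partial>lborel)\<^sup>2" for x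
    by (intro power_mono) auto
  then have "(\<integral>\<^sup>+x. ennreal ((cmod (LINT y|lborel. k x y * g y))\<^sup>2) \<partial>lborel)
      \<le> (\<integral>\<^sup>+x. (\<integral>\<^sup>+y. ennreal (cmod (k x y * g y)) \<partial>lborel)\<^sup>2 \<partial>lborel)"
    by (intro nn_integral_mono) (simp add: ennreal_power)
  also have "\<dots> < \<infinity>" by (rule travel_kernel_nn_integral_finite[OF assms])
  finally show "integrable lborel (\<lambda>x. (cmod (LINT y|lborel. k x y * g y))\<^sup>2)"
    using m by (intro integrableI_bounded) auto
qed

text \<open>Moves the kernel from \<open>g\<close> onto the test side. Absolute integrability on the
  plane comes from Cauchy-Schwarz between \<open>t\<close> and the row integrals, whose square has
  finite integral by the Schur test.\<close>

lemma travel_kernel_integral_swap: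
  assumes k: "travel_kernel \<rho> k" and "\<rho> > 0" and g: "square_integrable g" and t: "square_integrable t"
  shows "(LINT x|lborel. (LINT y|lborel. k x y * g y) * t x) = (LINT y|lborel. g y * (LINT x|lborel. k x y * t x))"
proof -
  have [measurable]: "case_prod k \<in> borel_measurable (borel \<Otimes>\<^sub>M borel)"
    using k by (simp add: travel_kernel_def)
  note [measurable] = square_integrableD(2)[OF g] square_integrableD(2)[OF t]
  have "integrable (lborel \<Otimes>\<^sub>M lborel) (\<lambda>(x, y). t x * (k x y * g y))"
  proof (rule integrableI_bounded)
    show "(\<lambda>(x, y). t x * (k x y * g y)) \<in> borel_measurable (lborel \<Otimes>\<^sub>M lborel)" by measurable
    have "(\<integral>\<^sup>+p. ennreal (norm (case p of (x, y) \<Rightarrow> t x * (k x y * g y))) \<partial>(lborel \<Otimes>\<^sub>M lborel))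
        = (\<integral>\<^sup>+x. \<integral>\<^sup>+y. ennreal (cmod (t x * (k x y * g y))) \<partial>lborel \<partial>lborel)"
      by (subst lborel.nn_integral_fst[symmetric]) auto
    also have "\<dots> = (\<integral>\<^sup>+x. ennreal (cmod (t x)) * (\<integral>\<^sup>+y. ennreal (cmod (k x y * g y)) \<partial>lborel) \<partial>lborel)"
      by (intro nn_integral_cong) (simp add: norm_mult[of "t _"] ennreal_mult nn_integral_cmult)
    finally have eq: "(\<integral>\<^sup>+p. ennreal (norm (case p of (x, y) \<Rightarrow> t x * (k x y * g y))) \<partial>(lborel \<Otimes>\<^sub>M lborel))
        = (\<integral>\<^sup>+x. ennreal (cmod (t x)) * (\<integral>\<^sup>+y. ennreal (cmod (k x y * g y)) \<partial>lborel) \<partial>lborel)" .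
    have "(\<integral>\<^sup>+x. ennreal (cmod (t x)) * (\<integral>\<^sup>+y. ennreal (cmod (k x y * g y)) \<partial>lborel) \<partial>lborel)\<^sup>2
      \<le> (\<integral>\<^sup>+x. (ennreal (cmod (t x)))\<^sup>2 \<partial>lborel) * (\<integral>\<^sup>+x. (\<integral>\<^sup>+y. ennreal (cmod (k x y * g y)) \<partial>lborel)\<^sup>2 \<partial>lborel)"
      by (rule Cauchy_Schwarz_nn_integral) measurable
    also have "\<dots> < \<infinity>"
    proof -
      have "(\<integral>\<^sup>+x. (ennreal (cmod (t x)))\<^sup>2 \<partial>lborel) < \<infinity>"
        using square_integrableD(3)[OF t] unfolding integrable_iff_bounded by (simp add: ennreal_power)
      then show ?thesis
        using travel_kernel_nn_integral_finite[OF k \<open>\<rho> > 0\<close> g] by (simp add: ennreal_mult_less_top)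
    qed
    finally show "(\<integral>\<^sup>+p. ennreal (norm (case p of (x, y) \<Rightarrow> t x * (k x y * g y))) \<partial>(lborel \<Otimes>\<^sub>M lborel)) < \<infinity>"
      unfolding eq by (auto simp: power2_eq_square ennreal_mult_less_top)
  qed
  from lborel_pair.Fubini_integral[OF this]
  have "(LINT y|lborel. LINT x|lborel. t x * (k x y * g y)) = (LINT x|lborel. LINT y|lborel. t x * (k x y * g y))" .
  moreover have "(LINT y|lborel. t x * (k x y * g y)) = (LINT y|lborel. k x y * g y) * t x" for x
    by (subst integral_mult_right_zero) (simp add: mult.commute)
  moreover have "(LINT x|lborel. t x * (k x y * g y)) = g y * (LINT x|lborel. k x y * t x)" for y
    by (subst integral_mult_right_zero[symmetric]) (simp add: mult_ac)
  ultimately show ?thesis by (simp add: mult.commute)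
qed

text \<open>Variation of constants, integrating from the end at which \<open>fsol \<mu>\<close> is not square integrable.\<close>

lemma right_half_line_resolvent:
  assumes \<mu>: "Re \<mu> > 0 \<and> \<rho> = Re \<mu> \<or> Re \<mu> < - 2 \<and> \<rho> = - 2 - Re \<mu>"
  obtains k where "travel_kernel \<rho> k"
    "\<And>g. square_integrable g \<Longrightarrow>
      weak_resolvent_eq \<mu> (\<lambda>x. LINT y|lborel. k x y * g y) (\<lambda>x. indicator {0<..} x *\<^sub>R g x)"
proof -
  \<comment> \<open>\<open>S y\<close> collects the \<open>x\<close> influenced by \<open>g\<close>
    at \<open>y\<close>. For \<open>Re \<mu> > 0\<close> the solution is minus an integral over
    \<open>y > x\<close>, which gives \<open>x < y\<close> and \<open>c = -1\<close>; for
    \<open>Re \<mu> < -2\<close> it is an integral over \<open>y \<le> x\<close>, with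
    \<open>c = 1\<close>. Sections in \<open>x\<close> are used because the test function is
    integrated first.\<close>
  define S where "S y = (if Re \<mu> > 0 then {0<..<y} else {y..})" for y :: real
  define K where "K y = complex_of_real (weight y) * fsol \<mu> y" for y
  define c where "c = (if Re \<mu> > 0 then - 1 else 1 :: complex)"
  define k where "k x y = (if x > 0 \<and> y > 0 \<and> x \<in> S y then c * fsol \<mu> x / K y else 0)" for x y
  have \<rho>: "\<rho> > 0" using \<mu> by auto
  have kernel: "travel_kernel \<rho> k"
    unfolding travel_kernel_def
  proof (intro conjI allI impI)
    have [measurable]: "K \<in> borel_measurable borel" unfolding K_def by measurable
    show "case_prod k \<in> borel_measurable (borel \<Otimes>\<^sub>M borel)"
    proof (cases "Re \<mu> > 0")
      case True
      then have "case_prod k = (\<lambda>(x, y). if 0 < x \<and> x < y then c * fsol \<mu> x / K y else 0)"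
        by (auto simp: k_def S_def fun_eq_iff)
      then show ?thesis by simp
    next
      case False
      then have "case_prod k = (\<lambda>(x, y). if 0 < y \<and> y \<le> x then c * fsol \<mu> x / K y else 0)"
        by (auto simp: k_def S_def fun_eq_iff)
      then show ?thesis by simp
    qed
    fix x y :: real
    show "k x y = 0" if "\<not> (x > 0 \<and> y > 0)" using that by (auto simp: k_def)
    assume xy: "x > 0" "y > 0"
    note w = weight_pos[OF xy(1)] weight_pos[OF xy(2)]
    show "cmod (k x y) \<le> exp (- \<bar>\<rho> * (travel x - travel y)\<bar>) / (sqrt (weight x) * sqrt (weight y))"
    proof (cases "x \<in> S y")
      case True
      have "cmod (k x y) = sqrt (weight x) * exp (Re \<mu> * travel x) / (weight y * (sqrt (weight y) * exp (Re \<mu> * travel y)))"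
        using True xy w by (simp add: k_def K_def c_def norm_mult norm_divide norm_fsol)
      also have "\<dots> = exp (Re \<mu> * (travel x - travel y)) * (weight x / weight y) / (sqrt (weight x) * sqrt (weight y))"
      proof -
        have "sqrt (weight x) * A / (weight y * (sqrt (weight y) * B)) = A / B * (weight x / weight y) / (sqrt (weight x) * sqrt (weight y))"
          if "B > 0" for A B
          using w that by (simp add: field_simps)
        then show ?thesis by (simp add: right_diff_distrib exp_diff)
      qed
      also have "exp (Re \<mu> * (travel x - travel y)) * (weight x / weight y) \<le> exp (- \<bar>\<rho> * (travel x - travel y)\<bar>)"
        using \<mu>
      proof
        assume r: "Re \<mu> > 0 \<and> \<rho> = Re \<mu>"
        then have "x \<le> y" using True by (simp add: S_def)
        then have "weight x / weight y \<le> 1" "travel x \<le> travel y"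
          using xy w weight_mono[of x y] travel_mono[of x y] by auto
        then have "exp (Re \<mu> * (travel x - travel y)) * (weight x / weight y) \<le> exp (Re \<mu> * (travel x - travel y)) * 1"
          by (intro mult_left_mono) auto
        moreover have "Re \<mu> * (travel x - travel y) = - \<bar>\<rho> * (travel x - travel y)\<bar>"
          using r \<open>travel x \<le> travel y\<close> by (simp add: abs_mult right_diff_distrib)
        ultimately show ?thesis by (simp only: mult_1_right)
      next
        assume r: "Re \<mu> < - 2 \<and> \<rho> = - 2 - Re \<mu>"
        then have "y \<le> x" using True by (simp add: S_def)
        then have t: "travel y \<le> travel x" using xy travel_mono[of y x] by auto
        \<comment> \<open>Here the quotient of the weights may exceed 1, so it is not discarded: it
          costs \<open>exp (2 * (travel x - travel y))\<close>, which changes the rate from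
          \<open>Re \<mu>\<close> to \<open>Re \<mu> + 2 = - \<rho>\<close>.\<close>
        have "weight x / weight y = exp (2 * travel x) / exp (2 * x) / (exp (2 * travel y) / exp (2 * y))"
          using xy by (simp add: exp_travel)
        also have "\<dots> = exp (2 * (travel x - travel y)) * exp (2 * (y - x))"
          by (simp add: right_diff_distrib exp_diff)
        also have "\<dots> \<le> exp (2 * (travel x - travel y)) * 1"
          using \<open>y \<le> x\<close> by (intro mult_left_mono) auto
        finally have "exp (Re \<mu> * (travel x - travel y)) * (weight x / weight y)
          \<le> exp (Re \<mu> * (travel x - travel y)) * exp (2 * (travel x - travel y))"
          by (intro mult_left_mono) auto
        also have "\<dots> = exp ((Re \<mu> + 2) * (travel x - travel y))" by (simp add: distrib_right exp_add)
        also have "(Re \<mu> + 2) * (travel x - travel y) = - \<bar>\<rho> * (travel x - travel y)\<bar>"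
        proof -
          have "Re \<mu> + 2 = - \<rho>" using r by simp
          then show ?thesis using t \<rho> by (simp add: abs_mult)
        qed
        finally show ?thesis .
      qed
      finally show ?thesis using w by (simp add: divide_right_mono)
    next
      case False
      then show ?thesis using w by (simp add: k_def)
    qed
  qed
  have "weak_resolvent_eq \<mu> (\<lambda>x. LINT y|lborel. k x y * g y) (\<lambda>x. indicator {0<..} x *\<^sub>R g x)"
    if g: "square_integrable g" for g
    unfolding weak_resolvent_eq_def
  proof (intro conjI allI impI)
    show "square_integrable (\<lambda>x. LINT y|lborel. k x y * g y)"
      by (rule travel_kernel_square_integrable[OF kernel \<rho> g])
    have "square_integrable (\<lambda>x. indicator {0<..} x * g x)"
      by (rule square_integrable_bounded_mult[OF g, of _ 1]) (auto simp: indicator_def)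
    then show "square_integrable (\<lambda>x. indicator {0<..} x *\<^sub>R g x)"
      by (simp add: scaleR_conv_of_real of_real_indicator)
    fix \<psi> \<psi>' assume \<psi>: "test_function \<psi>" "\<forall>x. (\<psi> has_vector_derivative \<psi>' x) (at x)"
    define t where "t = adjoint_term \<mu> \<psi> \<psi>'"
    obtain M B where T: "\<And>x. \<bar>x\<bar> \<ge> M \<Longrightarrow> t x = 0" "\<And>x. cmod (t x) \<le> B" "t \<in> borel_measurable borel"
      using adjoint_term_props[of \<psi> \<psi>' \<mu>] \<psi> unfolding t_def by metis
    have st: "square_integrable t"
    proof -
      have "(\<lambda>x. (cmod (indicator {-M..M} x))\<^sup>2) = (indicator {-M..M} :: real \<Rightarrow> real)"
        by (auto simp: fun_eq_iff indicator_def)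
      moreover have "integrable lborel (indicator {-M..M} :: real \<Rightarrow> real)"
        by (rule integrable_real_indicator) (auto simp: emeasure_lborel_Icc_eq)
      ultimately have "square_integrable (indicator {-M..M})"
        by (simp add: square_integrable_def)
      then have "square_integrable (\<lambda>x. t x * indicator {-M..M} x)"
        by (rule square_integrable_bounded_mult[OF _ T(3,2)])
      also have "(\<lambda>x. t x * indicator {-M..M} x) = t"
        using T(1) by (force simp: fun_eq_iff indicator_def)
      finally show ?thesis .
    qed
    \<comment> \<open>For fixed \<open>y > 0\<close> the function \<open>k x y\<close> of
      \<open>x\<close> is a fundamental solution with pole at \<open>y\<close>: paired with
      \<open>adjoint_term\<close> it returns \<open>- \<psi> y\<close>, for either choice of
      \<open>S\<close> and \<open>c\<close>.\<close>
    have inner: "g y * (LINT x|lborel. k x y * t x) = - (indicator {0<..} y *\<^sub>R g y * \<psi> y)" for y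
    proof (cases "y > 0")
      case True
      have K0: "K y \<noteq> 0" using weight_pos[OF True] by (simp add: K_def fsol_nonzero)
      have "(LINT x|lborel. k x y * t x) = (LINT x|lborel. c / K y * (indicator (S y) x *\<^sub>R (fsol \<mu> x * t x)))"
        using True by (intro Bochner_Integration.integral_cong refl) (auto simp: k_def S_def)
      also have "\<dots> = c / K y * (LINT x:S y|lborel. fsol \<mu> x * t x)"
        unfolding set_lebesgue_integral_def by (rule integral_mult_right_zero)
      also have "(LINT x:S y|lborel. fsol \<mu> x * t x) = - c * (K y * \<psi> y)"
        using integral_fsol_adjoint_term_left[of \<mu> y \<psi> \<psi>'] integral_fsol_adjoint_term_right[of y \<psi> \<psi>' \<mu>] True \<psi>
        by (simp add: S_def c_def t_def K_def)
      also have "c / K y * (- c * (K y * \<psi> y)) = - \<psi> y"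
        using K0 by (simp add: c_def)
      finally show ?thesis using True by simp
    qed (simp add: k_def)
    have "(LINT x|lborel. (LINT y|lborel. k x y * g y) * t x) = (LINT y|lborel. - (indicator {0<..} y *\<^sub>R g y * \<psi> y))"
      unfolding travel_kernel_integral_swap[OF kernel \<rho> g st] inner ..
    then show "(LINT x|lborel. indicator {0<..} x *\<^sub>R g x * \<psi> x)
        = - (LINT x|lborel. (LINT y|lborel. k x y * g y) * adjoint_term \<mu> \<psi> \<psi>' x)"
      by (simp add: t_def)
  qed
  with kernel that show thesis by blast
qed

section \<open>Reflection and dense range\<close>

lemma integral_reflect:
  fixes f :: "real \<Rightarrow> 'a::{banach, second_countable_topology}"
  shows "(LINT x|lborel. f (- x)) = (LINT x|lborel. f x)"
  using lborel_integral_real_affine[of "-1" f 0] by simp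

lemma square_integrable_reflect:
  assumes f: "square_integrable f"
  shows "square_integrable (\<lambda>x. f (- x))"
  unfolding square_integrable_def
proof
  note [measurable] = square_integrableD(2)[OF f]
  show "(\<lambda>x. f (- x)) \<in> borel_measurable lborel" by measurable
  show "integrable lborel (\<lambda>x. (cmod (f (- x)))\<^sup>2)"
    using lborel_integrable_real_affine[OF square_integrableD(3)[OF f], of "-1" 0] by simp
qed

lemma l2_norm_reflect: "l2_norm (\<lambda>x. f (- x)) = l2_norm f"
  unfolding l2_norm_def using integral_reflect[of "\<lambda>x. (cmod (f x))\<^sup>2"] by simp

lemma weak_resolvent_eqD:
  assumes "weak_resolvent_eq \<mu> v g" "test_function \<psi>" "\<And>x. (\<psi> has_vector_derivative \<psi>' x) (at x)"
  shows "(LINT x|lborel. g x * \<psi> x) = - (LINT x|lborel. v x * adjoint_term \<mu> \<psi> \<psi>' x)"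
  using assms unfolding weak_resolvent_eq_def by blast

text \<open>The reflection \<open>x \<mapsto> -x\<close> turns \<open>L\<close> into \<open>-L\<close>, so the left half line behaves like the right one
  with \<open>\<mu>\<close> replaced by \<open>-\<mu>\<close>.\<close>

lemma weak_resolvent_eq_reflect:
  assumes "weak_resolvent_eq \<mu> v g"
  shows "weak_resolvent_eq (- \<mu>) (\<lambda>x. v (- x)) (\<lambda>x. - g (- x))"
  unfolding weak_resolvent_eq_def
proof (intro conjI allI impI)
  have v: "square_integrable v" and g: "square_integrable g"
    using assms by (auto simp: weak_resolvent_eq_def)
  show "square_integrable (\<lambda>x. v (- x))" by (rule square_integrable_reflect[OF v])
  show "square_integrable (\<lambda>x. - g (- x))"
    using square_integrable_cmult[OF square_integrable_reflect[OF g], of "-1"] by simp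
  fix \<psi> \<psi>' assume \<psi>: "test_function \<psi>" "\<forall>x. (\<psi> has_vector_derivative \<psi>' x) (at x)"
  define \<theta> where "\<theta> x = \<psi> (- x)" for x
  have "smooth_fun (\<lambda>x. 1 * \<psi> ((-1) * x + 0) + 0 * \<psi> (1 * x + 0))"
    using \<psi>(1) by (intro smooth_fun_affine_comb) (auto simp: test_function_iff)
  moreover obtain M where "M > 0" "\<And>x. \<bar>x\<bar> \<ge> M \<Longrightarrow> \<psi> x = 0"
    using \<psi>(1) unfolding test_function_iff compact_support_iff by blast
  ultimately have t\<theta>: "test_function \<theta>"
    unfolding test_function_iff compact_support_iff \<theta>_def by (intro conjI exI[of _ M]) auto
  have \<theta>': "(\<theta> has_vector_derivative - \<psi>' (- x)) (at x)" for x
  proof -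
    have "(uminus has_vector_derivative - 1) (at x)" by (auto intro!: derivative_eq_intros)
    from vector_diff_chain_at[OF this, of \<psi> "\<psi>' (- x)"] \<psi>(2)
    show ?thesis by (simp add: o_def \<theta>_def[abs_def])
  qed
  have "(LINT x|lborel. g x * \<theta> x) = - (LINT x|lborel. v x * adjoint_term \<mu> \<theta> (\<lambda>x. - \<psi>' (- x)) x)"
    by (rule weak_resolvent_eqD[OF assms t\<theta> \<theta>'])
  moreover have "adjoint_term \<mu> \<theta> (\<lambda>x. - \<psi>' (- x)) x = - adjoint_term (- \<mu>) \<psi> \<psi>' (- x)" for x
    unfolding adjoint_term_def \<theta>_def weight_minus phi_phi'_minus
    by (simp add: algebra_simps del: of_real_mult)
  ultimately have "(LINT x|lborel. g x * \<psi> (- x)) = (LINT x|lborel. v x * adjoint_term (- \<mu>) \<psi> \<psi>' (- x))"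
    by (simp add: \<theta>_def)
  then show "(LINT x|lborel. - g (- x) * \<psi> x) = - (LINT x|lborel. v (- x) * adjoint_term (- \<mu>) \<psi> \<psi>' x)"
    using integral_reflect[of "\<lambda>x. g x * \<psi> (- x)"]
      integral_reflect[of "\<lambda>x. v x * adjoint_term (- \<mu>) \<psi> \<psi>' (- x)"] by simp
qed

section \<open>Linearity and change of parameter in the weak equation\<close>

lemma integrable_mult_adjoint_term:
  assumes "square_integrable v" "test_function \<psi>" "\<And>x. (\<psi> has_vector_derivative \<psi>' x) (at x)"
  shows "integrable lborel (\<lambda>x. v x * adjoint_term \<mu> \<psi> \<psi>' x)"
  by (rule adjoint_term_props[OF assms(2,3), of \<mu>])
    (rule integrable_mult_compact_support[OF square_integrable_imp_locally_integrable[OF assms(1)]])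

lemma weak_resolvent_eq_lin_comb:
  assumes "weak_resolvent_eq \<mu> v1 g1" "weak_resolvent_eq \<mu> v2 g2"
  shows "weak_resolvent_eq \<mu> (\<lambda>x. v1 x + c * v2 x) (\<lambda>x. g1 x + c * g2 x)"
  unfolding weak_resolvent_eq_def
proof (intro conjI allI impI)
  have s: "square_integrable v1" "square_integrable v2" "square_integrable g1" "square_integrable g2"
    using assms by (auto simp: weak_resolvent_eq_def)
  show "square_integrable (\<lambda>x. v1 x + c * v2 x)" "square_integrable (\<lambda>x. g1 x + c * g2 x)"
    by (intro square_integrable_add square_integrable_cmult s)+
  fix \<psi> \<psi>' assume \<psi>: "test_function \<psi>" "\<forall>x. (\<psi> has_vector_derivative \<psi>' x) (at x)"
  have i: "integrable lborel (\<lambda>x. v1 x * adjoint_term \<mu> \<psi> \<psi>' x)"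
    "integrable lborel (\<lambda>x. v2 x * adjoint_term \<mu> \<psi> \<psi>' x)"
    "integrable lborel (\<lambda>x. g1 x * \<psi> x)" "integrable lborel (\<lambda>x. g2 x * \<psi> x)"
    using integrable_mult_adjoint_term[OF s(1) \<psi>(1) \<psi>(2)[rule_format]]
      integrable_mult_adjoint_term[OF s(2) \<psi>(1) \<psi>(2)[rule_format]] \<psi>(1) s
    by (blast intro: integrable_mult_test square_integrable_imp_locally_integrable)+
  have e: "(LINT x|lborel. g1 x * \<psi> x) = - (LINT x|lborel. v1 x * adjoint_term \<mu> \<psi> \<psi>' x)"
    "(LINT x|lborel. g2 x * \<psi> x) = - (LINT x|lborel. v2 x * adjoint_term \<mu> \<psi> \<psi>' x)"
    using assms \<psi> by (auto simp: weak_resolvent_eq_def)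
  have "(LINT x|lborel. (g1 x + c * g2 x) * \<psi> x) = (LINT x|lborel. g1 x * \<psi> x) + c * (LINT x|lborel. g2 x * \<psi> x)"
    using i by (simp add: distrib_right mult.assoc)
  also have "\<dots> = - ((LINT x|lborel. v1 x * adjoint_term \<mu> \<psi> \<psi>' x) + c * (LINT x|lborel. v2 x * adjoint_term \<mu> \<psi> \<psi>' x))"
    unfolding e by simp
  also have "\<dots> = - (LINT x|lborel. (v1 x + c * v2 x) * adjoint_term \<mu> \<psi> \<psi>' x)"
    using i by (simp add: distrib_right mult.assoc)
  finally show "(LINT x|lborel. (g1 x + c * g2 x) * \<psi> x) = - (LINT x|lborel. (v1 x + c * v2 x) * adjoint_term \<mu> \<psi> \<psi>' x)" .
qed

text \<open>An exact solution for a perturbed parameter \<open>\<nu>\<close> thereby counts as an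
  approximate solution for \<open>\<mu>\<close>, with error
  \<open>(\<nu> - \<mu>) * v\<close>.\<close>

lemma weak_resolvent_eq_shift:
  assumes "weak_resolvent_eq \<nu> v g"
  shows "weak_resolvent_eq \<mu> v (\<lambda>x. g x + (\<nu> - \<mu>) * v x)"
  unfolding weak_resolvent_eq_def
proof (intro conjI allI impI)
  have s: "square_integrable v" "square_integrable g"
    using assms by (auto simp: weak_resolvent_eq_def)
  show "square_integrable v" "square_integrable (\<lambda>x. g x + (\<nu> - \<mu>) * v x)"
    by (intro square_integrable_add square_integrable_cmult s)+
  fix \<psi> \<psi>' assume \<psi>: "test_function \<psi>" "\<forall>x. (\<psi> has_vector_derivative \<psi>' x) (at x)"
  have i: "integrable lborel (\<lambda>x. v x * adjoint_term \<nu> \<psi> \<psi>' x)"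
    "integrable lborel (\<lambda>x. v x * \<psi> x)" "integrable lborel (\<lambda>x. g x * \<psi> x)"
    using integrable_mult_adjoint_term[OF s(1) \<psi>(1) \<psi>(2)[rule_format]] \<psi>(1) s
    by (blast intro: integrable_mult_test square_integrable_imp_locally_integrable)+
  have e: "(LINT x|lborel. g x * \<psi> x) = - (LINT x|lborel. v x * adjoint_term \<nu> \<psi> \<psi>' x)"
    using assms \<psi> by (auto simp: weak_resolvent_eq_def)
  have "(LINT x|lborel. (g x + (\<nu> - \<mu>) * v x) * \<psi> x) = (LINT x|lborel. g x * \<psi> x + (\<nu> - \<mu>) * (v x * \<psi> x))"
    by (simp add: distrib_right mult.assoc)
  also have "\<dots> = (LINT x|lborel. g x * \<psi> x) + (\<nu> - \<mu>) * (LINT x|lborel. v x * \<psi> x)"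
    using i by (subst Bochner_Integration.integral_add) (auto simp del: left_diff_distrib)
  also have "\<dots> = - ((LINT x|lborel. v x * adjoint_term \<nu> \<psi> \<psi>' x) - (\<nu> - \<mu>) * (LINT x|lborel. v x * \<psi> x))"
    unfolding e by simp
  also have "\<dots> = - (LINT x|lborel. v x * adjoint_term \<nu> \<psi> \<psi>' x - (\<nu> - \<mu>) * (v x * \<psi> x))"
    using i by (subst Bochner_Integration.integral_diff) auto
  also have "(\<lambda>x. v x * adjoint_term \<nu> \<psi> \<psi>' x - (\<nu> - \<mu>) * (v x * \<psi> x)) = (\<lambda>x. v x * adjoint_term \<mu> \<psi> \<psi>' x)"
    by (simp add: adjoint_term_def fun_eq_iff algebra_simps)
  finally show "(LINT x|lborel. (g x + (\<nu> - \<mu>) * v x) * \<psi> x) = - (LINT x|lborel. v x * adjoint_term \<mu> \<psi> \<psi>' x)" .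
qed

lemma weak_resolvent_eq_cong_AE:
  assumes "weak_resolvent_eq \<mu> v g" "square_integrable g'" "AE x in lborel. g x = g' x"
  shows "weak_resolvent_eq \<mu> v g'"
  unfolding weak_resolvent_eq_def
proof (intro conjI allI impI assms)
  have s: "square_integrable g" using assms by (auto simp: weak_resolvent_eq_def)
  note [measurable] = square_integrableD(2)[OF s] square_integrableD(2)[OF assms(2)]
  show "square_integrable v" using assms by (auto simp: weak_resolvent_eq_def)
  fix \<psi> \<psi>' assume \<psi>: "test_function \<psi>" "\<forall>x. (\<psi> has_vector_derivative \<psi>' x) (at x)"
  note [measurable] = test_function_measurable[OF \<psi>(1)]
  have "(LINT x|lborel. g' x * \<psi> x) = (LINT x|lborel. g x * \<psi> x)"
  proof (rule integral_cong_AE)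
    show "AE x in lborel. g' x * \<psi> x = g x * \<psi> x" using assms(3) by eventually_elim simp
  qed measurable
  also have "\<dots> = - (LINT x|lborel. v x * adjoint_term \<mu> \<psi> \<psi>' x)"
    using assms(1) \<psi> unfolding weak_resolvent_eq_def by blast
  finally show "(LINT x|lborel. g' x * \<psi> x) = - (LINT x|lborel. v x * adjoint_term \<mu> \<psi> \<psi>' x)" .
qed

lemma square_integrable_indicator:
  assumes "square_integrable g" "A \<in> sets borel"
  shows "square_integrable (\<lambda>x. indicator A x *\<^sub>R g x)"
proof -
  have "square_integrable (\<lambda>x. indicator A x * g x)"
    using assms(2) by (intro square_integrable_bounded_mult[OF assms(1), of _ 1]) (auto simp: indicator_def)
  then show ?thesis by (simp add: scaleR_conv_of_real of_real_indicator)
qed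

text \<open>Right-hand sides that vanish near both ends of the half line are dense, by dominated
  convergence; on those the perturbed solutions can be controlled.\<close>

lemma travel_truncation:
  assumes g: "square_integrable g" and "e > 0"
  obtains n :: nat where
    "l2_norm (\<lambda>x. indicator {x. 0 < x \<and> \<bar>travel x\<bar> \<le> n} x *\<^sub>R g x - indicator {0<..} x *\<^sub>R g x) < e"
proof -
  note [measurable] = square_integrableD(2)[OF g]
  define h where "h n x = indicator {x. 0 < x \<and> \<bar>travel x\<bar> \<le> real n} x *\<^sub>R g x - indicator {0<..} x *\<^sub>R g x" for n :: nat and x
  have [measurable]: "h n \<in> borel_measurable borel" for n unfolding h_def by measurable
  have "(\<lambda>n. LINT x|lborel. (cmod (h n x))\<^sup>2) \<longlonglongrightarrow> (LINT x|(lborel :: real measure). 0)"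
  proof (rule integral_dominated_convergence[where w = "\<lambda>x. (cmod (g x))\<^sup>2"])
    show "integrable lborel (\<lambda>x. (cmod (g x))\<^sup>2)" by (rule square_integrableD(3)[OF g])
    show "AE x in lborel. (\<lambda>n. (cmod (h n x))\<^sup>2) \<longlonglongrightarrow> 0"
    proof (rule AE_I2, rule tendsto_eventually)
      fix x
      have "eventually (\<lambda>n. \<bar>travel x\<bar> \<le> real n) sequentially"
        using filterlim_real_sequentially by (simp add: filterlim_at_top)
      then show "eventually (\<lambda>n. (cmod (h n x))\<^sup>2 = 0) sequentially"
        by eventually_elim (auto simp: h_def indicator_def)
    qed
    show "AE x in lborel. norm ((cmod (h n x))\<^sup>2) \<le> (cmod (g x))\<^sup>2" for n
      by (rule AE_I2) (auto simp: h_def indicator_def)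
  qed measurable
  then have "(\<lambda>n. sqrt (LINT x|lborel. (cmod (h n x))\<^sup>2)) \<longlonglongrightarrow> sqrt 0"
    by (intro tendsto_intros) simp
  then have "eventually (\<lambda>n. l2_norm (h n) < e) sequentially"
    using \<open>e > 0\<close> by (intro order_tendstoD(2)[of _ 0]) (simp_all add: l2_norm_def)
  then obtain n where "l2_norm (h n) < e" unfolding eventually_sequentially by blast
  then show thesis using that[of n] by (simp add: h_def[abs_def])
qed

text \<open>On the lines \<open>Re \<mu> = 0\<close> and \<open>Re \<mu> = -2\<close> the parameter is moved by \<open>\<delta>\<close> off the spectrum of the half
  line problem. The resolvent norm is of order \<open>1 / \<delta>\<close>, but on a right-hand side with bounded
  \<open>travel\<close>-support the solution is only of size \<open>\<delta> powr (- 1 / 2)\<close>, so the error term vanishes in the limit.\<close>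

lemma right_half_line_dense_range:
  assumes \<mu>: "Re \<mu> = 0 \<or> Re \<mu> = - 2" and g: "square_integrable g" and "e > 0"
  obtains v f where "weak_resolvent_eq \<mu> v f" "l2_norm (\<lambda>x. f x - indicator {0<..} x *\<^sub>R g x) < e"
proof -
  note [measurable] = square_integrableD(2)[OF g]
  obtain n :: nat where n:
    "l2_norm (\<lambda>x. indicator {x. 0 < x \<and> \<bar>travel x\<bar> \<le> n} x *\<^sub>R g x - indicator {0<..} x *\<^sub>R g x) < e / 2"
    using travel_truncation[OF g, of "e / 2"] \<open>e > 0\<close> by auto
  define g0 where "g0 x = indicator {x. 0 < x \<and> \<bar>travel x\<bar> \<le> real n} x *\<^sub>R g x" for x
  have [measurable]: "g0 \<in> borel_measurable borel" unfolding g0_def by measurable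
  have sg0: "square_integrable g0"
    unfolding g0_def[abs_def] by (rule square_integrable_indicator[OF g]) measurable
  \<comment> \<open>An integrable majorant of \<open>cmod (g0 y) / sqrt (weight y)\<close> that does
    not depend on the perturbation. It splits the quotient by
    \<open>a * b \<le> a\<^sup>2 + b\<^sup>2\<close>; on the truncated region the factor
    \<open>1 + (real n)\<^sup>2\<close> compensates the denominator
    \<open>1 + (travel y)\<^sup>2\<close>.\<close>
  define q where "q y = (cmod (g y))\<^sup>2 + (1 + (real n)\<^sup>2) * (indicator {0<..} y * (1 / (weight y * (1 + (travel y)\<^sup>2))))" for y
  have iw: "integrable lborel (\<lambda>y. indicator {0<..} y * (1 / (weight y * (1 + (travel y)\<^sup>2))))"
  proof (rule integrableI_bounded)
    have "(\<integral>\<^sup>+y. ennreal (norm (indicator {0<..} y * (1 / (weight y * (1 + (travel y)\<^sup>2))))) \<partial>lborel)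
      = (\<integral>\<^sup>+y. ennreal (1 / (weight y * (1 + (1 * (travel y - 0))\<^sup>2))) * indicator {0<..} y \<partial>lborel)"
      using weight_bounds by (intro nn_integral_cong) (auto simp: indicator_def add_nonneg_nonneg)
    also have "\<dots> \<le> ennreal (pi / 1)" by (rule nn_integral_travel_le) simp
    finally show "(\<integral>\<^sup>+y. ennreal (norm (indicator {0<..} y * (1 / (weight y * (1 + (travel y)\<^sup>2))))) \<partial>lborel) < \<infinity>"
      by (rule le_less_trans) simp
  qed measurable
  have iq: "integrable lborel q"
    unfolding q_def[abs_def] using square_integrableD(3)[OF g] iw
    by (intro Bochner_Integration.integrable_add integrable_mult_right) auto
  define C where "C = (LINT y|lborel. q y)"
  have q0: "q y \<ge> 0" for y using weight_bounds[of y] by (simp add: q_def)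
  then have C0: "C \<ge> 0" unfolding C_def by simp
  have gq: "cmod (g0 y) / sqrt (weight y) \<le> q y" for y
  proof (cases "0 < y \<and> \<bar>travel y\<bar> \<le> real n")
    case True
    then have w: "weight y > 0" by (simp add: weight_pos)
    have "0 \<le> (cmod (g y) - 1 / sqrt (weight y))\<^sup>2 + (cmod (g y))\<^sup>2 + (1 / sqrt (weight y))\<^sup>2" by simp
    then have "cmod (g y) / sqrt (weight y) \<le> (cmod (g y))\<^sup>2 + 1 / weight y"
      using w by (simp add: power2_diff power_divide)
    also have "1 / weight y \<le> (1 + (real n)\<^sup>2) * (1 / (weight y * (1 + (travel y)\<^sup>2)))"
    proof -
      have "(travel y)\<^sup>2 \<le> (real n)\<^sup>2" using True by (intro abs_le_square_iff[THEN iffD1]) auto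
      then have "1 \<le> (1 + (real n)\<^sup>2) / (1 + (travel y)\<^sup>2)"
        by (subst le_divide_eq_1_pos) (auto intro: add_pos_nonneg)
      then have "1 / weight y * 1 \<le> 1 / weight y * ((1 + (real n)\<^sup>2) / (1 + (travel y)\<^sup>2))"
        using w by (intro mult_left_mono) auto
      then show ?thesis by (simp add: mult.commute)
    qed
    finally show ?thesis using True by (simp add: g0_def q_def)
  qed (use q0 in \<open>auto simp: g0_def\<close>)
  define D where "D = (exp (real n) * C)\<^sup>2"
  have D0: "D \<ge> 0" by (simp add: D_def)
  \<comment> \<open>The squared error will be at most \<open>\<delta> * (D * pi / 2)\<close>, and
    this choice pushes it below \<open>(e / 2)\<^sup>2\<close>. The added 1 guards against
    \<open>D = 0\<close>, and \<open>\<delta> \<le> 1\<close> keeps \<open>D\<close> independent of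
    \<open>\<delta>\<close>.\<close>
  define \<delta> where "\<delta> = min 1 (e\<^sup>2 / (4 * (D * pi / 2 + 1)))"
  have Dpi: "D * pi / 2 + 1 > 0" using D0 by (simp add: add_nonneg_pos)
  have \<delta>: "0 < \<delta>" "\<delta> \<le> 1" using \<open>e > 0\<close> Dpi by (auto simp: \<delta>_def)
  \<comment> \<open>The shift points out of the closed strip: to the right from
    \<open>Re \<mu> = 0\<close>, to the left from \<open>Re \<mu> = -2\<close>. In both cases the
    distance to the strip, and hence the decay rate, is \<open>\<delta>\<close>.\<close>
  define c where "c = (if Re \<mu> = 0 then complex_of_real \<delta> else - complex_of_real \<delta>)"
  have "Re (\<mu> + c) > 0 \<and> \<delta> = Re (\<mu> + c) \<or> Re (\<mu> + c) < - 2 \<and> \<delta> = - 2 - Re (\<mu> + c)"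
    using \<mu> \<delta> by (auto simp: c_def)
  then obtain k where k: "travel_kernel \<delta> k"
    "\<And>g. square_integrable g \<Longrightarrow>
      weak_resolvent_eq (\<mu> + c) (\<lambda>x. LINT y|lborel. k x y * g y) (\<lambda>x. indicator {0<..} x *\<^sub>R g x)"
    by (rule right_half_line_resolvent) blast
  define v where "v x = (LINT y|lborel. k x y * g0 y)" for x
  have "weak_resolvent_eq (\<mu> + c) v (\<lambda>x. indicator {0<..} x *\<^sub>R g0 x)"
    unfolding v_def by (rule k(2)[OF sg0])
  also have "(\<lambda>x. indicator {0<..} x *\<^sub>R g0 x) = g0" by (auto simp: g0_def fun_eq_iff indicator_def)
  finally have w0: "weak_resolvent_eq (\<mu> + c) v g0" .
  then have sv: "square_integrable v" by (simp add: weak_resolvent_eq_def)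
  from weak_resolvent_eq_shift[OF w0, of \<mu>] have w: "weak_resolvent_eq \<mu> v (\<lambda>x. g0 x + c * v x)" by simp
  have "cmod (v x) \<le> exp (real n) * C * (exp (- \<bar>\<delta> * travel x\<bar>) / sqrt (weight x))" if x: "x > 0" for x
  proof -
    define m where "m = exp (real n) * (exp (- \<bar>\<delta> * travel x\<bar>) / sqrt (weight x))"
    have m0: "m \<ge> 0" using weight_bounds[of x] by (simp add: m_def)
    have "cmod (v x) \<le> (LINT y|lborel. m * q y)"
      unfolding v_def
    proof (rule Bochner_Integration.integral_norm_bound_integral)
      show imq: "integrable lborel (\<lambda>y. m * q y)" using iq by simp
      have le: "cmod (k x y * g0 y) \<le> m * q y" for y
        proof (cases "0 < y \<and> \<bar>travel y\<bar> \<le> real n")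
          case True
          have wx: "sqrt (weight x) > 0" "sqrt (weight y) > 0" using x True by (simp_all add: weight_pos)
          have "cmod (k x y) \<le> exp (- \<bar>\<delta> * (travel x - travel y)\<bar>) / (sqrt (weight x) * sqrt (weight y))"
            using k(1) x True by (simp add: travel_kernel_def)
          \<comment> \<open>Recentring the kernel at 0 costs
            \<open>exp (\<delta> * \<bar>travel y\<bar>)\<close>, which the truncation and
            \<open>\<delta> \<le> 1\<close> bound by \<open>exp (real n)\<close>.\<close>
          also have "exp (- \<bar>\<delta> * (travel x - travel y)\<bar>) \<le> exp (real n) * exp (- \<bar>\<delta> * travel x\<bar>)"
          proof -
            have "\<bar>\<delta> * travel x\<bar> \<le> \<bar>\<delta> * (travel x - travel y)\<bar> + \<bar>\<delta> * travel y\<bar>"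
              by (simp add: right_diff_distrib)
            moreover have "\<bar>\<delta> * travel y\<bar> \<le> 1 * real n"
              unfolding abs_mult using \<delta> True by (intro mult_mono) auto
            ultimately show ?thesis by (simp flip: exp_add)
          qed
          finally have "cmod (k x y) \<le> m * (1 / sqrt (weight y))"
            using wx by (simp add: m_def divide_right_mono)
          then have "cmod (k x y * g0 y) \<le> m * (1 / sqrt (weight y)) * cmod (g0 y)"
            unfolding norm_mult by (rule mult_right_mono) simp
          also have "\<dots> = m * (cmod (g0 y) / sqrt (weight y))" by simp
          also have "\<dots> \<le> m * q y" by (intro mult_left_mono gq m0)
          finally show ?thesis .
        next
          case False
          then show ?thesis using m0 q0 by (auto simp: g0_def)
        qed
      then show "cmod (k x y * g0 y) \<le> m * q y" for y .
      have [measurable]: "case_prod k \<in> borel_measurable (borel \<Otimes>\<^sub>M borel)"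
        using k(1) by (simp add: travel_kernel_def)
      show "integrable lborel (\<lambda>y. k x y * g0 y)"
      proof (rule Bochner_Integration.integrable_bound[OF imq])
        show "AE y in lborel. norm (k x y * g0 y) \<le> norm (m * q y)"
          using le by (intro AE_I2) (smt (verit) real_norm_def)
      qed measurable
    qed
    also have "\<dots> = m * C" by (simp add: C_def)
    finally show ?thesis by (simp add: m_def mult_ac)
  qed
  note bound = this
  have "(l2_norm v)\<^sup>2 \<le> D * (pi / (2 * \<delta>))"
  proof (rule square_integrableI_travel(2)[where c = 0])
    show "v \<in> borel_measurable borel" using sv by (rule square_integrableD)
    show "v x = 0" if "x \<le> 0" for x
      using k(1) that by (simp add: v_def travel_kernel_def)
    fix x :: real assume x: "x > 0"
    have wx: "weight x > 0" by (rule weight_pos[OF x])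
    have "(cmod (v x))\<^sup>2 \<le> (exp (real n) * C * (exp (- \<bar>\<delta> * travel x\<bar>) / sqrt (weight x)))\<^sup>2"
      by (intro power_mono bound x) simp
    also have "\<dots> = D * (exp (- \<bar>\<delta> * travel x\<bar>))\<^sup>2 / weight x"
      using wx by (simp add: D_def power_mult_distrib power_divide)
    also have "(exp (- \<bar>\<delta> * travel x\<bar>))\<^sup>2 = exp (- \<bar>2 * \<delta> * travel x\<bar>)"
      by (simp add: exp_double[symmetric] abs_mult)
    also have "D * exp (- \<bar>2 * \<delta> * travel x\<bar>) / weight x \<le> D * (1 / (1 + (2 * \<delta> * travel x)\<^sup>2)) / weight x"
      using D0 wx by (intro divide_right_mono mult_left_mono exp_minus_abs_le) auto
    finally show "(cmod (v x))\<^sup>2 \<le> D / (weight x * (1 + (2 * \<delta> * (travel x - 0))\<^sup>2))"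
      by (simp add: mult.commute)
  qed (use \<delta> D0 in auto)
  then have "\<delta>\<^sup>2 * (l2_norm v)\<^sup>2 \<le> \<delta>\<^sup>2 * (D * (pi / (2 * \<delta>)))" by (intro mult_left_mono) auto
  also have "\<dots> = \<delta> * (D * pi / 2)" using \<delta> by (simp add: power2_eq_square)
  also have "\<dots> < \<delta> * (D * pi / 2 + 1)" using \<delta> by simp
  also have "\<dots> \<le> e\<^sup>2 / (4 * (D * pi / 2 + 1)) * (D * pi / 2 + 1)"
    using Dpi by (intro mult_right_mono) (auto simp: \<delta>_def)
  also have "\<dots> = (e / 2)\<^sup>2"
  proof -
    have "e\<^sup>2 / (4 * t) * t = (e / 2)\<^sup>2" if "t > 0" for t
      using that by (simp add: power_divide)
    then show ?thesis using Dpi by blast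
  qed
  finally have "(\<delta> * l2_norm v)\<^sup>2 < (e / 2)\<^sup>2" by (simp add: power_mult_distrib)
  then have "\<delta> * l2_norm v < e / 2"
    by (rule power2_less_imp_less) (use \<open>e > 0\<close> in simp)
  then have lv: "l2_norm (\<lambda>x. c * v x) < e / 2"
    using \<delta> by (simp add: l2_norm_cmult c_def)
  have s1: "square_integrable (\<lambda>x. g0 x - indicator {0<..} x *\<^sub>R g x)"
    using square_integrable_add[OF sg0 square_integrable_cmult[OF square_integrable_indicator[OF g, of "{0<..}"], of "-1"]]
    by simp
  have "l2_norm (\<lambda>x. (g0 x + c * v x) - indicator {0<..} x *\<^sub>R g x)
      = l2_norm (\<lambda>x. (g0 x - indicator {0<..} x *\<^sub>R g x) + c * v x)"
    by (simp add: algebra_simps)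
  also have "\<dots> \<le> l2_norm (\<lambda>x. g0 x - indicator {0<..} x *\<^sub>R g x) + l2_norm (\<lambda>x. c * v x)"
    by (intro l2_norm_triangle s1 square_integrable_cmult sv)
  also have "\<dots> < e" using n lv by (simp add: g0_def)
  finally show thesis using that w by blast
qed

section \<open>The spectrum\<close>

lemma right_half_line_approx:
  assumes "Re \<mu> \<ge> 0 \<or> Re \<mu> \<le> - 2" "square_integrable g" "e > 0"
  obtains v f where "weak_resolvent_eq \<mu> v f" "l2_norm (\<lambda>x. f x - indicator {0<..} x *\<^sub>R g x) < e"
proof (cases "Re \<mu> = 0 \<or> Re \<mu> = - 2")
  case True
  then show thesis using right_half_line_dense_range[OF _ assms(2,3)] that by blast
next
  case False
  \<comment> \<open>The maximum selects whichever of the two distances to the strip is positive, so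
    both cases share one \<open>\<rho>\<close>. The solution obtained is exact and the error norm is
    0.\<close>
  then have "Re \<mu> > 0 \<and> max (Re \<mu>) (- 2 - Re \<mu>) = Re \<mu> \<or>
      Re \<mu> < - 2 \<and> max (Re \<mu>) (- 2 - Re \<mu>) = - 2 - Re \<mu>"
    using assms(1) by auto
  then obtain k where "\<And>g. square_integrable g \<Longrightarrow>
      weak_resolvent_eq \<mu> (\<lambda>x. LINT y|lborel. k x y * g y) (\<lambda>x. indicator {0<..} x *\<^sub>R g x)"
    by (rule right_half_line_resolvent) blast
  from that[OF this[OF assms(2)]] show thesis using assms(3) by (simp add: l2_norm_def)
qed

lemma AE_reflect_half_lines:
  fixes P :: "real \<Rightarrow> bool"
  assumes "AE x in lborel. x > 0 \<longrightarrow> P x" "AE x in lborel. x > 0 \<longrightarrow> P (- x)"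
    and [measurable]: "Measurable.pred borel P"
  shows "AE x in lborel. P x"
proof -
  have "AE x in lborel. 0 + (-1) * x > 0 \<longrightarrow> P (- (0 + (-1) * x))"
    by (rule AE_borel_affine[OF _ _ assms(2)]) auto
  with assms(1) AE_lborel_singleton[of 0] show ?thesis
  proof eventually_elim
    case (elim x)
    then show ?case by (cases "x > 0") auto
  qed
qed

lemma op_ker_trivial:
  assumes "Re \<mu> \<ge> 0 \<or> Re \<mu> \<le> - 2" "Re (- \<mu>) \<ge> 0 \<or> Re (- \<mu>) \<le> - 2"
  shows "op_ker Dom_L L \<mu> = {0}"
  unfolding op_ker_eq_0_iff
proof (intro allI impI)
  fix v assume v: "weak_resolvent_eq \<mu> v (\<lambda>_. 0)"
  then have "square_integrable v" by (simp add: weak_resolvent_eq_def)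
  then have [measurable]: "v \<in> borel_measurable borel" by (rule square_integrableD)
  have "AE x in lborel. x > 0 \<longrightarrow> v x = 0"
    by (rule homogeneous_solution_right_half_line[OF v _ assms(1)]) simp
  moreover have "AE x in lborel. x > 0 \<longrightarrow> v (- x) = 0"
    by (rule homogeneous_solution_right_half_line[OF weak_resolvent_eq_reflect[OF v] _ assms(2)]) simp
  ultimately show "AE x in lborel. v x = 0" by (rule AE_reflect_half_lines) measurable
qed

lemma op_ker_nontrivial:
  assumes "0 < \<bar>Re \<mu>\<bar>" "\<bar>Re \<mu>\<bar> < 2"
  shows "op_ker Dom_L L \<mu> \<noteq> {0}"
proof -
  \<comment> \<open>\<open>fsol\<close> has no zeros, so vanishing almost everywhere would make the
    interval from 0 to 1 a null set.\<close>
  have right: False if "AE x in lborel. indicator {0<..} x *\<^sub>R fsol \<nu> x = 0" for \<nu>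
  proof -
    from that have "AE x in lborel. x \<notin> {0<..<1::real}"
      by eventually_elim (auto simp: indicator_def fsol_nonzero)
    then have "{0<..<1::real} \<in> null_sets lborel"
      by (subst AE_iff_null_sets) auto
    then have "emeasure lborel {0<..<1::real} = 0" by (rule null_setsD1)
    then show False by simp
  qed
  show ?thesis
  proof
    assume *: "op_ker Dom_L L \<mu> = {0}"
    show False
    proof (cases "Re \<mu> < 0")
      case True
      then have "weak_resolvent_eq \<mu> (\<lambda>x. indicator {0<..} x *\<^sub>R fsol \<mu> x) (\<lambda>_. 0)"
        using assms by (intro fsol_weak_resolvent_eq) auto
      then show False using * right unfolding op_ker_eq_0_iff by blast
    next
      case False
      then have "weak_resolvent_eq (- \<mu>) (\<lambda>x. indicator {0<..} x *\<^sub>R fsol (- \<mu>) x) (\<lambda>_. 0)"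
        using assms by (intro fsol_weak_resolvent_eq) auto
      from weak_resolvent_eq_reflect[OF this]
      have "weak_resolvent_eq \<mu> (\<lambda>x. indicator {0<..} (- x) *\<^sub>R fsol (- \<mu>) (- x)) (\<lambda>_. 0)" by simp
      then have "AE x in lborel. indicator {0<..} (- x) *\<^sub>R fsol (- \<mu>) (- x) = 0"
        using * unfolding op_ker_eq_0_iff by blast
      then have "AE x in lborel. indicator {0<..} (- (0 + (-1) * x)) *\<^sub>R fsol (- \<mu>) (- (0 + (-1) * x)) = 0"
        by (intro AE_borel_affine) auto
      then have "AE x in lborel. indicator {0<..} x *\<^sub>R fsol (- \<mu>) x = 0" by simp
      then show False by (rule right)
    qed
  qed
qed

lemma square_integrable_uminus_reflect:
  assumes "square_integrable g"
  shows "square_integrable (\<lambda>x. - g (- x))"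
  using square_integrable_cmult[OF square_integrable_reflect[OF assms], of "-1"] by simp

lemma square_integrable_diff:
  assumes "square_integrable f" "square_integrable g"
  shows "square_integrable (\<lambda>x. f x - g x)"
  using square_integrable_add[OF assms(1) square_integrable_cmult[OF assms(2), of "-1"]] by simp

text \<open>The two half lines are approximated independently, the left one after reflection, and
  the approximants are added; each right-hand side is close to 0 in norm on the foreign half line,
  so the errors simply add up.\<close>

lemma op_ran_dense:
  assumes "Re \<mu> \<ge> 0 \<or> Re \<mu> \<le> - 2" "Re (- \<mu>) \<ge> 0 \<or> Re (- \<mu>) \<le> - 2"
  shows "closure (op_ran Dom_L L \<mu>) = UNIV"
proof (rule closure_op_ran_eq_UNIV)
  fix g and e :: real assume g: "square_integrable g" and "e > 0"
  \<comment> \<open>The sign accompanies the reflection, which replaces \<open>L - \<mu>\<close> by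
    \<open>- (L + \<mu>)\<close>.\<close>
  define g' where "g' x = - g (- x)" for x
  have g': "square_integrable g'"
    unfolding g'_def[abs_def] by (rule square_integrable_uminus_reflect[OF g])
  obtain v1 f1 where 1: "weak_resolvent_eq \<mu> v1 f1" "l2_norm (\<lambda>x. f1 x - indicator {0<..} x *\<^sub>R g x) < e / 2"
    using right_half_line_approx[OF assms(1) g, of "e / 2"] \<open>e > 0\<close> by auto
  obtain v2 f2 where 2: "weak_resolvent_eq (- \<mu>) v2 f2" "l2_norm (\<lambda>x. f2 x - indicator {0<..} x *\<^sub>R g' x) < e / 2"
    using right_half_line_approx[OF assms(2) g', of "e / 2"] \<open>e > 0\<close> by auto
  have s: "square_integrable f1" "square_integrable f2"
    using 1 2 by (auto simp: weak_resolvent_eq_def)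
  define a where "a x = f1 x - indicator {0<..} x *\<^sub>R g x" for x
  define b where "b x = f2 x - indicator {0<..} x *\<^sub>R g' x" for x
  have sa: "square_integrable a" "square_integrable b"
    unfolding a_def[abs_def] b_def[abs_def]
    by (intro square_integrable_diff square_integrable_indicator s g g'; simp)+
  have w: "weak_resolvent_eq \<mu> (\<lambda>x. v1 x + 1 * v2 (- x)) (\<lambda>x. f1 x + 1 * (- f2 (- x)))"
    using weak_resolvent_eq_lin_comb[OF 1(1), of "\<lambda>x. v2 (- x)" "\<lambda>x. - f2 (- x)" 1]
      weak_resolvent_eq_reflect[OF 2(1)] by simp
  have sf: "square_integrable (\<lambda>x. f1 x + 1 * (- f2 (- x)))"
    using w by (simp add: weak_resolvent_eq_def)
  have "l2_norm (\<lambda>x. f1 x + 1 * (- f2 (- x)) - g x) = l2_norm (\<lambda>x. a x + - b (- x))"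
  proof (rule l2_norm_cong_AE)
    show "square_integrable (\<lambda>x. f1 x + 1 * (- f2 (- x)) - g x)"
      by (rule square_integrable_diff[OF sf g])
    show "square_integrable (\<lambda>x. a x + - b (- x))"
      by (intro square_integrable_add sa square_integrable_uminus_reflect)
    show "AE x in lborel. f1 x + 1 * (- f2 (- x)) - g x = a x + - b (- x)"
      using AE_lborel_singleton[of 0]
      by eventually_elim (auto simp: a_def b_def g'_def indicator_def)
  qed
  also have "\<dots> \<le> l2_norm a + l2_norm (\<lambda>x. - b (- x))"
    by (intro l2_norm_triangle sa square_integrable_uminus_reflect)
  also have "l2_norm (\<lambda>x. - b (- x)) = l2_norm b"
    using l2_norm_reflect[of "\<lambda>x. - b x"] l2_norm_cmult[of "-1" b] by simp
  also have "l2_norm a + l2_norm b < e"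
    using 1(2) 2(2) by (simp add: a_def[abs_def] b_def[abs_def])
  finally show "\<exists>v f. weak_resolvent_eq \<mu> v f \<and> l2_norm (\<lambda>x. f x - g x) < e"
    using w by blast
qed

text \<open>The condition is symmetric under negation, so \<open>\<mu>\<close> and
  \<open>- \<mu>\<close> both lie outside the closed strip and each half line has an exact solution;
  the two agree with \<open>g\<close> together except at the single point 0.\<close>

lemma op_ran_full:
  assumes "\<bar>Re \<mu>\<bar> > 2"
  shows "op_ran Dom_L L \<mu> = UNIV"
  unfolding op_ran_eq_UNIV_iff
proof (intro allI impI)
  fix g assume g: "square_integrable g"
  define g' where "g' x = - g (- x)" for x
  have g': "square_integrable g'"
    unfolding g'_def[abs_def] by (rule square_integrable_uminus_reflect[OF g])
  have half: "\<exists>v. weak_resolvent_eq \<nu> v (\<lambda>x. indicator {0<..} x *\<^sub>R h x)"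
    if "\<bar>Re \<nu>\<bar> > 2" "square_integrable h" for \<nu> h
  proof -
    have "Re \<nu> > 0 \<and> max (Re \<nu>) (- 2 - Re \<nu>) = Re \<nu> \<or>
        Re \<nu> < - 2 \<and> max (Re \<nu>) (- 2 - Re \<nu>) = - 2 - Re \<nu>"
      using that(1) by auto
    then obtain k where "\<And>g. square_integrable g \<Longrightarrow>
        weak_resolvent_eq \<nu> (\<lambda>x. LINT y|lborel. k x y * g y) (\<lambda>x. indicator {0<..} x *\<^sub>R g x)"
      by (rule right_half_line_resolvent) blast
    from this[OF that(2)] show ?thesis by blast
  qed
  obtain v1 where 1: "weak_resolvent_eq \<mu> v1 (\<lambda>x. indicator {0<..} x *\<^sub>R g x)"
    using half[OF assms g] by blast
  obtain v2 where 2: "weak_resolvent_eq (- \<mu>) v2 (\<lambda>x. indicator {0<..} x *\<^sub>R g' x)"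
    using half[OF _ g', of "- \<mu>"] assms by auto
  have "weak_resolvent_eq \<mu> (\<lambda>x. v1 x + 1 * v2 (- x))
      (\<lambda>x. indicator {0<..} x *\<^sub>R g x + 1 * (- (indicator {0<..} (- x) *\<^sub>R g' (- x))))"
    using weak_resolvent_eq_lin_comb[OF 1 weak_resolvent_eq_reflect[OF 2, simplified minus_minus], of 1] .
  then have "weak_resolvent_eq \<mu> (\<lambda>x. v1 x + 1 * v2 (- x)) g"
  proof (rule weak_resolvent_eq_cong_AE[OF _ g])
    show "AE x in lborel. indicator {0<..} x *\<^sub>R g x + 1 * (- (indicator {0<..} (- x) *\<^sub>R g' (- x))) = g x"
      using AE_lborel_singleton[of 0] by eventually_elim (auto simp: g'_def indicator_def)
  qed
  then show "\<exists>v. weak_resolvent_eq \<mu> v g" by blast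
qed

lemma op_ran_not_full:
  assumes "Re \<mu> = 0 \<or> \<bar>Re \<mu>\<bar> = 2"
  shows "op_ran Dom_L L \<mu> \<noteq> UNIV"
proof
  assume full: "op_ran Dom_L L \<mu> = UNIV"
  show False
  proof (cases "Re \<mu> = 2")
    case True
    \<comment> \<open>This line is critical for the left half line only, where the relevant
      parameter is \<open>- \<mu>\<close> with real part \<open>-2\<close>; the unsolvable
      right-hand side is therefore reflected.\<close>
    then obtain g where g: "square_integrable g" "\<And>v. \<not> weak_resolvent_eq (- \<mu>) v g"
      using right_half_line_not_surjective[of "- \<mu>"] by auto
    obtain v where "weak_resolvent_eq \<mu> v (\<lambda>x. - g (- x))"
      using full square_integrable_uminus_reflect[OF g(1)] unfolding op_ran_eq_UNIV_iff by blast
    from weak_resolvent_eq_reflect[OF this] g(2) show False by simp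
  next
    case False
    then have "Re \<mu> = 0 \<or> Re \<mu> = - 2" using assms by auto
    then obtain g where "square_integrable g" "\<And>v. \<not> weak_resolvent_eq \<mu> v g"
      by (rule right_half_line_not_surjective) blast
    with full show False unfolding op_ran_eq_UNIV_iff by blast
  qed
qed

text \<open>Linearity enters through the weak equation: subtracting the equations of two preimages
  yields a homogeneous one, to which the trivial kernel applies.\<close>

lemma inj_on_resolvent_iff:
  "inj_on (\<lambda>u. L u - \<mu> *\<^sub>C u) Dom_L \<longleftrightarrow> op_ker Dom_L L \<mu> = {0}"
proof
  assume inj: "inj_on (\<lambda>u. L u - \<mu> *\<^sub>C u) Dom_L"
  have 0: "0 \<in> op_ker Dom_L L \<mu>" by (rule zero_in_op_ker)
  have "u = 0" if "u \<in> op_ker Dom_L L \<mu>" for u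
    using inj_onD[OF inj, of u 0] that 0 by (simp add: op_ker_def)
  with 0 show "op_ker Dom_L L \<mu> = {0}" by blast
next
  assume ker: "op_ker Dom_L L \<mu> = {0}"
  show "inj_on (\<lambda>u. L u - \<mu> *\<^sub>C u) Dom_L"
  proof (rule inj_onI)
    fix u1 u2 assume u: "u1 \<in> Dom_L" "u2 \<in> Dom_L" "L u1 - \<mu> *\<^sub>C u1 = L u2 - \<mu> *\<^sub>C u2"
    obtain v1 where v1: "square_integrable v1" "u1 = abs_L2 v1" by (rule L2_exhaust)
    obtain v2 where v2: "square_integrable v2" "u2 = abs_L2 v2" by (rule L2_exhaust)
    obtain g where g: "square_integrable g" "L u1 - \<mu> *\<^sub>C u1 = abs_L2 g" by (rule L2_exhaust)
    have "weak_resolvent_eq \<mu> v1 g" "weak_resolvent_eq \<mu> v2 g"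
      using L_abs_L2_eq_iff[OF v1(1) g(1), of \<mu>] L_abs_L2_eq_iff[OF v2(1) g(1), of \<mu>] u g(2)
      by (simp_all add: v1(2) v2(2))
    from weak_resolvent_eq_lin_comb[OF this, of "-1"]
    have "weak_resolvent_eq \<mu> (\<lambda>x. v1 x - v2 x) (\<lambda>_. 0)" by simp
    then have "AE x in lborel. v1 x - v2 x = 0" using ker unfolding op_ker_eq_0_iff by blast
    then show "u1 = u2" unfolding v1(2) v2(2) by (simp add: abs_L2_eq_iff v1(1) v2(1))
  qed
qed

lemma spectrum_L_iff:
  "\<mu> \<in> spectrum Dom_L L \<longleftrightarrow> op_ker Dom_L L \<mu> \<noteq> {0} \<or> op_ran Dom_L L \<mu> \<noteq> UNIV"
  by (simp add: spectrum_def bij_betw_def inj_on_resolvent_iff op_ran_def)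

theorem theorem3p2:
  shows "spectrum Dom_L L = {\<mu>. 0 \<le> \<bar>Re \<mu>\<bar> \<and> \<bar>Re \<mu>\<bar> \<le> 2} \<and>
    point_spectrum Dom_L L = {\<mu>. 0 < \<bar>Re \<mu>\<bar> \<and> \<bar>Re \<mu>\<bar> < 2} \<and>
    continuous_spectrum Dom_L L = {\<mu>. Re \<mu> = 0} \<union> {\<mu>. Re \<mu> = 2} \<union> {\<mu>. Re \<mu> = - 2} \<and>
    residual_spectrum Dom_L L = {}"
proof -
  \<comment> \<open>Neither \<open>\<mu>\<close> nor \<open>- \<mu>\<close> lies in the open strip
    between \<open>-2\<close> and 0, so the lemmas for both half lines apply.\<close>
  have outside: "(Re \<mu> \<ge> 0 \<or> Re \<mu> \<le> - 2) \<and> (Re (- \<mu>) \<ge> 0 \<or> Re (- \<mu>) \<le> - 2)"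
    if "Re \<mu> = 0 \<or> \<bar>Re \<mu>\<bar> \<ge> 2" for \<mu>
    using that by (cases "Re \<mu> \<ge> 0") auto
  have ker: "op_ker Dom_L L \<mu> = {0} \<longleftrightarrow> Re \<mu> = 0 \<or> \<bar>Re \<mu>\<bar> \<ge> 2" for \<mu>
  proof
    assume "op_ker Dom_L L \<mu> = {0}"
    then have "\<not> (0 < \<bar>Re \<mu>\<bar> \<and> \<bar>Re \<mu>\<bar> < 2)" using op_ker_nontrivial by blast
    then show "Re \<mu> = 0 \<or> \<bar>Re \<mu>\<bar> \<ge> 2" by auto
  next
    assume "Re \<mu> = 0 \<or> \<bar>Re \<mu>\<bar> \<ge> 2"
    then show "op_ker Dom_L L \<mu> = {0}" using outside op_ker_trivial by blast
  qed
  have dense: "closure (op_ran Dom_L L \<mu>) = UNIV" if "Re \<mu> = 0 \<or> \<bar>Re \<mu>\<bar> \<ge> 2" for \<mu>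
    using outside[OF that] op_ran_dense by blast
  have ran: "op_ran Dom_L L \<mu> = UNIV \<longleftrightarrow> \<bar>Re \<mu>\<bar> > 2" if "Re \<mu> = 0 \<or> \<bar>Re \<mu>\<bar> \<ge> 2" for \<mu>
  proof
    assume "op_ran Dom_L L \<mu> = UNIV"
    then have "\<not> (Re \<mu> = 0 \<or> \<bar>Re \<mu>\<bar> = 2)" using op_ran_not_full by blast
    then show "\<bar>Re \<mu>\<bar> > 2" using that by auto
  qed (rule op_ran_full)
  have "\<mu> \<in> spectrum Dom_L L \<longleftrightarrow> \<bar>Re \<mu>\<bar> \<le> 2" for \<mu>
    unfolding spectrum_L_iff ker using ran[of \<mu>] by (cases "Re \<mu> = 0 \<or> \<bar>Re \<mu>\<bar> \<ge> 2") auto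
  moreover have "\<mu> \<in> point_spectrum Dom_L L \<longleftrightarrow> 0 < \<bar>Re \<mu>\<bar> \<and> \<bar>Re \<mu>\<bar> < 2" for \<mu>
    unfolding point_spectrum_def mem_Collect_eq ker by auto
  moreover have "\<mu> \<in> continuous_spectrum Dom_L L \<longleftrightarrow> Re \<mu> = 0 \<or> Re \<mu> = 2 \<or> Re \<mu> = - 2" for \<mu>
    unfolding continuous_spectrum_def mem_Collect_eq ker using ran[of \<mu>] dense[of \<mu>]
    by (cases "Re \<mu> = 0 \<or> \<bar>Re \<mu>\<bar> \<ge> 2") auto
  moreover have "\<mu> \<notin> residual_spectrum Dom_L L" for \<mu>
    unfolding residual_spectrum_def mem_Collect_eq ker using dense[of \<mu>] by blast
  ultimately show ?thesis by auto
qed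

end
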